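(* Let $F$ be a conic nondegenerate holomorphic function on an open subset $U\subset\mathbb{C}^n$. Then the (totally complex) holomorphic immersion $\phi=dF:U\to V=T^*\mathbb{C}^n$ defines on $U$ the structure of a conic Kähler manifold $(U,J,\nabla,\omega)$ of complex dimension $n$, where $J$ is the complex structure of $U$ and $\nabla,\omega$ are the connection and symplectic form induced by $\phi$. Conversely, any conic Kähler manifold of complex dimension $n$ can be locally obtained in this way, i.e. every point has an open neighbourhood which is isomorphic, as a conic Kähler manifold, to one defined by a conic nondegenerate holomorphic function on an open subset of $\mathbb{C}^n$.
   Context: Kähler metrics are allowed to be indefinite. A local holomorphic $\mathbb{C}^*$-action on a complex manifold $M$ is a holomorphic map $(\lambda,p)\mapsto\varphi_\lambda(p)\in M$ defined on an open neighbourhood $W$ of $\{1\}\times M$ in $\mathbb{C}^*\times M$ such that $\varphi_1(p)=p$ for all $p$ and $\varphi_\lambda(\varphi_\mu(p))=\varphi_{\lambda\mu}(p)$ whenever both sides are defined. Equations involving $\varphi_\lambda$ are meant to hold locally, i.e. on any open set on which $\varphi_\lambda$ is defined and is a diffeomorphism onto its image. A conic complex manifold $(M,J,\nabla)$ is a complex manifold $(M,J)$ with a flat torsionfree connection $\nabla$ (on the real tangent bundle) admitting a local holomorphic $\mathbb{C}^*$-action $\varphi_\lambda$ such that locally $d\varphi_\lambda X=re^{\theta J}X=r(\cos\theta)X+r(\sin\theta)JX$ for all (local) $\nabla$-parallel vector fields $X$, where $\lambda=re^{i\theta}$, $r>0$. A conic Kähler manifold is a conic complex manifold with a $\nabla$-parallel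 $J$-invariant symplectic form $\omega$. A holomorphic function $F$ on an open set $U\subset\mathbb{C}^n$ is called nondegenerate if the real matrix $\left(\mathrm{Im}\,\partial^2F/\partial z^i\partial z^j\right)$ is invertible (at every point of $U$). It is called conic if its differential $dF$ is conic, which is the case if and only if $F$ is locally homogeneous of degree two, i.e. $F(\lambda z)=\lambda^2F(z)$ for all $z\in U$ and all $\lambda$ near $1\in\mathbb{C}^*$. The holomorphic $1$-form $dF$ is considered as a holomorphic immersion $U\to V=T^*\mathbb{C}^n$: in the canonical coordinates $(z^1,\dots,z^n,w_1,\dots,w_n)$ of $V$ it is $z\mapsto(z,\partial F/\partial z^1,\dots,\partial F/\partial z^n)$. An immersion $\phi$ into $V$ is totally complex if $T^*\mathbb{R}^n\cap d\phi(T_pU)=0$ for all $p$, where $T^*\mathbb{R}^n=\mathbb{R}^{2n}\subset\mathbb{C}^{2n}=V$. Put $x^i=\mathrm{Re}\,z^i$, $y_i=\mathrm{Re}\,w_i$. For a totally complex holomorphic immersion $\phi$, the functions $x^i\circ\phi,\ y_j\circ\phi$ are local coordinates around each point; the induced connection $\nabla$ is the flat torsionfree connection for which these functions are affine, and the induced symplectic form is $\omega=2\phi^*(\sum dx^i\wedge dy_i)$. *)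

theory Defs
  imports "HOL-Analysis.Analysis"
begin

section \<open>Smooth and holomorphic maps between vector spaces\<close>

primrec C_k_on ::
  "nat \<Rightarrow> ('a::real_normed_vector \<Rightarrow> 'b::real_normed_vector) \<Rightarrow> 'a set \<Rightarrow> bool" where
  "C_k_on 0 = (\<lambda>f S. continuous_on S f)"
| "C_k_on (Suc k) = (\<lambda>f S. (\<forall>x\<in>S. f differentiable (at x)) \<and>
      (\<forall>v. C_k_on k (\<lambda>x. frechet_derivative f (at x) v) S))"

text \<open>Only meant for open \<open>S\<close>, as is \<open>holo_on\<close> below.\<close>
definition smooth_on ::
  "('a::real_normed_vector \<Rightarrow> 'b::real_normed_vector) \<Rightarrow> 'a set \<Rightarrow> bool" where
  "smooth_on f S \<longleftrightarrow> (\<forall>k. C_k_on k f S)"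

text \<open>Holomorphy in several variables: real differentiable with complex linear derivative, i.e.\ one
  commuting with the multiplications by \<open>\<i>\<close>, which are passed as \<open>I\<close> (source) and \<open>I'\<close> (target).\<close>
definition holo_on ::
  "('a::real_normed_vector \<Rightarrow> 'a) \<Rightarrow> ('b::real_normed_vector \<Rightarrow> 'b) \<Rightarrow> ('a \<Rightarrow> 'b) \<Rightarrow> 'a set \<Rightarrow> bool" where
  "holo_on I I' f S \<longleftrightarrow>
    (\<forall>x\<in>S. \<exists>f'. (f has_derivative f') (at x) \<and> (\<forall>v. f' (I v) = I' (f' v)))"

definition J :: "complex^'n \<Rightarrow> complex^'n" where
  "J v = \<i> *s v"

definition J1 :: "complex \<Rightarrow> complex" where
  "J1 a = \<i> * a"


section \<open>Complex manifolds\<close>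

text \<open>A chart is a pair (domain, coordinate map). A complex manifold of complex dimension
  \<open>CARD('n)\<close> is given by its topology and a holomorphic atlas.\<close>
type_synonym ('a, 'n) chart = "'a set \<times> ('a \<Rightarrow> (complex, 'n) vec)"

definition chart_inv :: "('a, 'n::finite) chart \<Rightarrow> complex^'n \<Rightarrow> 'a" where
  "chart_inv \<kappa> = inv_into (fst \<kappa>) (snd \<kappa>)"

definition complex_manifold :: "'a topology \<Rightarrow> ('a, 'n::finite) chart set \<Rightarrow> bool" where
  "complex_manifold X A \<longleftrightarrow>
    Hausdorff_space X \<and> second_countable X \<and> (\<Union>\<kappa>\<in>A. fst \<kappa>) = topspace X \<and>
    (\<forall>\<kappa>\<in>A. openin X (fst \<kappa>) \<and> open (snd \<kappa> ` fst \<kappa>) \<and>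
       homeomorphic_map (subtopology X (fst \<kappa>)) (top_of_set (snd \<kappa> ` fst \<kappa>)) (snd \<kappa>)) \<and>
    (\<forall>\<kappa>\<in>A. \<forall>\<kappa>'\<in>A. holo_on J J (snd \<kappa>' \<circ> chart_inv \<kappa>) (snd \<kappa> ` (fst \<kappa> \<inter> fst \<kappa>')))"

text \<open>Derivative of \<open>f\<close> at the point \<open>p\<close> in the direction of the tangent vector having
  components \<open>u\<close> in the chart \<open>\<kappa>\<close>. In particular \<open>pd \<kappa> (snd \<kappa>') p u\<close> are the components of that
  tangent vector in the chart \<open>\<kappa>'\<close>.\<close>
definition pd ::
  "('a, 'n::finite) chart \<Rightarrow> ('a \<Rightarrow> 'b::real_normed_vector) \<Rightarrow> 'a \<Rightarrow> complex^'n \<Rightarrow> 'b" where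
  "pd \<kappa> f p u = frechet_derivative (f \<circ> chart_inv \<kappa>) (at (snd \<kappa> p)) u"

definition smooth_in_chart ::
  "('a, 'n::finite) chart \<Rightarrow> ('a \<Rightarrow> 'b::real_normed_vector) \<Rightarrow> 'a set \<Rightarrow> bool" where
  "smooth_in_chart \<kappa> f S \<longleftrightarrow> smooth_on (f \<circ> chart_inv \<kappa>) (snd \<kappa> ` (fst \<kappa> \<inter> S))"


section \<open>Vector fields, connections and 2-forms\<close>

text \<open>Tensor fields on the real tangent bundle are given by their components in all charts of the
  atlas; the real tangent space is \<open>complex^'n\<close> as a real vector space, with complex structure \<open>J\<close>.\<close>
type_synonym ('a, 'n) vfield = "('a, 'n) chart \<Rightarrow> 'a \<Rightarrow> (complex, 'n) vec"
type_synonym ('a, 'n) conn =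
  "('a, 'n) chart \<Rightarrow> 'a \<Rightarrow> (complex, 'n) vec \<Rightarrow> (complex, 'n) vec \<Rightarrow> (complex, 'n) vec"
type_synonym ('a, 'n) form2 =
  "('a, 'n) chart \<Rightarrow> 'a \<Rightarrow> (complex, 'n) vec \<Rightarrow> (complex, 'n) vec \<Rightarrow> real"

definition vector_field ::
  "('a, 'n::finite) chart set \<Rightarrow> 'a set \<Rightarrow> ('a, 'n) vfield \<Rightarrow> bool" where
  "vector_field A S Y \<longleftrightarrow>
    (\<forall>\<kappa>\<in>A. smooth_in_chart \<kappa> (Y \<kappa>) S) \<and>
    (\<forall>\<kappa>\<in>A. \<forall>\<kappa>'\<in>A. \<forall>p\<in>fst \<kappa> \<inter> fst \<kappa>' \<inter> S. Y \<kappa>' p = pd \<kappa> (snd \<kappa>') p (Y \<kappa> p))"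

text \<open>\<open>f\<close> maps the connection with Christoffel symbols \<open>G\<close> in the chart \<open>\<kappa>\<close> around \<open>p\<close> to the one with
  Christoffel symbols \<open>G'\<close> in the chart \<open>\<kappa>'\<close> around \<open>f p\<close>:
  \<open>G'(df u, df v) = df (G(u,v)) - d\<^sup>2f(u,v)\<close>. For \<open>f = id\<close> this is the transformation law of
  Christoffel symbols. Analogously for 2-forms.\<close>
definition conn_related where
  "conn_related \<kappa> \<kappa>' f G G' p \<longleftrightarrow>
    (\<forall>u v. G' (f p) (pd \<kappa> (snd \<kappa>' \<circ> f) p u) (pd \<kappa> (snd \<kappa>' \<circ> f) p v) =
       pd \<kappa> (snd \<kappa>' \<circ> f) p (G p u v) - pd \<kappa> (\<lambda>q. pd \<kappa> (snd \<kappa>' \<circ> f) q v) p u)"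

definition form_related where
  "form_related \<kappa> \<kappa>' f w w' p \<longleftrightarrow>
    (\<forall>u v. w' (f p) (pd \<kappa> (snd \<kappa>' \<circ> f) p u) (pd \<kappa> (snd \<kappa>' \<circ> f) p v) = w p u v)"

definition connection :: "('a, 'n::finite) chart set \<Rightarrow> ('a, 'n) conn \<Rightarrow> bool" where
  "connection A \<Gamma> \<longleftrightarrow>
    (\<forall>\<kappa>\<in>A. (\<forall>p\<in>fst \<kappa>. bilinear (\<Gamma> \<kappa> p)) \<and>
       (\<forall>u v. smooth_in_chart \<kappa> (\<lambda>p. \<Gamma> \<kappa> p u v) (fst \<kappa>))) \<and>
    (\<forall>\<kappa>\<in>A. \<forall>\<kappa>'\<in>A. \<forall>p\<in>fst \<kappa> \<inter> fst \<kappa>'. conn_related \<kappa> \<kappa>' id (\<Gamma> \<kappa>) (\<Gamma> \<kappa>') p)"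

text \<open>The covariant derivative of \<open>Y\<close> in the direction \<open>u\<close> at \<open>p\<close>, in the chart \<open>\<kappa>\<close>.\<close>
definition cov_deriv ::
  "('a, 'n::finite) conn \<Rightarrow> ('a, 'n) chart \<Rightarrow> ('a \<Rightarrow> complex^'n) \<Rightarrow> 'a \<Rightarrow> complex^'n \<Rightarrow> complex^'n" where
  "cov_deriv \<Gamma> \<kappa> Y p u = pd \<kappa> Y p u + \<Gamma> \<kappa> p u (Y p)"

definition torsionfree :: "('a, 'n::finite) chart set \<Rightarrow> ('a, 'n) conn \<Rightarrow> bool" where
  "torsionfree A \<Gamma> \<longleftrightarrow> (\<forall>\<kappa>\<in>A. \<forall>p\<in>fst \<kappa>. \<forall>u v. \<Gamma> \<kappa> p u v = \<Gamma> \<kappa> p v u)"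

text \<open>Vanishing of the curvature \<open>R(u,v)w = \<nabla>\<^sub>u \<nabla>\<^sub>v w - \<nabla>\<^sub>v \<nabla>\<^sub>u w\<close>, evaluated on coordinate vector
  fields, i.e.\ those with constant components \<open>u, v, w\<close> in the chart.\<close>
definition flat :: "('a, 'n::finite) chart set \<Rightarrow> ('a, 'n) conn \<Rightarrow> bool" where
  "flat A \<Gamma> \<longleftrightarrow> (\<forall>\<kappa>\<in>A. \<forall>p\<in>fst \<kappa>. \<forall>u v w.
    cov_deriv \<Gamma> \<kappa> (\<lambda>q. cov_deriv \<Gamma> \<kappa> (\<lambda>_. w) q v) p u -
    cov_deriv \<Gamma> \<kappa> (\<lambda>q. cov_deriv \<Gamma> \<kappa> (\<lambda>_. w) q u) p v = 0)"

definition flat_torsionfree_connection ::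
  "('a, 'n::finite) chart set \<Rightarrow> ('a, 'n) conn \<Rightarrow> bool" where
  "flat_torsionfree_connection A \<Gamma> \<longleftrightarrow> connection A \<Gamma> \<and> flat A \<Gamma> \<and> torsionfree A \<Gamma>"

definition parallel_vector_field ::
  "('a, 'n::finite) chart set \<Rightarrow> ('a, 'n) conn \<Rightarrow> 'a set \<Rightarrow> ('a, 'n) vfield \<Rightarrow> bool" where
  "parallel_vector_field A \<Gamma> S Y \<longleftrightarrow> vector_field A S Y \<and>
    (\<forall>\<kappa>\<in>A. \<forall>p\<in>fst \<kappa> \<inter> S. \<forall>u. cov_deriv \<Gamma> \<kappa> (Y \<kappa>) p u = 0)"

text \<open>\<open>\<nabla> df = 0\<close>\<close>
definition affine_function ::
  "('a, 'n::finite) chart set \<Rightarrow> ('a, 'n) conn \<Rightarrow> ('a \<Rightarrow> real) \<Rightarrow> bool" where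
  "affine_function A \<Gamma> f \<longleftrightarrow>
    (\<forall>\<kappa>\<in>A. smooth_in_chart \<kappa> f (fst \<kappa>) \<and>
      (\<forall>p\<in>fst \<kappa>. \<forall>u v. pd \<kappa> (\<lambda>q. pd \<kappa> f q v) p u - pd \<kappa> f p (\<Gamma> \<kappa> p u v) = 0))"

text \<open>The last conjunct but one is nondegeneracy, the last one closedness.\<close>
definition symplectic_form :: "('a, 'n::finite) chart set \<Rightarrow> ('a, 'n) form2 \<Rightarrow> bool" where
  "symplectic_form A \<omega> \<longleftrightarrow>
    (\<forall>\<kappa>\<in>A. \<forall>u v. smooth_in_chart \<kappa> (\<lambda>p. \<omega> \<kappa> p u v) (fst \<kappa>)) \<and>
    (\<forall>\<kappa>\<in>A. \<forall>\<kappa>'\<in>A. \<forall>p\<in>fst \<kappa> \<inter> fst \<kappa>'. form_related \<kappa> \<kappa>' id (\<omega> \<kappa>) (\<omega> \<kappa>') p) \<and>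
    (\<forall>\<kappa>\<in>A. \<forall>p\<in>fst \<kappa>. bilinear (\<omega> \<kappa> p) \<and> (\<forall>u. \<omega> \<kappa> p u u = 0) \<and>
       (\<forall>u. (\<forall>v. \<omega> \<kappa> p u v = 0) \<longrightarrow> u = 0) \<and>
       (\<forall>u v w. pd \<kappa> (\<lambda>q. \<omega> \<kappa> q v w) p u + pd \<kappa> (\<lambda>q. \<omega> \<kappa> q w u) p v +
          pd \<kappa> (\<lambda>q. \<omega> \<kappa> q u v) p w = 0))"

definition parallel_form ::
  "('a, 'n::finite) chart set \<Rightarrow> ('a, 'n) conn \<Rightarrow> ('a, 'n) form2 \<Rightarrow> bool" where
  "parallel_form A \<Gamma> \<omega> \<longleftrightarrow> (\<forall>\<kappa>\<in>A. \<forall>p\<in>fst \<kappa>. \<forall>u v w.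
    pd \<kappa> (\<lambda>q. \<omega> \<kappa> q v w) p u - \<omega> \<kappa> p (\<Gamma> \<kappa> p u v) w - \<omega> \<kappa> p v (\<Gamma> \<kappa> p u w) = 0)"

definition J_invariant :: "('a, 'n::finite) chart set \<Rightarrow> ('a, 'n) form2 \<Rightarrow> bool" where
  "J_invariant A \<omega> \<longleftrightarrow> (\<forall>\<kappa>\<in>A. \<forall>p\<in>fst \<kappa>. \<forall>u v. \<omega> \<kappa> p (J u) (J v) = \<omega> \<kappa> p u v)"


section \<open>Conic complex and conic Kaehler manifolds\<close>

definition local_action ::
  "'a topology \<Rightarrow> ('a, 'n::finite) chart set \<Rightarrow> (complex \<times> 'a) set \<Rightarrow> (complex \<Rightarrow> 'a \<Rightarrow> 'a) \<Rightarrow> bool"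
  where
  "local_action X A W \<phi> \<longleftrightarrow>
    openin (prod_topology (top_of_set (- {0})) X) W \<and>
    {1} \<times> topspace X \<subseteq> W \<and>
    continuous_map (subtopology (prod_topology (top_of_set (- {0})) X) W) X (\<lambda>(l, p). \<phi> l p) \<and>
    (\<forall>\<kappa>\<in>A. \<forall>\<kappa>'\<in>A. holo_on (map_prod J1 J) J
       (\<lambda>(l, x). snd \<kappa>' (\<phi> l (chart_inv \<kappa> x)))
       {(l, snd \<kappa> p) | l p. (l, p) \<in> W \<and> p \<in> fst \<kappa> \<and> \<phi> l p \<in> fst \<kappa>'}) \<and>
    (\<forall>p\<in>topspace X. \<phi> 1 p = p) \<and>
    (\<forall>l m p. (m, p) \<in> W \<longrightarrow> (l, \<phi> m p) \<in> W \<longrightarrow> (l * m, p) \<in> W \<longrightarrow>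
       \<phi> l (\<phi> m p) = \<phi> (l * m) p)"

text \<open>The local equation \<open>d\<phi>\<^sub>l Y = r (cos \<theta>) Y + r (sin \<theta>) J Y\<close> for \<open>l = r e\<^bsup>i\<theta>\<^esup>\<close>; here
  \<open>r cos \<theta> = Re l\<close> and \<open>r sin \<theta> = Im l\<close>. A parallel field \<open>Y\<close> on \<open>S\<close> is compared at \<open>p\<close> and at
  \<open>\<phi>\<^sub>l p\<close> whenever \<open>l\<close> can be joined to 1 such that the orbit of \<open>p\<close> stays in \<open>S\<close>. For other \<open>l\<close> the
  values of \<open>Y\<close> at the two points may be unrelated (different components of \<open>S\<close>, holonomy).\<close>
definition conic_action ::
  "('a topology) \<Rightarrow> ('a, 'n::finite) chart set \<Rightarrow> ('a, 'n) conn \<Rightarrow>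
   (complex \<times> 'a) set \<Rightarrow> (complex \<Rightarrow> 'a \<Rightarrow> 'a) \<Rightarrow> bool" where
  "conic_action X A \<Gamma> W \<phi> \<longleftrightarrow>
    (\<forall>S Y. openin X S \<longrightarrow> parallel_vector_field A \<Gamma> S Y \<longrightarrow>
      (\<forall>p\<in>S. \<forall>l\<in>connected_component_set {m. (m, p) \<in> W \<and> \<phi> m p \<in> S} 1.
        \<forall>\<kappa>\<in>A. \<forall>\<kappa>'\<in>A. p \<in> fst \<kappa> \<longrightarrow> \<phi> l p \<in> fst \<kappa>' \<longrightarrow>
          pd \<kappa> (snd \<kappa>' \<circ> \<phi> l) p (Y \<kappa> p) =
            Re l *\<^sub>R Y \<kappa>' (\<phi> l p) + Im l *\<^sub>R J (Y \<kappa>' (\<phi> l p))))"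

definition conic_complex_manifold ::
  "'a topology \<Rightarrow> ('a, 'n::finite) chart set \<Rightarrow> ('a, 'n) conn \<Rightarrow> bool" where
  "conic_complex_manifold X A \<Gamma> \<longleftrightarrow>
    complex_manifold X A \<and> flat_torsionfree_connection A \<Gamma> \<and>
    (\<exists>W \<phi>. local_action X A W \<phi> \<and> conic_action X A \<Gamma> W \<phi>)"

definition conic_Kaehler_manifold ::
  "'a topology \<Rightarrow> ('a, 'n::finite) chart set \<Rightarrow> ('a, 'n) conn \<Rightarrow> ('a, 'n) form2 \<Rightarrow> bool" where
  "conic_Kaehler_manifold X A \<Gamma> \<omega> \<longleftrightarrow>
    conic_complex_manifold X A \<Gamma> \<and>
    symplectic_form A \<omega> \<and> parallel_form A \<Gamma> \<omega> \<and> J_invariant A \<omega>"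

definition holo_map_on ::
  "('a, 'n::finite) chart set \<Rightarrow> ('b, 'm::finite) chart set \<Rightarrow> 'a set \<Rightarrow> ('a \<Rightarrow> 'b) \<Rightarrow> bool" where
  "holo_map_on A B S f \<longleftrightarrow> (\<forall>\<kappa>\<in>A. \<forall>\<kappa>'\<in>B.
    holo_on J J (snd \<kappa>' \<circ> f \<circ> chart_inv \<kappa>) (snd \<kappa> ` {p \<in> fst \<kappa> \<inter> S. f p \<in> fst \<kappa>'}))"

text \<open>\<open>f\<close> is an isomorphism from the open submanifold \<open>N\<close> of \<open>(X, A, \<Gamma>, \<omega>)\<close> onto \<open>(Y, B, \<Delta>, \<eta>)\<close>.\<close>
definition conic_Kaehler_iso_on ::
  "'a set \<Rightarrow> 'a topology \<Rightarrow> ('a, 'n::finite) chart set \<Rightarrow> ('a, 'n) conn \<Rightarrow> ('a, 'n) form2 \<Rightarrow>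
   'b topology \<Rightarrow> ('b, 'n) chart set \<Rightarrow> ('b, 'n) conn \<Rightarrow> ('b, 'n) form2 \<Rightarrow> ('a \<Rightarrow> 'b) \<Rightarrow> bool" where
  "conic_Kaehler_iso_on N X A \<Gamma> \<omega> Y B \<Delta> \<eta> f \<longleftrightarrow>
    homeomorphic_map (subtopology X N) Y f \<and>
    holo_map_on A B N f \<and> holo_map_on B A (topspace Y) (inv_into N f) \<and>
    (\<forall>\<kappa>\<in>A. \<forall>\<kappa>'\<in>B. \<forall>p\<in>fst \<kappa> \<inter> N. f p \<in> fst \<kappa>' \<longrightarrow>
      conn_related \<kappa> \<kappa>' f (\<Gamma> \<kappa>) (\<Delta> \<kappa>') p \<and> form_related \<kappa> \<kappa>' f (\<omega> \<kappa>) (\<eta> \<kappa>') p)"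


section \<open>Structures induced by a holomorphic function on an open set\<close>

definition std_atlas :: "(complex^'n) set \<Rightarrow> (complex^'n, 'n::finite) chart set" where
  "std_atlas U = {(U, id)}"

definition holo_fun_on :: "(complex^'n \<Rightarrow> complex) \<Rightarrow> (complex^'n) set \<Rightarrow> bool" where
  "holo_fun_on F U \<longleftrightarrow> holo_on J J1 F U"

text \<open>\<open>\<partial>F/\<partial>z\<^sup>i\<close>\<close>
definition dz :: "'n \<Rightarrow> (complex^'n \<Rightarrow> complex) \<Rightarrow> complex^'n \<Rightarrow> complex" where
  "dz i F z = deriv (\<lambda>t. F (z + t *s axis i 1)) 0"

definition nondegenerate_fun :: "(complex^'n \<Rightarrow> complex) \<Rightarrow> (complex^'n) set \<Rightarrow> bool" where
  "nondegenerate_fun F U \<longleftrightarrow>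
    (\<forall>z\<in>U. invertible (\<chi> i j. Im (dz i (dz j F) z) :: real^'n^'n))"

definition conic_fun :: "(complex^'n \<Rightarrow> complex) \<Rightarrow> (complex^'n) set \<Rightarrow> bool" where
  "conic_fun F U \<longleftrightarrow> (\<forall>z\<in>U. \<forall>\<^sub>F l in nhds 1. F (l *s z) = l\<^sup>2 * F z)"

text \<open>\<open>V = T\<^sup>*\<complex>\<^sup>n\<close> with canonical coordinates \<open>(z, w)\<close>; \<open>x\<^sup>i = Re z\<^sup>i\<close>, \<open>y\<^sub>i = Re w\<^sub>i\<close>.\<close>
type_synonym 'n cotangent = "(complex, 'n) vec \<times> (complex, 'n) vec"

definition dF :: "(complex^'n \<Rightarrow> complex) \<Rightarrow> complex^'n \<Rightarrow> ('n::finite) cotangent" where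
  "dF F z = (z, \<chi> i. dz i F z)"

definition xcoord :: "'n \<Rightarrow> ('n::finite) cotangent \<Rightarrow> real" where
  "xcoord i v = Re (fst v $ i)"

definition ycoord :: "'n \<Rightarrow> ('n::finite) cotangent \<Rightarrow> real" where
  "ycoord i v = Re (snd v $ i)"

definition holo_immersion_on ::
  "(complex^'n \<Rightarrow> ('n::finite) cotangent) \<Rightarrow> (complex^'n) set \<Rightarrow> bool" where
  "holo_immersion_on \<phi> U \<longleftrightarrow>
    holo_on J (map_prod J J) \<phi> U \<and> (\<forall>z\<in>U. inj (frechet_derivative \<phi> (at z)))"

definition real_cotangent :: "('n::finite) cotangent set" where
  "real_cotangent = {v. (\<forall>i. fst v $ i \<in> \<real>) \<and> (\<forall>i. snd v $ i \<in> \<real>)}"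

definition totally_complex_on ::
  "(complex^'n \<Rightarrow> ('n::finite) cotangent) \<Rightarrow> (complex^'n) set \<Rightarrow> bool" where
  "totally_complex_on \<phi> U \<longleftrightarrow>
    (\<forall>z\<in>U. real_cotangent \<inter> range (frechet_derivative \<phi> (at z)) = {0})"

definition induced_connection ::
  "(complex^'n \<Rightarrow> ('n::finite) cotangent) \<Rightarrow> (complex^'n) set \<Rightarrow> (complex^'n, 'n) conn \<Rightarrow> bool" where
  "induced_connection \<phi> U \<Gamma> \<longleftrightarrow>
    flat_torsionfree_connection (std_atlas U) \<Gamma> \<and>
    (\<forall>i. affine_function (std_atlas U) \<Gamma> (xcoord i \<circ> \<phi>) \<and>
         affine_function (std_atlas U) \<Gamma> (ycoord i \<circ> \<phi>))"

text \<open>\<open>\<omega> = 2 \<phi>\<^sup>*(\<Sum> dx\<^sup>i \<and> dy\<^sub>i)\<close>; the coordinates \<open>x\<^sup>i, y\<^sub>i\<close> are linear, so they are their own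
  differentials.\<close>
definition induced_form ::
  "(complex^'n \<Rightarrow> ('n::finite) cotangent) \<Rightarrow> (complex^'n, 'n) form2" where
  "induced_form \<phi> \<kappa> p u v = 2 * (\<Sum>i\<in>UNIV.
     xcoord i (pd \<kappa> \<phi> p u) * ycoord i (pd \<kappa> \<phi> p v) -
     xcoord i (pd \<kappa> \<phi> p v) * ycoord i (pd \<kappa> \<phi> p u))"

end

theory Submission
  imports Defs "HOL-Complex_Analysis.Cauchy_Integral_Formula"
begin

text \<open>For \<open>\<phi> = dF\<close> the map \<open>\<psi> = (Re z, Re \<partial>F)\<close> is a local diffeomorphism exactly when \<open>F\<close> is
  nondegenerate, and the induced connection is \<open>(D\<psi>)\<inverse> D\<^sup>2\<psi>\<close>. Euler's relation makes \<open>D\<^sup>2\<partial>F\<close> vanish on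
  the radial direction, so that parallel fields are constant along the orbits of scalar multiplication,
  which therefore is a conic action.

  Conversely, let \<open>\<xi>\<close> generate the action of a conic Kaehler manifold. Differentiating the defining
  equation of the action at \<open>1\<close> in the directions \<open>1\<close> and \<open>\<i>\<close> gives \<open>\<nabla>\<xi> = id\<close> and \<open>\<nabla>(J\<xi>) = J\<close>.
  Hence for a parallel field \<open>Y\<close> the function \<open>Z\<^sub>Y = \<omega>(Y, \<xi>) - \<i> \<omega>(Y, J\<xi>)\<close> is holomorphic, its real part is
  affine, and \<open>dZ\<^sub>Y(\<xi>) = Z\<^sub>Y\<close>. Parallel fields extending a Lagrangian and totally real frame at a point,
  obtained by diagonalising an indefinite Hermitian form, yield in this way functions \<open>z\<^sup>i\<close>, \<open>w\<^sub>i\<close> such that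
  the \<open>z\<^sup>i\<close> are local holomorphic coordinates and \<open>\<omega> = 2 \<Sum> d Re z\<^sup>i \<and> d Re w\<^sub>i\<close>. Since \<open>\<omega>\<close> is
  \<open>J\<close>-invariant, \<open>\<Sum> dz\<^sup>i \<and> dw\<^sub>i = 0\<close>; contracting with \<open>\<xi>\<close> shows that \<open>F = (1/2) \<Sum> z\<^sup>i w\<^sub>i\<close> satisfies
  \<open>dF = \<Sum> w\<^sub>i dz\<^sup>i\<close>.\<close>

section \<open>Smooth maps\<close>

text \<open>The obstacle behind the converse is that J need not be parallel. So \<nabla>(J\<xi>) = J
  does not follow from \<nabla>\<xi> = id and has to be read off from the complex directions of the
  action; and a frame v, J v at a point extends to parallel fields Y, Y' where Y' may differ from J
  Y elsewhere. The functions z^i are therefore controlled only at the centre, and the inverse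
  function theorem does the rest. A Lagrangian frame alone would not do: in indefinite signature a
  Lagrangian subspace can be J-invariant, and then the dz^i are dependent at the point.
  Diagonalising with signs excludes this. A conic action is tested on parallel fields only, so its
  definition says nothing until such fields are known to exist. The connection being given by
  Christoffel symbols, their existence is a Frobenius-type theorem, proved by Picard iteration.
  Holomorphic means differentiable with complex linear derivative, whereas fields, connections and
  forms must have derivatives of all orders; Osgood's lemma connects the two notions.\<close>

abbreviation fd :: "('a::real_normed_vector \<Rightarrow> 'b::real_normed_vector) \<Rightarrow> 'a \<Rightarrow> 'a \<Rightarrow> 'b" where
  "fd f x \<equiv> frechet_derivative f (at x)"

lemma fd_eq: "(f has_derivative f') (at x) \<Longrightarrow> fd f x = f'"
  by (simp add: frechet_derivative_at[symmetric])

text \<open>Differentiability is not assumed: \<open>frechet_derivative\<close> is a choice among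
  all derivatives, and the two functions have the same ones at \<open>x\<close>.\<close>

lemma fd_cong:
  assumes "open S" "x \<in> S" "\<And>y. y \<in> S \<Longrightarrow> f y = g y"
  shows "fd f x = fd g x"
proof -
  have "(f has_derivative D) (at x) \<longleftrightarrow> (g has_derivative D) (at x)" for D
    using has_derivative_transform_within_open[of f D x UNIV S g]
      has_derivative_transform_within_open[of g D x UNIV S f] assms by auto
  then show ?thesis by (simp add: frechet_derivative_def)
qed

lemma C_k_on_cong:
  assumes "open S" "\<And>x. x \<in> S \<Longrightarrow> f x = g x" "C_k_on k f S"
  shows "C_k_on k g S"
  using assms(2,3)
proof (induction k arbitrary: f g)
  case 0 then show ?case by (simp cong: continuous_on_cong)
next
  case (Suc k)
  have "g differentiable at x" if "x \<in> S" for x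
    using Suc.prems that \<open>open S\<close>
    by (metis C_k_on.simps(2) differentiable_def has_derivative_transform_within_open)
  moreover have "C_k_on k (\<lambda>x. fd g x v) S" for v
  proof (rule Suc.IH)
    show "C_k_on k (\<lambda>x. fd f x v) S" using Suc.prems by simp
    show "fd f x v = fd g x v" if "x \<in> S" for x
      using fd_cong[OF \<open>open S\<close> that Suc.prems(1)] by simp
  qed
  ultimately show ?case by simp
qed

lemma C_k_on_subset: "C_k_on k f S \<Longrightarrow> T \<subseteq> S \<Longrightarrow> C_k_on k f T"
  by (induction k arbitrary: f) (auto intro: continuous_on_subset)

lemma C_k_on_SucI:
  assumes "open S" "\<And>x. x \<in> S \<Longrightarrow> (f has_derivative f' x) (at x)" "\<And>v. C_k_on k (\<lambda>x. f' x v) S"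
  shows "C_k_on (Suc k) f S"
proof -
  have "C_k_on k (\<lambda>x. fd f x v) S" for v
    by (rule C_k_on_cong[OF assms(1) _ assms(3)]) (simp add: fd_eq[OF assms(2)])
  then show ?thesis using assms(2) by (auto simp: differentiable_def)
qed

lemma C_k_on_SucD: "C_k_on (Suc k) f S \<Longrightarrow> C_k_on k f S"
  by (induction k arbitrary: f)
    (auto intro: differentiable_imp_continuous_within continuous_at_imp_continuous_on)

lemma C_k_on_imp_continuous: "C_k_on k f S \<Longrightarrow> continuous_on S f"
  by (cases k) (auto intro: differentiable_imp_continuous_within continuous_at_imp_continuous_on)

lemma C_k_on_has_derivative: "C_k_on (Suc k) f S \<Longrightarrow> x \<in> S \<Longrightarrow> (f has_derivative fd f x) (at x)"
  by (auto simp: frechet_derivative_works)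

lemma C_k_on_fd: "C_k_on (Suc k) f S \<Longrightarrow> C_k_on k (\<lambda>x. fd f x v) S"
  by simp

lemma C_k_on_const: "C_k_on k (\<lambda>x. c) S"
proof (induction k arbitrary: c)
  case (Suc k)
  show ?case
    unfolding C_k_on.simps frechet_derivative_const using Suc.IH[of 0] differentiable_const by blast
qed simp

lemma C_k_on_linear:
  assumes "open S" "bounded_linear f"
  shows "C_k_on k f S"
proof (cases k)
  case (Suc m)
  show ?thesis unfolding Suc
    by (rule C_k_on_SucI[OF assms(1) bounded_linear_imp_has_derivative[OF assms(2)] C_k_on_const])
qed (simp add: linear_continuous_on assms)

lemma C_k_on_linear_compose:
  assumes "open S" "bounded_linear h" "C_k_on k f S"
  shows "C_k_on k (\<lambda>x. h (f x)) S"
  using assms(3)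
proof (induction k arbitrary: f)
  case 0 then show ?case
    using bounded_linear.continuous_on[OF assms(2)] by simp
next
  case (Suc k)
  show ?case
  proof (rule C_k_on_SucI[OF \<open>open S\<close>])
    show "((\<lambda>x. h (f x)) has_derivative (\<lambda>v. h (fd f x v))) (at x)" if "x \<in> S" for x
      by (rule bounded_linear.has_derivative[OF assms(2) C_k_on_has_derivative[OF Suc.prems that]])
    show "C_k_on k (\<lambda>x. h (fd f x v)) S" for v
      by (rule Suc.IH[OF C_k_on_fd[OF Suc.prems]])
  qed
qed

lemma C_k_on_add:
  assumes "open S" "C_k_on k f S" "C_k_on k g S"
  shows "C_k_on k (\<lambda>x. f x + g x) S"
  using assms(2,3)
proof (induction k arbitrary: f g)
  case 0 then show ?case by (auto intro: continuous_intros)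
next
  case (Suc k)
  show ?case
  proof (rule C_k_on_SucI[OF \<open>open S\<close>])
    show "((\<lambda>x. f x + g x) has_derivative (\<lambda>v. fd f x v + fd g x v)) (at x)" if "x \<in> S" for x
      using Suc.prems that by (intro has_derivative_add C_k_on_has_derivative)
    show "C_k_on k (\<lambda>x. fd f x v + fd g x v) S" for v
      by (rule Suc.IH[OF Suc.prems[THEN C_k_on_fd]])
  qed
qed

lemma C_k_on_sum:
  assumes "open S" "\<And>i. i \<in> I \<Longrightarrow> C_k_on k (f i) S"
  shows "C_k_on k (\<lambda>x. \<Sum>i\<in>I. f i x) S"
  using assms(2)
  by (induction I rule: infinite_finite_induct) (auto intro!: C_k_on_const C_k_on_add[OF \<open>open S\<close>])

lemma C_k_on_bilinear:
  assumes "open S" "bounded_bilinear h" "C_k_on k f S" "C_k_on k g S"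
  shows "C_k_on k (\<lambda>x. h (f x) (g x)) S"
  using assms(3,4)
proof (induction k arbitrary: f g)
  case 0 then show ?case
    using bounded_bilinear.continuous_on[OF assms(2)] by simp
next
  case (Suc k)
  show ?case
  proof (rule C_k_on_SucI[OF \<open>open S\<close>])
    show "((\<lambda>x. h (f x) (g x)) has_derivative (\<lambda>v. h (f x) (fd g x v) + h (fd f x v) (g x))) (at x)"
      if "x \<in> S" for x
      using Suc.prems that by (intro bounded_bilinear.FDERIV[OF assms(2)] C_k_on_has_derivative)
    show "C_k_on k (\<lambda>x. h (f x) (fd g x v) + h (fd f x v) (g x)) S" for v
      by (intro C_k_on_add[OF \<open>open S\<close>] Suc.IH C_k_on_fd Suc.prems C_k_on_SucD)
  qed
qed

lemma linear_apply_basis: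
  fixes A :: "'b::euclidean_space \<Rightarrow> 'c::real_normed_vector"
  assumes "linear A" shows "A y = (\<Sum>i\<in>Basis. (y \<bullet> i) *\<^sub>R A i)"
proof -
  have "A y = A (\<Sum>i\<in>Basis. (y \<bullet> i) *\<^sub>R i)"
    by (simp only: euclidean_representation)
  then show ?thesis by (simp only: linear_sum[OF assms] linear_cmul[OF assms])
qed

text \<open>The family \<open>A\<close> is known to be \<open>C_k_on\<close> only on each fixed
  vector, so \<open>b x\<close> is expanded in a basis. This vectorwise form matches the recursion
  in \<open>C_k_on\<close>, where derivatives are also taken one direction at a time.\<close>

lemma C_k_on_apply:
  fixes A :: "'a::real_normed_vector \<Rightarrow> 'b::euclidean_space \<Rightarrow> 'c::real_normed_vector"
  assumes "open S" "\<And>x. x \<in> S \<Longrightarrow> linear (A x)" "\<And>w. C_k_on k (\<lambda>x. A x w) S" "C_k_on k b S"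
  shows "C_k_on k (\<lambda>x. A x (b x)) S"
proof (rule C_k_on_cong[OF \<open>open S\<close>])
  show "(\<Sum>i\<in>Basis. (b x \<bullet> i) *\<^sub>R A x i) = A x (b x)" if "x \<in> S" for x
    by (rule linear_apply_basis[OF assms(2)[OF that], symmetric])
  show "C_k_on k (\<lambda>x. \<Sum>i\<in>Basis. (b x \<bullet> i) *\<^sub>R A x i) S"
    by (intro C_k_on_sum[OF \<open>open S\<close>] C_k_on_bilinear[OF \<open>open S\<close> bounded_bilinear_scaleR] assms
        C_k_on_linear_compose[OF \<open>open S\<close> bounded_linear_inner_left])
qed

lemma has_derivative_apply:
  fixes A :: "'a::real_normed_vector \<Rightarrow> 'b::euclidean_space \<Rightarrow> 'c::real_normed_vector"
  assumes "open S" "x \<in> S" "\<And>y. y \<in> S \<Longrightarrow> linear (A y)"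
    and A': "\<And>w. ((\<lambda>y. A y w) has_derivative (\<lambda>u. A' u w)) (at x)"
    and b: "(b has_derivative b') (at x)"
  shows "((\<lambda>y. A y (b y)) has_derivative (\<lambda>u. A' u (b x) + A x (b' u))) (at x)"
proof -
  have lin: "A y w = (\<Sum>i\<in>Basis. (w \<bullet> i) *\<^sub>R A y i)" if "y \<in> S" for y w
    by (rule linear_apply_basis[OF assms(3)[OF that]])
  have "((\<lambda>y. \<Sum>i\<in>Basis. (w \<bullet> i) *\<^sub>R A y i) has_derivative (\<lambda>u. \<Sum>i\<in>Basis. (w \<bullet> i) *\<^sub>R A' u i)) (at x)" for w
    by (auto intro!: derivative_eq_intros A')
  \<comment> \<open>Linearity of \<open>A' u\<close> in \<open>w\<close> is deduced from uniqueness
    of the derivative.\<close>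
  from has_derivative_transform_within_open[OF this \<open>open S\<close> \<open>x \<in> S\<close> lin[symmetric]]
  have *: "(\<lambda>u. \<Sum>i\<in>Basis. (w \<bullet> i) *\<^sub>R A' u i) = (\<lambda>u. A' u w)" for w
    using A' has_derivative_unique by blast
  have "((\<lambda>y. \<Sum>i\<in>Basis. (b y \<bullet> i) *\<^sub>R A y i) has_derivative
      (\<lambda>u. \<Sum>i\<in>Basis. (b x \<bullet> i) *\<^sub>R A' u i + (b' u \<bullet> i) *\<^sub>R A x i)) (at x)"
    by (auto intro!: derivative_eq_intros A' b)
  then have "((\<lambda>y. \<Sum>i\<in>Basis. (b y \<bullet> i) *\<^sub>R A y i) has_derivative (\<lambda>u. A' u (b x) + A x (b' u))) (at x)"
    by (simp only: sum.distrib lin[OF \<open>x \<in> S\<close>, symmetric] fun_cong[OF *, of "b x"])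
  then show ?thesis
    by (rule has_derivative_transform_within_open[OF _ \<open>open S\<close> \<open>x \<in> S\<close> lin[symmetric]])
qed

lemma C_k_on_compose:
  fixes g :: "'a::real_normed_vector \<Rightarrow> 'b::euclidean_space" and f :: "'b \<Rightarrow> 'c::real_normed_vector"
  assumes "open S" "C_k_on k g S" "C_k_on k f T" "g ` S \<subseteq> T"
  shows "C_k_on k (\<lambda>x. f (g x)) S"
  using assms(2,3)
proof (induction k arbitrary: f)
  case 0 then show ?case using continuous_on_compose2[OF _ _ assms(4)] by auto
next
  case (Suc k)
  have f: "(f has_derivative fd f y) (at y)" if "y \<in> T" for y
    using C_k_on_has_derivative[OF Suc.prems(2) that] .
  show ?case
  proof (rule C_k_on_SucI[OF \<open>open S\<close>])
    show "((\<lambda>x. f (g x)) has_derivative (\<lambda>v. fd f (g x) (fd g x v))) (at x)" if "x \<in> S" for x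
      using that assms(4) f C_k_on_has_derivative[OF Suc.prems(1)]
      by (intro has_derivative_compose[of g _ x UNIV f]) auto
    show "C_k_on k (\<lambda>x. fd f (g x) (fd g x v)) S" for v
    proof (rule C_k_on_apply[OF \<open>open S\<close>])
      show "linear (fd f (g x))" if "x \<in> S" for x
        using f[of "g x"] that assms(4) has_derivative_linear by blast
      show "C_k_on k (\<lambda>x. fd f (g x) w) S" for w
        by (rule Suc.IH[OF C_k_on_SucD[OF Suc.prems(1)] C_k_on_fd[OF Suc.prems(2)]])
      show "C_k_on k (\<lambda>x. fd g x v) S" by (rule C_k_on_fd[OF Suc.prems(1)])
    qed
  qed
qed

text \<open>The derivative is a polynomial in the function itself, so the induction closes. This
  yields smooth quotients, used for Cramer's rule.\<close>

lemma C_k_on_inverse: "C_k_on k (\<lambda>x::real. inverse x) (- {0})"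
proof (induction k)
  case 0 then show ?case by (auto intro!: continuous_intros)
next
  case (Suc k)
  have "C_k_on k (\<lambda>x::real. - (v * (inverse x * inverse x))) (- {0})" for v
    by (intro C_k_on_linear_compose[where h="\<lambda>x. - x"] C_k_on_bilinear[OF _ bounded_bilinear_mult]
        C_k_on_const Suc bounded_linear_minus bounded_linear_ident) auto
  then show ?case
    by (intro C_k_on_SucI[where f'="\<lambda>x v. - (v * (inverse x * inverse x))"])
       (auto intro!: derivative_eq_intros simp: field_simps)
qed

lemma smooth_on_cong: "open S \<Longrightarrow> (\<And>x. x \<in> S \<Longrightarrow> f x = g x) \<Longrightarrow> smooth_on f S \<Longrightarrow> smooth_on g S"
  unfolding smooth_on_def using C_k_on_cong by blast
lemma smooth_on_subset: "smooth_on f S \<Longrightarrow> T \<subseteq> S \<Longrightarrow> smooth_on f T"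
  unfolding smooth_on_def using C_k_on_subset by blast
lemma smooth_on_imp_continuous: "smooth_on f S \<Longrightarrow> continuous_on S f"
  unfolding smooth_on_def using C_k_on_imp_continuous by blast
lemma smooth_on_has_derivative: "smooth_on f S \<Longrightarrow> x \<in> S \<Longrightarrow> (f has_derivative fd f x) (at x)"
  unfolding smooth_on_def using C_k_on_has_derivative by blast
lemma smooth_on_fd: "smooth_on f S \<Longrightarrow> smooth_on (\<lambda>x. fd f x v) S"
  unfolding smooth_on_def by (metis C_k_on.simps(2))
lemma smooth_on_const: "smooth_on (\<lambda>x. c) S"
  by (simp add: smooth_on_def C_k_on_const)
lemma smooth_on_linear: "open S \<Longrightarrow> bounded_linear f \<Longrightarrow> smooth_on f S"
  by (simp add: smooth_on_def C_k_on_linear)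
lemma smooth_on_linear_compose:
  "open S \<Longrightarrow> bounded_linear h \<Longrightarrow> smooth_on f S \<Longrightarrow> smooth_on (\<lambda>x. h (f x)) S"
  by (simp add: smooth_on_def C_k_on_linear_compose)
lemma smooth_on_add: "open S \<Longrightarrow> smooth_on f S \<Longrightarrow> smooth_on g S \<Longrightarrow> smooth_on (\<lambda>x. f x + g x) S"
  by (simp add: smooth_on_def C_k_on_add)
lemma smooth_on_sum:
  "open S \<Longrightarrow> (\<And>i. i \<in> I \<Longrightarrow> smooth_on (f i) S) \<Longrightarrow> smooth_on (\<lambda>x. \<Sum>i\<in>I. f i x) S"
  by (simp add: smooth_on_def C_k_on_sum)
lemma smooth_on_bilinear:
  "open S \<Longrightarrow> bounded_bilinear h \<Longrightarrow> smooth_on f S \<Longrightarrow> smooth_on g S \<Longrightarrow> smooth_on (\<lambda>x. h (f x) (g x)) S"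
  by (simp add: smooth_on_def C_k_on_bilinear)
lemma smooth_on_mult:
  fixes f g :: "'a::real_normed_vector \<Rightarrow> 'b::real_normed_algebra"
  shows "open S \<Longrightarrow> smooth_on f S \<Longrightarrow> smooth_on g S \<Longrightarrow> smooth_on (\<lambda>x. f x * g x) S"
  by (rule smooth_on_bilinear[OF _ bounded_bilinear_mult])
lemma smooth_on_prod:
  fixes f :: "'i \<Rightarrow> 'a::real_normed_vector \<Rightarrow> 'b::{real_normed_algebra, comm_ring_1}"
  assumes "open S" "\<And>i. i \<in> I \<Longrightarrow> smooth_on (f i) S"
  shows "smooth_on (\<lambda>x. \<Prod>i\<in>I. f i x) S"
  using assms(2)
  by (induction I rule: infinite_finite_induct) (auto intro!: smooth_on_const smooth_on_mult[OF \<open>open S\<close>])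
lemma smooth_on_apply:
  fixes A :: "'a::real_normed_vector \<Rightarrow> 'b::euclidean_space \<Rightarrow> 'c::real_normed_vector"
  shows "open S \<Longrightarrow> (\<And>x. x \<in> S \<Longrightarrow> linear (A x)) \<Longrightarrow> (\<And>w. smooth_on (\<lambda>x. A x w) S) \<Longrightarrow> smooth_on b S
    \<Longrightarrow> smooth_on (\<lambda>x. A x (b x)) S"
  by (simp add: smooth_on_def C_k_on_apply)
lemma smooth_on_compose:
  fixes g :: "'a::real_normed_vector \<Rightarrow> 'b::euclidean_space"
  shows "open S \<Longrightarrow> smooth_on g S \<Longrightarrow> smooth_on f T \<Longrightarrow> g ` S \<subseteq> T \<Longrightarrow> smooth_on (\<lambda>x. f (g x)) S"
  unfolding smooth_on_def using C_k_on_compose by blast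
lemma smooth_on_divide:
  fixes f g :: "'a::real_normed_vector \<Rightarrow> real"
  assumes "open S" "smooth_on f S" "smooth_on g S" "\<And>x. x \<in> S \<Longrightarrow> g x \<noteq> 0"
  shows "smooth_on (\<lambda>x. f x / g x) S"
proof -
  have "smooth_on (\<lambda>x. inverse (g x)) S"
    by (rule smooth_on_compose[OF assms(1,3), of _ "- {0}"]) (use assms(4) in \<open>auto simp: smooth_on_def C_k_on_inverse\<close>)
  then show ?thesis
    unfolding divide_inverse by (intro smooth_on_mult assms)
qed

section \<open>Differentiation under the integral sign and symmetry of second derivatives\<close>

lemma leibniz_rule_fd:
  fixes f :: "'a::euclidean_space \<Rightarrow> real \<Rightarrow> 'c::banach"
  assumes "open U" "convex U" "x0 \<in> U"
    and f: "\<And>x t. x \<in> U \<Longrightarrow> t \<in> {a..b} \<Longrightarrow> ((\<lambda>x. f x t) has_derivative f' x t) (at x)"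
    and cont: "\<And>v. continuous_on (U \<times> {a..b}) (\<lambda>(x, t). f' x t v)"
    and contf: "\<And>x. x \<in> U \<Longrightarrow> continuous_on {a..b} (f x)"
  shows "((\<lambda>x. integral {a..b} (f x)) has_derivative (\<lambda>v. integral {a..b} (\<lambda>t. f' x0 t v))) (at x0)"
proof -
  \<comment> \<open>The derivative is turned into a bounded linear function for
    \<open>leibniz_rule\<close>; in finite dimension, continuity in each fixed direction
    \<open>v\<close> makes it continuous in norm.\<close>
  have B: "blinfun_apply (Blinfun (f' x t)) = f' x t" if "x \<in> U" "t \<in> {a..b}" for x t
    using f[OF that] has_derivative_bounded_linear bounded_linear_Blinfun_apply by blast
  have c: "continuous_on (U \<times> {a..b}) (\<lambda>(x, t). Blinfun (f' x t))"
  proof (rule continuous_on_blinfun_componentwise)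
    fix i :: 'a
    show "continuous_on (U \<times> {a..b}) (\<lambda>x. blinfun_apply (case x of (x, t) \<Rightarrow> Blinfun (f' x t)) i)"
      by (rule continuous_on_eq[OF cont[of i]]) (use B in auto)
  qed
  have "((\<lambda>x. integral {a..b} (f x)) has_derivative integral {a..b} (\<lambda>t. Blinfun (f' x0 t))) (at x0 within U)"
    unfolding cbox_interval[symmetric]
    by (rule leibniz_rule) (use assms c B in \<open>auto intro: integrable_continuous_real has_derivative_at_withinI\<close>)
  moreover have "blinfun_apply (integral {a..b} (\<lambda>t. Blinfun (f' x0 t))) = (\<lambda>v. integral {a..b} (\<lambda>t. f' x0 t v))"
  proof
    have "(\<lambda>t. Blinfun (f' x0 t)) integrable_on {a..b}"
      by (intro integrable_continuous_real continuous_on_compose2[OF c, of _ "\<lambda>t. (x0, t)", simplified])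
        (use \<open>x0 \<in> U\<close> in \<open>auto intro!: continuous_intros\<close>)
    then show "blinfun_apply (integral {a..b} (\<lambda>t. Blinfun (f' x0 t))) v = integral {a..b} (\<lambda>t. f' x0 t v)" for v
      using B \<open>x0 \<in> U\<close> by (auto simp: blinfun_apply_integral intro!: integral_cong)
  qed
  ultimately show ?thesis
    using at_within_open[OF \<open>x0 \<in> U\<close> \<open>open U\<close>] by simp
qed

text \<open>Differentiate \<open>f (y + t v) - f y = \<integral>\<^sub>0\<^sup>t Df (y + s v) v ds\<close> in the direction \<open>u\<close>.\<close>
lemma fd_fd_commute:
  fixes f :: "'a::euclidean_space \<Rightarrow> 'b::banach"
  assumes "open S" "smooth_on f S" "x \<in> S"
  shows "fd (\<lambda>y. fd f y v) x u = fd (\<lambda>y. fd f y u) x v"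
proof -
  note f = smooth_on_has_derivative[OF assms(2)]
  note fv = smooth_on_has_derivative[OF smooth_on_fd[OF assms(2)]]
  obtain r where r: "r > 0" "ball x (2 * r) \<subseteq> S"
    using assms(1,3) open_contains_ball by (metis field_sum_of_halves half_gt_zero mult_2)
  \<comment> \<open>For parameters up to \<open>d\<close> in absolute value, points of
    \<open>ball x r\<close> move by less than \<open>r\<close>; the summand 1 covers
    \<open>v = 0\<close>.\<close>
  define d where "d = r / (norm v + 1)"
  have nv: "norm v + 1 > 0" by (smt (verit) norm_ge_zero)
  have d: "d > 0" "d * norm v < r" using r nv by (auto simp: d_def field_simps)
  have inS: "y + s *\<^sub>R v \<in> S" if "y \<in> ball x r" "\<bar>s\<bar> \<le> d" for y s
  proof -
    have "norm (s *\<^sub>R v) \<le> d * norm v" using that by (auto intro: mult_right_mono)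
    then have "dist x (y + s *\<^sub>R v) < 2 * r"
      using that d norm_triangle_ineq4[of "x - y" "s *\<^sub>R v"] by (simp add: dist_norm algebra_simps)
    then show ?thesis using r by auto
  qed
  have line: "((\<lambda>s. g (y + s *\<^sub>R v)) has_derivative (\<lambda>h. h *\<^sub>R g' v)) (at s within T)"
    if "(g has_derivative g') (at (y + s *\<^sub>R v))" for g :: "'a \<Rightarrow> 'b" and g' y s T
  proof -
    have "((\<lambda>s. g (y + s *\<^sub>R v)) has_derivative (\<lambda>h. g' (h *\<^sub>R v))) (at s within T)"
      by (rule has_derivative_compose[of "\<lambda>s. y + s *\<^sub>R v" "\<lambda>h. h *\<^sub>R v" s T g g'])
        (use that in \<open>auto intro!: derivative_eq_intros\<close>)
    then show ?thesis
      using linear_cmul[OF has_derivative_linear[OF that]] by simp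
  qed
  have contv: "continuous_on (ball x r \<times> {0..d}) (\<lambda>(y, s). fd (\<lambda>y. fd f y v) (y + s *\<^sub>R v) u)"
    unfolding split_beta
    by (rule continuous_on_compose2[OF smooth_on_imp_continuous[OF smooth_on_fd[OF smooth_on_fd[OF assms(2)]]]])
      (auto intro!: continuous_intros inS)
  have ftc: "((\<lambda>s. fd f (y + s *\<^sub>R v) v) has_integral f (y + t *\<^sub>R v) - f y) {0..t}"
    if "y \<in> ball x r" "t \<in> {0..d}" for y t
  proof -
    have "((\<lambda>s. f (y + s *\<^sub>R v)) has_vector_derivative fd f (y + s *\<^sub>R v) v) (at s within {0..t})"
      if s: "s \<in> {0..t}" for s
    proof -
      have "y + s *\<^sub>R v \<in> S"
        by (rule inS) (use s \<open>y \<in> _\<close> \<open>t \<in> _\<close> in auto)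
      from line[OF f[OF this]] show ?thesis unfolding has_vector_derivative_def .
    qed
    then show ?thesis
      using fundamental_theorem_of_calculus[of 0 t "\<lambda>s. f (y + s *\<^sub>R v)" "\<lambda>s. fd f (y + s *\<^sub>R v) v"] that
      by simp
  qed
  have eq: "fd f (x + t *\<^sub>R v) u - fd f x u = integral {0..t} (\<lambda>s. fd (\<lambda>y. fd f y v) (x + s *\<^sub>R v) u)"
    if t: "t \<in> {0..d}" for t
  proof -
    have "((\<lambda>y. integral {0..t} (\<lambda>s. fd f (y + s *\<^sub>R v) v)) has_derivative
        (\<lambda>u. integral {0..t} (\<lambda>s. fd (\<lambda>y. fd f y v) (x + s *\<^sub>R v) u))) (at x)"
    proof (rule leibniz_rule_fd[where U="ball x r"])
      fix y s assume ys: "y \<in> ball x r" "s \<in> {0..t}"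
      then show "((\<lambda>y. fd f (y + s *\<^sub>R v) v) has_derivative (\<lambda>u. fd (\<lambda>y. fd f y v) (y + s *\<^sub>R v) u)) (at y)"
        using t by (intro has_derivative_compose[of "\<lambda>y. y + s *\<^sub>R v" "\<lambda>u. u" y UNIV "\<lambda>y. fd f y v"] fv inS)
          (auto intro!: derivative_eq_intros)
    next
      fix y assume "y \<in> ball x r"
      then show "continuous_on {0..t} (\<lambda>s. fd f (y + s *\<^sub>R v) v)"
        using t by (intro continuous_on_compose2[OF smooth_on_imp_continuous[OF smooth_on_fd[OF assms(2)]]])
         (auto intro!: continuous_intros inS)
    next
      fix u
      show "continuous_on (ball x r \<times> {0..t}) (\<lambda>(y, s). fd (\<lambda>y. fd f y v) (y + s *\<^sub>R v) u)"
        unfolding split_beta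
        by (rule continuous_on_compose2[OF smooth_on_imp_continuous[OF smooth_on_fd[OF smooth_on_fd[OF assms(2)]]]])
          (use t in \<open>auto intro!: continuous_intros inS\<close>)
    qed (use r in auto)
    then have "((\<lambda>y. f (y + t *\<^sub>R v) - f y) has_derivative
        (\<lambda>u. integral {0..t} (\<lambda>s. fd (\<lambda>y. fd f y v) (x + s *\<^sub>R v) u))) (at x)"
      by (rule has_derivative_transform_within_open[of _ _ _ _ "ball x r"])
         (use r ftc[OF _ t] in \<open>auto intro!: integral_unique\<close>)
    moreover have "((\<lambda>y. f (y + t *\<^sub>R v) - f y) has_derivative (\<lambda>u. fd f (x + t *\<^sub>R v) u - fd f x u)) (at x)"
      using t r assms(3)
      by (intro has_derivative_diff f has_derivative_compose[of "\<lambda>y. y + t *\<^sub>R v" "\<lambda>u. u" x UNIV f] inS)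
        (auto intro!: derivative_eq_intros)
    ultimately show ?thesis by (metis (no_types, lifting) has_derivative_unique)
  qed
  \<comment> \<open>Both sides of \<open>eq\<close> are now differentiated at \<open>t = 0\<close>
    from the right: the integral gives D(Df v) u, the left-hand side gives D(Df u) v.\<close>
  have "((\<lambda>t. fd f x u + integral {0..t} (\<lambda>s. fd (\<lambda>y. fd f y v) (x + s *\<^sub>R v) u)) has_vector_derivative
      fd (\<lambda>y. fd f y v) (x + 0 *\<^sub>R v) u) (at 0 within {0..d})"
  proof -
    have "continuous_on {0..d} (\<lambda>s. fd (\<lambda>y. fd f y v) (x + s *\<^sub>R v) u)"
      by (rule continuous_on_compose2[OF contv, of _ "\<lambda>s. (x, s)", simplified])
        (use r in \<open>auto intro!: continuous_intros\<close>)
    then show ?thesis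
      using integral_has_vector_derivative[of 0 d "\<lambda>s. fd (\<lambda>y. fd f y v) (x + s *\<^sub>R v) u" 0] d
      by (auto intro!: derivative_eq_intros)
  qed
  then have "((\<lambda>t. fd f (x + t *\<^sub>R v) u) has_vector_derivative fd (\<lambda>y. fd f y v) (x + 0 *\<^sub>R v) u) (at 0 within {0..d})"
    unfolding has_vector_derivative_def
  proof (rule has_derivative_transform[rotated 2])
    fix t assume "t \<in> {0..d}"
    from eq[OF this] show "fd f (x + t *\<^sub>R v) u =
        fd f x u + integral {0..t} (\<lambda>s. fd (\<lambda>y. fd f y v) (x + s *\<^sub>R v) u)"
      by (simp only: diff_eq_eq add.commute)
  qed (use d in auto)
  moreover have "((\<lambda>t. fd f (x + t *\<^sub>R v) u) has_vector_derivative fd (\<lambda>y. fd f y u) x v) (at 0 within {0..d})"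
    unfolding has_vector_derivative_def by (rule line) (use fv assms(3) in simp)
  ultimately have "fd (\<lambda>y. fd f y v) (x + 0 *\<^sub>R v) u = fd (\<lambda>y. fd f y u) x v"
    using d by (intro vector_derivative_unique_within[of 0 "{0..d}"]) (auto simp: trivial_limit_within islimpt_Icc)
  then show ?thesis by simp
qed

lemma fd_compose:
  assumes "(g has_derivative g') (at x)" "(f has_derivative f') (at (g x))"
  shows "fd (\<lambda>x. f (g x)) x = (\<lambda>v. f' (g' v))"
  using has_derivative_compose[of g g' x UNIV f f'] assms by (intro fd_eq) auto

text \<open>The summand with the second derivative of \<open>g\<close> is the source of the
  inhomogeneous term in the transformation law of Christoffel symbols.\<close>

lemma fd_fd_compose:
  fixes g :: "'a::euclidean_space \<Rightarrow> 'b::euclidean_space" and f :: "'b \<Rightarrow> 'c::real_normed_vector"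
  assumes "open S" "smooth_on g S" "smooth_on f T" "g ` S \<subseteq> T" "x \<in> S"
  shows "fd (\<lambda>y. fd (\<lambda>x. f (g x)) y v) x u =
     fd (\<lambda>z. fd f z (fd g x v)) (g x) (fd g x u) + fd f (g x) (fd (\<lambda>y. fd g y v) x u)"
proof -
  note f = smooth_on_has_derivative[OF assms(3)]
  note g = smooth_on_has_derivative[OF assms(2)]
  have "fd (\<lambda>y. fd (\<lambda>x. f (g x)) y v) x = fd (\<lambda>y. fd f (g y) (fd g y v)) x"
    by (rule fd_cong[OF assms(1,5)]) (use assms(4) in \<open>auto simp: fd_compose[OF g f]\<close>)
  also have "\<dots> = (\<lambda>u. fd (\<lambda>z. fd f z (fd g x v)) (g x) (fd g x u) + fd f (g x) (fd (\<lambda>y. fd g y v) x u))"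
  proof (rule fd_eq, rule has_derivative_apply[OF assms(1,5)])
    show "linear (fd f (g y))" if "y \<in> S" for y
      using f[of "g y"] that assms(4) has_derivative_linear by blast
    show "((\<lambda>y. fd g y v) has_derivative fd (\<lambda>y. fd g y v) x) (at x)"
      by (rule smooth_on_has_derivative[OF smooth_on_fd[OF assms(2)] assms(5)])
    show "((\<lambda>y. fd f (g y) w) has_derivative (\<lambda>u. fd (\<lambda>z. fd f z w) (g x) (fd g x u))) (at x)" for w
      using assms(4,5)
      by (intro has_derivative_compose[of g _ x UNIV "\<lambda>z. fd f z w"] g
          smooth_on_has_derivative[OF smooth_on_fd[OF assms(3)]]) auto
  qed
  finally show ?thesis by simp
qed

section \<open>Osgood's lemma\<close>

abbreviation circ :: "real \<Rightarrow> real \<Rightarrow> complex" where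
  "circ r t \<equiv> r * exp (2 * of_real pi * \<i> * of_real t)"

lemma contour_integral_circlepath_0:
  "contour_integral (circlepath 0 r) g = integral {0..1} (\<lambda>t. g (circ r t) * (2 * of_real pi * \<i> * circ r t))"
proof -
  have "integral {0..1} (\<lambda>t. g (circlepath 0 r t) * vector_derivative (circlepath 0 r) (at t)) =
      integral {0..1} (\<lambda>t. g (circ r t) * (2 * of_real pi * \<i> * circ r t))"
    unfolding vector_derivative_circlepath by (simp add: circlepath mult.assoc)
  then show ?thesis by (simp add: contour_integral_integral)
qed

lemma holo_onE:
  assumes "holo_on I I' f S" "x \<in> S"
  shows "(f has_derivative fd f x) (at x)" "fd f x (I v) = I' (fd f x v)"
  using assms fd_eq unfolding holo_on_def by metis+

lemma holo_onI:
  assumes "\<And>x. x \<in> S \<Longrightarrow> (f has_derivative f' x) (at x)" "\<And>x v. x \<in> S \<Longrightarrow> f' x (I v) = I' (f' x v)"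
  shows "holo_on I I' f S"
  using assms unfolding holo_on_def by metis

lemma holo_on_subset: "holo_on I I' f S \<Longrightarrow> T \<subseteq> S \<Longrightarrow> holo_on I I' f T"
  unfolding holo_on_def by blast

lemma holo_on_cong:
  assumes "open S" "\<And>x. x \<in> S \<Longrightarrow> f x = g x" "holo_on I I' f S"
  shows "holo_on I I' g S"
  using assms has_derivative_transform_within_open[of f _ _ UNIV S g] unfolding holo_on_def by metis

lemma holo_on_compose:
  assumes "holo_on I I' g S" "holo_on I' I'' f T" "g ` S \<subseteq> T"
  shows "holo_on I I'' (\<lambda>x. f (g x)) S"
proof (rule holo_onI)
  fix x assume x: "x \<in> S"
  then have gx: "g x \<in> T" using assms(3) by auto
  show "((\<lambda>x. f (g x)) has_derivative (\<lambda>v. fd f (g x) (fd g x v))) (at x)"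
    by (rule has_derivative_compose[OF holo_onE(1)[OF assms(1) x] holo_onE(1)[OF assms(2) gx]])
  show "fd f (g x) (fd g x (I v)) = I'' (fd f (g x) (fd g x v))" for v
    by (simp only: holo_onE(2)[OF assms(1) x] holo_onE(2)[OF assms(2) gx])
qed

text \<open>An abstract complex structure \<open>I\<close> covers both \<open>complex^'n\<close> and
  its product with \<open>complex\<close>, the source of an action map. \<open>cs\<close> is the
  multiplication by complex scalars that \<open>I\<close> defines.\<close>

locale cstruct =
  fixes I :: "'a::euclidean_space \<Rightarrow> 'a"
  assumes linear_I: "linear I" and I_I: "I (I v) = - v"
begin

definition cs :: "complex \<Rightarrow> 'a \<Rightarrow> 'a" where "cs c v = Re c *\<^sub>R v + Im c *\<^sub>R I v"

lemma norm_cs: "norm (cs c v) \<le> norm c * (norm v + norm (I v))"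
proof -
  have "norm (cs c v) \<le> \<bar>Re c\<bar> * norm v + \<bar>Im c\<bar> * norm (I v)"
    unfolding cs_def by (metis norm_scaleR norm_triangle_ineq)
  also have "\<dots> \<le> norm c * norm v + norm c * norm (I v)"
    by (intro add_mono mult_right_mono abs_Re_le_cmod abs_Im_le_cmod) auto
  finally show ?thesis by (simp add: algebra_simps)
qed

lemma holo_on_line:
  assumes "holo_on I J1 f S" "x + cs c v \<in> S"
  shows "((\<lambda>c. f (x + cs c v)) has_field_derivative fd f (x + cs c v) v) (at c)"
proof -
  note f = holo_onE[OF assms]
  have "((\<lambda>c. f (x + cs c v)) has_derivative (\<lambda>h. fd f (x + cs c v) (cs h v))) (at c)"
    by (rule has_derivative_compose[of "\<lambda>c. x + cs c v" "\<lambda>h. cs h v" c UNIV f, OF _ f(1)])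
      (auto simp: cs_def intro!: derivative_eq_intros)
  moreover have "fd f (x + cs c v) (cs h v) = fd f (x + cs c v) v * h" for h
  proof -
    interpret L: linear "fd f (x + cs c v)" by (rule has_derivative_linear[OF f(1)])
    have "fd f (x + cs c v) (cs h v) = Re h *\<^sub>R fd f (x + cs c v) v + Im h *\<^sub>R (\<i> * fd f (x + cs c v) v)"
      unfolding cs_def[of h] by (simp only: L.add L.scale f(2) J1_def)
    then show ?thesis by (simp add: complex_eq_iff)
  qed
  ultimately show ?thesis by (simp add: has_field_derivative_def)
qed

text \<open>Cauchy's formula for the derivative at 0 of \<open>f\<close> restricted to a complex
  line; with the circle parametrised, d\<zeta> / \<zeta>^2 becomes 2 pi \<i> dt / \<zeta>. Only
  values of \<open>f\<close> occur on the right, so regularity in \<open>x\<close> can be read off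
  under the integral sign.\<close>

lemma cauchy_fd:
  assumes "holo_on I J1 f S" "\<rho> > 0" "\<And>c. norm c \<le> \<rho> \<Longrightarrow> x + cs c v \<in> S"
  shows "fd f x v = integral {0..1}
     (\<lambda>t. f (x + cs (circ \<rho> t) v) / (circ \<rho> t))"
proof -
  define g where "g = (\<lambda>c. f (x + cs c v))"
  have g: "(g has_field_derivative fd f (x + cs c v) v) (at c)" if "norm c \<le> \<rho>" for c
    unfolding g_def by (rule holo_on_line[OF assms(1) assms(3)[OF that]])
  have "continuous_on (cball 0 \<rho>) g"
    using g by (auto intro!: continuous_at_imp_continuous_on DERIV_isCont)
  moreover have "g holomorphic_on ball 0 \<rho>"
    using g by (intro holomorphic_onI) (auto simp: field_differentiable_def intro: has_field_derivative_at_within less_imp_le)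
  ultimately have "(g has_field_derivative (1 / (2 * of_real pi * \<i>) *
      contour_integral (circlepath 0 \<rho>) (\<lambda>u. g u / (u - 0)^2))) (at 0)"
    using assms(2) by (intro Cauchy_derivative_integral_circlepath) auto
  then have "fd f x v = 1 / (2 * of_real pi * \<i>) * contour_integral (circlepath 0 \<rho>) (\<lambda>u. g u / u^2)"
    using g[of 0] assms(2) DERIV_unique by (fastforce simp: cs_def)
  also have "contour_integral (circlepath 0 \<rho>) (\<lambda>u. g u / u^2) = integral {0..1}
     (\<lambda>t. 2 * of_real pi * \<i> * (g (circ \<rho> t) / (circ \<rho> t)))"
    unfolding contour_integral_circlepath_0
    by (intro integral_cong) (use assms(2) in \<open>simp add: power2_eq_square\<close>)
  also have "1 / (2 * of_real pi * \<i>) * \<dots> = integral {0..1} (\<lambda>t. g (circ \<rho> t) / (circ \<rho> t))"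
    by (simp only: Henstock_Kurzweil_Integration.integral_mult_right) simp
  finally show ?thesis by (simp add: g_def)
qed

lemma obtain_polydisc:
  assumes "open S" "x0 \<in> S"
  obtains r \<rho> where "r > 0" "\<rho> > 0" "\<And>x c. x \<in> ball x0 r \<Longrightarrow> norm c \<le> \<rho> \<Longrightarrow> x + cs c v \<in> S"
proof -
  obtain e where e: "e > 0" "ball x0 e \<subseteq> S"
    using assms open_contains_ball by blast
  define M where "M = norm v + norm (I v) + 1"
  have M: "M > 0" unfolding M_def by (smt (verit) norm_ge_zero)
  have "x + cs c v \<in> S" if "x \<in> ball x0 (e/2)" "norm c \<le> e / 2 / M" for x c
  proof -
    have "norm (cs c v) \<le> norm c * M"
      by (rule order_trans[OF norm_cs]) (auto simp: M_def intro!: mult_left_mono)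
    also have "\<dots> \<le> e / 2" using that M by (simp add: field_simps)
    finally have "dist x0 (x + cs c v) < e"
      using that norm_triangle_ineq4[of "x0 - x" "cs c v"] by (simp add: dist_norm algebra_simps)
    then show ?thesis using e by auto
  qed
  then show thesis using that[of "e/2" "e/2/M"] e M by auto
qed

lemma exp_circle_continuous [continuous_intros]:
  "continuous_on T f \<Longrightarrow> continuous_on T (\<lambda>t. exp (2 * of_real pi * \<i> * complex_of_real (f t)))"
  by (intro continuous_intros)

lemma continuous_on_cs [continuous_intros]:
  "continuous_on T f \<Longrightarrow> continuous_on T (\<lambda>t. cs (f t) v)"
  unfolding cs_def by (intro continuous_intros)

lemma holo_on_continuous: "holo_on I I' f S \<Longrightarrow> continuous_on S f"
  by (meson continuous_at_imp_continuous_on has_derivative_continuous holo_onE(1))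

text \<open>Separate from \<open>holo_on_fd\<close>, which differentiates under the integral sign
  and for that needs the derivative of \<open>f\<close> to be continuous beforehand.\<close>

lemma holo_on_fd_continuous:
  assumes "open S" "holo_on I J1 f S"
  shows "continuous_on S (\<lambda>x. fd f x v)"
proof (rule continuous_at_imp_continuous_on, rule ballI)
  fix x0 assume "x0 \<in> S"
  then obtain r \<rho> where r: "r > 0" "\<rho> > 0" "\<And>x c. x \<in> ball x0 r \<Longrightarrow> norm c \<le> \<rho> \<Longrightarrow> x + cs c v \<in> S"
    using obtain_polydisc[OF assms(1)] by metis
  have "continuous_on (ball x0 r) (\<lambda>x. integral (cbox 0 1)
     (\<lambda>t. f (x + cs (circ \<rho> t) v) / (circ \<rho> t)))"
    by (rule integral_continuous_on_param, unfold split_beta)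
      (use r in \<open>auto intro!: continuous_intros continuous_on_compose2[OF holo_on_continuous[OF assms(2)]] simp: norm_mult\<close>)
  then have "continuous_on (ball x0 r) (\<lambda>x. fd f x v)"
  proof (rule continuous_on_eq)
    fix x assume "x \<in> ball x0 r"
    from cauchy_fd[OF assms(2) r(2) r(3)[OF this], symmetric]
    show "integral (cbox 0 1)
     (\<lambda>t. f (x + cs (circ \<rho> t) v) / (circ \<rho> t))
      = fd f x v" by simp
  qed
  then show "isCont (\<lambda>x. fd f x v) x0"
    using r(1) by (meson centre_in_ball continuous_on_eq_continuous_at open_ball)
qed

text \<open>Cauchy's formula is differentiated under the integral sign; complex linearity of the
  integrand in \<open>w\<close> passes to the integral.\<close>

lemma holo_on_fd:
  assumes "open S" "holo_on I J1 f S"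
  shows "holo_on I J1 (\<lambda>x. fd f x v) S"
  unfolding holo_on_def
proof
  fix x0 assume "x0 \<in> S"
  then obtain r \<rho> where r: "r > 0" "\<rho> > 0" "\<And>x c. x \<in> ball x0 r \<Longrightarrow> norm c \<le> \<rho> \<Longrightarrow> x + cs c v \<in> S"
    using obtain_polydisc[OF assms(1)] by metis
  define e where "e = circ \<rho>"
  have e: "norm (e t) \<le> \<rho>" "e t \<noteq> 0" for t using r(2) by (auto simp: e_def norm_mult)
  have ce: "continuous_on T g \<Longrightarrow> continuous_on T (\<lambda>t. e (g t))" for T and g :: "'x::topological_space \<Rightarrow> real"
    unfolding e_def by (intro continuous_intros)
  have "((\<lambda>x. integral {0..1} (\<lambda>t. f (x + cs (e t) v) / e t)) has_derivative
      (\<lambda>w. integral {0..1} (\<lambda>t. fd f (x0 + cs (e t) v) w / e t))) (at x0)"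
  proof (rule leibniz_rule_fd[where U="ball x0 r"])
    show "((\<lambda>x. f (x + cs (e t) v) / e t) has_derivative (\<lambda>w. fd f (x + cs (e t) v) w / e t)) (at x)"
      if "x \<in> ball x0 r" for x t
      using holo_onE(1)[OF assms(2) r(3)[OF that e(1)[of t]]] e(2)[of t]
      by (auto intro!: derivative_eq_intros
          has_derivative_compose[of "\<lambda>x. x + cs (e t) v" "\<lambda>w. w" x UNIV f])
    show "continuous_on (ball x0 r \<times> {0..1}) (\<lambda>(x, t). fd f (x + cs (e t) v) w / e t)" for w
      unfolding split_beta
      by (intro continuous_intros ce continuous_on_compose2[OF holo_on_fd_continuous[OF assms]])
        (use e r in auto)
    show "continuous_on {0..1} (\<lambda>t. f (x + cs (e t) v) / e t)" if "x \<in> ball x0 r" for x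
      by (intro continuous_intros ce continuous_on_compose2[OF holo_on_continuous[OF assms(2)]])
        (use e r that in auto)
  qed (use r in auto)
  then have "((\<lambda>x. fd f x v) has_derivative
      (\<lambda>w. integral {0..1} (\<lambda>t. fd f (x0 + cs (e t) v) w / e t))) (at x0)"
    by (rule has_derivative_transform_within_open[of _ _ _ _ "ball x0 r"])
      (use r cauchy_fd[OF assms(2) r(2,3)] in \<open>auto simp: e_def\<close>)
  moreover have "integral {0..1} (\<lambda>t. fd f (x0 + cs (e t) v) (I w) / e t) =
      J1 (integral {0..1} (\<lambda>t. fd f (x0 + cs (e t) v) w / e t))" for w
    using r e holo_onE(2)[OF assms(2)] by (simp add: J1_def flip: Henstock_Kurzweil_Integration.integral_mult_right)
  ultimately show "\<exists>f'. ((\<lambda>x. fd f x v) has_derivative f') (at x0) \<and> (\<forall>v. f' (I v) = J1 (f' v))"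
    by blast
qed

lemma holo_on_imp_smooth:
  assumes "open S" "holo_on I J1 f S"
  shows "smooth_on f S"
proof -
  have "C_k_on k f S" for k
    using assms(2)
  proof (induction k arbitrary: f)
    case 0 then show ?case by (simp add: holo_on_continuous)
  next
    case (Suc k)
    show ?case
      by (rule C_k_on_SucI[OF \<open>open S\<close> holo_onE(1)[OF Suc.prems] Suc.IH[OF holo_on_fd[OF \<open>open S\<close> Suc.prems]]])
  qed
  then show ?thesis by (simp add: smooth_on_def)
qed

end

section \<open>Vector-valued holomorphic maps and the standard complex structures\<close>

lemma has_derivative_vec_iff:
  fixes f :: "'a::real_normed_vector \<Rightarrow> complex^'n"
  shows "(f has_derivative f') (at x) \<longleftrightarrow> (\<forall>i. ((\<lambda>x. f x $ i) has_derivative (\<lambda>v. f' v $ i)) (at x))"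
proof
  assume "\<forall>i. ((\<lambda>x. f x $ i) has_derivative (\<lambda>v. f' v $ i)) (at x)"
  then have "((\<lambda>x. f x $ i \<bullet> b) has_derivative (\<lambda>v. f' v $ i \<bullet> b)) (at x)" for i b
    by (auto intro: bounded_linear.has_derivative[OF bounded_linear_inner_left])
  then show "(f has_derivative f') (at x)"
    by (subst has_derivative_componentwise_within) (auto simp: Basis_vec_def inner_axis)
qed (auto intro: bounded_linear.has_derivative[OF bounded_linear_vec_nth])

lemma smooth_on_vec:
  fixes f :: "'a::real_normed_vector \<Rightarrow> complex^'n"
  assumes "open S" "\<And>i. smooth_on (\<lambda>x. f x $ i) S"
  shows "smooth_on f S"
proof (rule smooth_on_cong[OF assms(1)])
  have "linear (axis i :: complex \<Rightarrow> complex^'n)" for i :: 'n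
    by (rule linearI) (auto simp: axis_def vec_eq_iff)
  then have "bounded_linear (axis i :: complex \<Rightarrow> complex^'n)" for i :: 'n
    by (simp add: linear_conv_bounded_linear)
  then show "smooth_on (\<lambda>x. \<Sum>i\<in>UNIV. axis i (f x $ i)) S"
    by (intro smooth_on_sum[OF assms(1)] smooth_on_linear_compose[OF assms(1) _ assms(2)])
  show "(\<Sum>i\<in>UNIV. axis i (f x $ i)) = f x" for x
    by (simp add: vec_eq_iff axis_def)
qed

lemma holo_on_vec_iff:
  fixes f :: "'a::real_normed_vector \<Rightarrow> complex^'n"
  shows "holo_on I J f S \<longleftrightarrow> (\<forall>i. holo_on I J1 (\<lambda>x. f x $ i) S)"
proof
  assume *: "\<forall>i. holo_on I J1 (\<lambda>x. f x $ i) S"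
  show "holo_on I J f S"
  proof (rule holo_onI)
    fix x assume x: "x \<in> S"
    show "(f has_derivative (\<lambda>v. \<chi> i. fd (\<lambda>x. f x $ i) x v)) (at x)"
      using holo_onE(1)[OF spec[OF *] x] by (simp add: has_derivative_vec_iff)
    show "(\<chi> i. fd (\<lambda>x. f x $ i) x (I v)) = J (\<chi> i. fd (\<lambda>x. f x $ i) x v)" for v
      using holo_onE(2)[OF spec[OF *] x] by (simp add: vec_eq_iff J_def J1_def)
  qed
next
  assume *: "holo_on I J f S"
  show "\<forall>i. holo_on I J1 (\<lambda>x. f x $ i) S"
  proof
    fix i show "holo_on I J1 (\<lambda>x. f x $ i) S"
    proof (rule holo_onI)
      fix x assume x: "x \<in> S"
      show "((\<lambda>x. f x $ i) has_derivative (\<lambda>v. fd f x v $ i)) (at x)"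
        using holo_onE(1)[OF * x] by (simp add: has_derivative_vec_iff)
      show "fd f x (I v) $ i = J1 (fd f x v $ i)" for v
        by (simp add: holo_onE(2)[OF * x] J_def J1_def)
    qed
  qed
qed

lemma fd_vec_nth:
  fixes f :: "'a::real_normed_vector \<Rightarrow> complex^'n"
  assumes "(f has_derivative f') (at x)"
  shows "fd (\<lambda>x. f x $ i) x v = f' v $ i"
  using fd_eq[OF has_derivative_vec_iff[THEN iffD1, OF assms, rule_format]] by simp

context cstruct begin

lemma holo_on_vec_imp_smooth:
  fixes f :: "'a \<Rightarrow> complex^'n"
  assumes "open S" "holo_on I J f S"
  shows "smooth_on f S"
  using assms holo_on_imp_smooth[OF assms(1)] by (auto simp: holo_on_vec_iff intro!: smooth_on_vec)

lemma holo_on_vec_fd: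
  fixes f :: "'a \<Rightarrow> complex^'n"
  assumes "open S" "holo_on I J f S"
  shows "holo_on I J (\<lambda>x. fd f x v) S"
  unfolding holo_on_vec_iff
proof
  fix i
  have "holo_on I J1 (\<lambda>x. fd (\<lambda>x. f x $ i) x v) S"
    using assms by (auto simp: holo_on_vec_iff intro!: holo_on_fd)
  then show "holo_on I J1 (\<lambda>x. fd f x v $ i) S"
    by (rule holo_on_cong[OF assms(1), rotated]) (rule fd_vec_nth[OF holo_onE(1)[OF assms(2)]])
qed

end

lemma linear_J: "linear J"
  by (rule linearI) (auto simp: J_def vec_eq_iff algebra_simps)

lemma J_add: "J (a + b) = J a + J b" and J_scaleR: "J (r *\<^sub>R a) = r *\<^sub>R J a"
  using linear_J by (auto simp: linear_iff)

lemma J_J: "J (J v) = - v"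
  by (simp add: J_def vec_eq_iff)

interpretation Jc: cstruct "J :: complex^'n \<Rightarrow> complex^'n"
  by (simp add: cstruct_def linear_J J_J)

interpretation Jp: cstruct "map_prod J1 J :: complex \<times> (complex^'n) \<Rightarrow> complex \<times> (complex^'n)"
proof (unfold cstruct_def, intro conjI allI)
  show "linear (map_prod J1 J :: complex \<times> (complex^'n) \<Rightarrow> _)"
    by (rule linearI) (auto simp: J_add J_scaleR J1_def algebra_simps)
  show "map_prod J1 J (map_prod J1 J v) = - v" for v :: "complex \<times> (complex^'n)"
    by (cases v) (simp add: J_J J1_def)
qed

section \<open>Parallel sections of flat linear connections\<close>

text \<open>The connection d + \<open>G\<close> on the trivial bundle over \<open>V\<close> with
  fibre \<open>'b\<close>; \<open>flat_G\<close> is the vanishing of its curvature on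
  \<open>u\<close>, \<open>v\<close>.\<close>

locale flat_conn =
  fixes V :: "'a::euclidean_space set" and G :: "'a \<Rightarrow> 'a \<Rightarrow> 'b::euclidean_space \<Rightarrow> 'b"
  assumes open_V: "open V"
    and bilinear_G: "x \<in> V \<Longrightarrow> bilinear (G x)"
    and smooth_G: "smooth_on (\<lambda>x. G x u w) V"
    and flat_G: "x \<in> V \<Longrightarrow> fd (\<lambda>y. G y v w) x u + G x u (G x v w) =
      fd (\<lambda>y. G y u w) x v + G x v (G x u w)"
begin

lemma linear_G1: "x \<in> V \<Longrightarrow> linear (\<lambda>u. G x u w)"
  and linear_G2: "x \<in> V \<Longrightarrow> linear (G x u)"
  using bilinear_G by (auto simp: bilinear_def)

lemmas G_add2 = linear_add[OF linear_G2] and G_diff2 = linear_diff[OF linear_G2]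
  and G_scale2 = linear_cmul[OF linear_G2]
  and G_01 = linear_0[OF linear_G1] and G_02 = linear_0[OF linear_G2]

lemma G_bound:
  assumes "compact K" "K \<subseteq> V"
  obtains C where "C > 0" "\<And>x u w. x \<in> K \<Longrightarrow> norm (G x u w) \<le> C * norm u * norm w"
proof -
  have "\<exists>B. \<forall>x\<in>K. norm (G x i j) \<le> B" for i j
  proof -
    have "bounded ((\<lambda>x. G x i j) ` K)"
      by (intro compact_imp_bounded compact_continuous_image assms
          continuous_on_subset[OF smooth_on_imp_continuous[OF smooth_G] assms(2)])
    then show ?thesis by (auto simp: bounded_iff)
  qed
  then obtain B where B: "\<And>i j x. x \<in> K \<Longrightarrow> norm (G x i j) \<le> B i j" by metis
  define C where "C = (\<Sum>i\<in>Basis. \<Sum>j\<in>Basis. \<bar>B i j\<bar>) + 1"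
  have "C > 0" unfolding C_def by (smt (verit) abs_ge_zero sum_nonneg)
  moreover have "norm (G x u w) \<le> C * norm u * norm w" if "x \<in> K" for x u w
  proof -
    have x: "x \<in> V" using that assms by auto
    have "G x u w = (\<Sum>i\<in>Basis. (u \<bullet> i) *\<^sub>R G x i w)"
      by (rule linear_apply_basis[OF linear_G1[OF x]])
    also have "\<dots> = (\<Sum>i\<in>Basis. (u \<bullet> i) *\<^sub>R (\<Sum>j\<in>Basis. (w \<bullet> j) *\<^sub>R G x i j))"
      by (intro sum.cong refl arg_cong2[where f="(*\<^sub>R)"] linear_apply_basis[OF linear_G2[OF x]])
    also have "norm \<dots> \<le> (\<Sum>i\<in>Basis. norm u * (\<Sum>j\<in>Basis. norm w * \<bar>B i j\<bar>))"
    proof (intro sum_norm_le order_trans[OF eq_refl[OF norm_scaleR]] mult_mono)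
      fix i j :: 'a assume "i \<in> Basis"
      then show "\<bar>u \<bullet> i\<bar> \<le> norm u" by (rule Basis_le_norm)
    next
      fix j :: 'b assume "j \<in> Basis"
      then show "\<bar>w \<bullet> j\<bar> \<le> norm w" by (rule Basis_le_norm)
    next
      fix i j show "norm (G x i j) \<le> \<bar>B i j\<bar>" using B[OF that, of i j] by linarith
    qed auto
    also have "\<dots> = (C - 1) * norm u * norm w"
      by (simp add: C_def sum_distrib_left sum_distrib_right mult_ac)
    also have "\<dots> \<le> C * norm u * norm w"
      by (intro mult_right_mono) auto
    finally show ?thesis .
  qed
  ultimately show thesis by (rule that)
qed

text \<open>Bootstrapping: the equation expresses the derivative of \<open>Y\<close> through
  \<open>Y\<close> and the smooth \<open>G\<close>, so each order of differentiability gives the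
  next.\<close>

lemma parallel_smooth:
  assumes "open S" "S \<subseteq> V" "\<And>x. x \<in> S \<Longrightarrow> (Y has_derivative (\<lambda>u. - G x u (Y x))) (at x)"
  shows "smooth_on Y S"
proof -
  have "C_k_on k Y S" for k
  proof (induction k)
    case 0 show ?case
    proof -
      have "isCont Y x" if "x \<in> S" for x by (rule has_derivative_continuous[OF assms(3)[OF that]])
      then show ?thesis by (simp add: continuous_at_imp_continuous_on)
    qed
  next
    case (Suc k)
    have G: "C_k_on k (\<lambda>x. G x u (Y x)) S" for u
    proof (rule C_k_on_apply[OF \<open>open S\<close> _ _ Suc, where A="\<lambda>x. G x u"])
      show "linear (G x u)" if "x \<in> S" for x using that assms(2) by (intro linear_G2) auto
      show "C_k_on k (\<lambda>x. G x u w) S" for w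
        using smooth_on_subset[OF smooth_G assms(2)] unfolding smooth_on_def by blast
    qed
    have "C_k_on k (\<lambda>x. - G x u (Y x)) S" for u
      by (rule C_k_on_linear_compose[OF \<open>open S\<close> bounded_linear_minus[OF bounded_linear_ident] G])
    from C_k_on_SucI[OF \<open>open S\<close> assms(3) this] show ?case .
  qed
  then show ?thesis by (simp add: smooth_on_def)
qed

end

text \<open>The iterates \<open>Y\<close> are differentiated along with the integral equation. By flatness their defect
  \<open>Z u = DY u + G u Y\<close> reproduces itself, up to a contraction, in the next iterate.\<close>

locale picard = flat_conn V G for V :: "'a::euclidean_space set" and G :: "'a \<Rightarrow> 'a \<Rightarrow> 'b::euclidean_space \<Rightarrow> 'b" +
  fixes q :: 'a and r C :: real
  assumes r: "r > 0" "ball q r \<subseteq> V" and C: "C > 0" "8 * C * r \<le> 1"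
    and G_bd: "x \<in> ball q r \<Longrightarrow> norm (G x u w) \<le> C * norm u * norm w"
begin

abbreviation ray :: "'a \<Rightarrow> real \<Rightarrow> 'a" where "ray x t \<equiv> q + t *\<^sub>R (x - q)"

text \<open>The Picard operator for parallel transport along the rays from \<open>q\<close>. A fixed
  point is a priori parallel only in the radial direction; the other directions come from
  flatness.\<close>

definition step :: "'b \<Rightarrow> ('a \<Rightarrow> 'b) \<Rightarrow> 'a \<Rightarrow> 'b" where
  "step w Y x = w - integral {0..1} (\<lambda>t. G (ray x t) (x - q) (Y (ray x t)))"

lemma seg: "x \<in> ball q r \<Longrightarrow> t \<in> {0..1} \<Longrightarrow> ray x t \<in> ball q r"
proof -
  assume x: "x \<in> ball q r" and t: "t \<in> {0..1}"
  have "\<bar>t\<bar> * norm (x - q) \<le> 1 * norm (x - q)" using t by (intro mult_right_mono) auto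
  then show ?thesis using x by (simp add: dist_norm norm_minus_commute)
qed

lemma C_norm: "x \<in> ball q r \<Longrightarrow> 8 * (C * norm (x - q)) \<le> 1"
proof -
  assume "x \<in> ball q r"
  then have "C * norm (x - q) \<le> C * r"
    using C by (intro mult_left_mono) (auto simp: dist_norm norm_minus_commute)
  then show ?thesis using C(2) by linarith
qed

lemma bdV: "x \<in> ball q r \<Longrightarrow> x \<in> V" using r by auto

context
  fixes Y :: "'a \<Rightarrow> 'b" and w :: 'b
  assumes Y: "C_k_on 1 Y (ball q r)"
begin

definition M where "M u y = G y u (Y y)"
definition Z where "Z u y = fd Y y u + G y u (Y y)"

lemma Yd: "x \<in> ball q r \<Longrightarrow> (Y has_derivative fd Y x) (at x)"
  using Y C_k_on_has_derivative[of 0 Y] by simp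

lemma M_C1: "C_k_on (Suc 0) (M u) (ball q r)"
  unfolding M_def
proof (rule C_k_on_apply[OF open_ball linear_G2[OF bdV]])
  show "C_k_on (Suc 0) (\<lambda>x. G x u w) (ball q r)" for w
    using C_k_on_subset[OF _ r(2)] smooth_G unfolding smooth_on_def by blast
  show "C_k_on (Suc 0) Y (ball q r)" using Y by simp
qed

lemma M_sum: "y \<in> V \<Longrightarrow> M v y = (\<Sum>i\<in>Basis. (v \<bullet> i) *\<^sub>R M i y)"
  unfolding M_def by (rule linear_apply_basis[where A="\<lambda>u. G y u (Y y)", OF linear_G1])

lemma M_cont: "continuous_on (ball q r) (M u)"
  by (rule C_k_on_imp_continuous[OF M_C1])
lemma dM_cont: "continuous_on (ball q r) (\<lambda>x. fd (M u) x v)"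
  by (rule C_k_on_imp_continuous[OF C_k_on_fd[OF M_C1]])

lemma seg_cont:
  assumes "continuous_on (ball q r) f" "continuous_on T a" "continuous_on T b"
    "\<And>z. z \<in> T \<Longrightarrow> a z \<in> ball q r" "\<And>z. z \<in> T \<Longrightarrow> b z \<in> {0..1}"
  shows "continuous_on T (\<lambda>z. f (q + b z *\<^sub>R (a z - q)))"
  by (rule continuous_on_compose2[OF assms(1)]) (use assms seg in \<open>auto intro!: continuous_intros\<close>)

lemma seg_cont1:
  assumes "continuous_on (ball q r) f" "x \<in> ball q r"
  shows "continuous_on {0..1} (\<lambda>t. f (ray x t))"
  by (rule seg_cont[OF assms(1)]) (use assms in \<open>auto intro: continuous_on_const continuous_on_id\<close>)

lemma seg_cont2:
  assumes "continuous_on (ball q r) f"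
  shows "continuous_on (ball q r \<times> {0..1}) (\<lambda>z. f (ray (fst z) (snd z)))"
  by (rule seg_cont[OF assms]) (auto intro: continuous_on_fst continuous_on_snd continuous_on_id)

lemma fd_M:
  assumes x: "x \<in> ball q r"
  shows "fd (M a) x u = fd (\<lambda>y. G y a (Y x)) x u + G x a (fd Y x u)"
proof -
  have "(M a has_derivative (\<lambda>u. fd (\<lambda>y. G y a (Y x)) x u + G x a (fd Y x u))) (at x)"
    unfolding M_def
    by (rule has_derivative_apply[OF open_V bdV[OF x] linear_G2 smooth_on_has_derivative[OF smooth_G bdV[OF x]] Yd[OF x]])
  then show ?thesis by (simp add: fd_eq)
qed

text \<open>Flatness enters here: the antisymmetric part of the derivative of the one-form
  \<open>M\<close> is linear in the defect \<open>Z\<close>, so \<open>M\<close> is closed when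
  \<open>Y\<close> is parallel.\<close>

lemma fd_M_swap:
  assumes x: "x \<in> ball q r"
  shows "fd (M a) x u = fd (M u) x a + (G x a (Z u x) - G x u (Z a x))"
  using flat_G[OF bdV[OF x], where u=u and v=a and w="Y x"]
  by (simp add: fd_M[OF x] Z_def G_add2[OF bdV[OF x]] algebra_simps)

text \<open>In \<open>step\<close> the point \<open>x\<close> also occurs in the argument
  \<open>x - q\<close> of \<open>G\<close>. Expanding that argument in the basis moves it out of the
  integral, where the product rule applies.\<close>

lemma step_has_derivative:
  assumes x: "x \<in> ball q r"
  shows "(step w Y has_derivative (\<lambda>u. - (\<Sum>i\<in>Basis. (u \<bullet> i) *\<^sub>R integral {0..1} (\<lambda>t. M i (ray x t))
     + ((x - q) \<bullet> i) *\<^sub>R integral {0..1} (\<lambda>t. fd (M i) (ray x t) (t *\<^sub>R u))))) (at x)"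
proof -
  have M': "((\<lambda>x. integral {0..1} (\<lambda>t. M i (ray x t))) has_derivative
      (\<lambda>u. integral {0..1} (\<lambda>t. fd (M i) (ray x t) (t *\<^sub>R u)))) (at x)" for i
  proof (rule leibniz_rule_fd[OF open_ball convex_ball x])
    fix y t assume "y \<in> ball q r" "t \<in> {0..1::real}"
    from C_k_on_has_derivative[OF M_C1 seg[OF this]]
    show "((\<lambda>y. M i (ray y t)) has_derivative (\<lambda>u. fd (M i) (ray y t) (t *\<^sub>R u))) (at y)"
      by (intro has_derivative_compose[of "\<lambda>y. ray y t" "\<lambda>u. t *\<^sub>R u" y UNIV "M i"])
        (auto intro!: derivative_eq_intros)
  next
    fix u
    have "continuous_on (ball q r \<times> {0..1}) (\<lambda>z. snd z *\<^sub>R fd (M i) (ray (fst z) (snd z)) u)"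
      by (intro continuous_on_scaleR continuous_on_snd continuous_on_id seg_cont2[OF dM_cont])
    then show "continuous_on (ball q r \<times> {0..1}) (\<lambda>(y, t). fd (M i) (ray y t) (t *\<^sub>R u))"
      by (rule continuous_on_eq)
        (clarsimp simp del: mem_ball, rule linear_cmul[OF has_derivative_linear[OF C_k_on_has_derivative[OF M_C1 seg]], symmetric], auto)
  next
    fix y assume "y \<in> ball q r"
    then show "continuous_on {0..1} (\<lambda>t. M i (ray y t))"
      by (rule seg_cont1[OF M_cont])
  qed
  have "((\<lambda>x. w - (\<Sum>i\<in>Basis. ((x - q) \<bullet> i) *\<^sub>R integral {0..1} (\<lambda>t. M i (ray x t)))) has_derivative
     (\<lambda>u. - (\<Sum>i\<in>Basis. (u \<bullet> i) *\<^sub>R integral {0..1} (\<lambda>t. M i (ray x t))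
     + ((x - q) \<bullet> i) *\<^sub>R integral {0..1} (\<lambda>t. fd (M i) (ray x t) (t *\<^sub>R u))))) (at x)"
  proof -
    have "((\<lambda>x. ((x - q) \<bullet> i) *\<^sub>R integral {0..1} (\<lambda>t. M i (ray x t))) has_derivative
      (\<lambda>u. ((x - q) \<bullet> i) *\<^sub>R integral {0..1} (\<lambda>t. fd (M i) (ray x t) (t *\<^sub>R u)) +
        (u \<bullet> i) *\<^sub>R integral {0..1} (\<lambda>t. M i (ray x t)))) (at x)" for i
      by (rule bounded_bilinear.FDERIV[OF bounded_bilinear_scaleR _ M']) (auto intro!: derivative_eq_intros)
    from has_derivative_diff[OF has_derivative_const has_derivative_sum[OF this]]
    show ?thesis by (simp add: add.commute)
  qed
  moreover have "w - (\<Sum>i\<in>Basis. ((y - q) \<bullet> i) *\<^sub>R integral {0..1} (\<lambda>t. M i (ray y t))) = step w Y y"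
    if y: "y \<in> ball q r" for y
  proof -
    have "integral {0..1} (\<lambda>t. M (y - q) (ray y t)) =
      integral {0..1} (\<lambda>t. \<Sum>i\<in>Basis. ((y - q) \<bullet> i) *\<^sub>R M i (ray y t))"
      by (rule integral_cong) (rule M_sum[OF bdV[OF seg[OF y]]])
    also have "\<dots> = (\<Sum>i\<in>Basis. integral {0..1} (\<lambda>t. ((y - q) \<bullet> i) *\<^sub>R M i (ray y t)))"
      by (intro integral_sum integrable_continuous_real continuous_on_scaleR continuous_on_const seg_cont1[OF M_cont] y finite_Basis)
    finally show ?thesis by (simp add: step_def M_def)
  qed
  ultimately show ?thesis
    by (rule has_derivative_transform_within_open[OF _ open_ball x])
qed

text \<open>The homotopy argument of the Poincare lemma: once \<open>fd_M_swap\<close> has exchanged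
  \<open>x - q\<close> and \<open>u\<close>, the derivative of the integrand becomes d/dt (t M u),
  whose integral is \<open>M u x\<close>; the exchange costs the integral of the \<open>Z\<close>
  terms.\<close>

lemma step_defect:
  assumes x: "x \<in> ball q r"
  shows "fd (step w Y) x u + G x u (step w Y x) = G x u (step w Y x - Y x) -
    integral {0..1} (\<lambda>t. t *\<^sub>R (G (ray x t) (x - q) (Z u (ray x t))
      - G (ray x t) u (Z (x - q) (ray x t))))"
proof -
  define a where "a = x - q"
  define c where "c = (\<lambda>t::real. q + t *\<^sub>R a)"
  have c: "c t \<in> ball q r" if "t \<in> {0..1}" for t using seg[OF x that] by (simp add: c_def a_def)
  have cont: "continuous_on {0..1} (\<lambda>t. f (c t))" if "continuous_on (ball q r) f" for f :: "'a \<Rightarrow> 'b"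
    unfolding c_def a_def by (rule seg_cont1[OF that x])
  note [continuous_intros] = cont[OF M_cont] cont[OF dM_cont]
  have linM: "fd (M u) (c t) (s *\<^sub>R v) = s *\<^sub>R fd (M u) (c t) v" if "t \<in> {0..1}" for u t s v
    by (rule linear_cmul[OF has_derivative_linear[OF C_k_on_has_derivative[OF M_C1 c[OF that]]]])
  have fd_sumM: "fd (M v) y u = (\<Sum>i\<in>Basis. (v \<bullet> i) *\<^sub>R fd (M i) y u)" if y: "y \<in> ball q r" for v y
  proof -
    have "((\<lambda>y. \<Sum>i\<in>Basis. (v \<bullet> i) *\<^sub>R M i y) has_derivative (\<lambda>u. \<Sum>i\<in>Basis. (v \<bullet> i) *\<^sub>R fd (M i) y u)) (at y)"
      by (auto intro!: derivative_eq_intros C_k_on_has_derivative[OF M_C1 y])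
    from has_derivative_transform_within_open[OF this open_ball y M_sum[symmetric, OF bdV]]
    show ?thesis by (simp add: fd_eq)
  qed
  have "fd (step w Y) x u = - (\<Sum>i\<in>Basis. (u \<bullet> i) *\<^sub>R integral {0..1} (\<lambda>t. M i (c t))
     + (a \<bullet> i) *\<^sub>R integral {0..1} (\<lambda>t. fd (M i) (c t) (t *\<^sub>R u)))"
    using fd_eq[OF step_has_derivative[OF x]] by (simp add: c_def a_def)
  also have "(\<Sum>i\<in>Basis. (u \<bullet> i) *\<^sub>R integral {0..1} (\<lambda>t. M i (c t))
     + (a \<bullet> i) *\<^sub>R integral {0..1} (\<lambda>t. fd (M i) (c t) (t *\<^sub>R u))) =
     (\<Sum>i\<in>Basis. integral {0..1} (\<lambda>t. (u \<bullet> i) *\<^sub>R M i (c t) + (a \<bullet> i) *\<^sub>R t *\<^sub>R fd (M i) (c t) u))"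
  proof (rule sum.cong[OF refl])
    fix i :: 'a
    have "integral {0..1} (\<lambda>t. fd (M i) (c t) (t *\<^sub>R u)) = integral {0..1} (\<lambda>t. t *\<^sub>R fd (M i) (c t) u)"
      by (rule integral_cong) (rule linM)
    moreover have "(\<lambda>t. (u \<bullet> i) *\<^sub>R M i (c t)) integrable_on {0..1}" "(\<lambda>t. (a \<bullet> i) *\<^sub>R t *\<^sub>R fd (M i) (c t) u) integrable_on {0..1}"
      by (intro integrable_continuous_real continuous_intros)+
    ultimately show "(u \<bullet> i) *\<^sub>R integral {0..1} (\<lambda>t. M i (c t)) + (a \<bullet> i) *\<^sub>R integral {0..1} (\<lambda>t. fd (M i) (c t) (t *\<^sub>R u))
      = integral {0..1} (\<lambda>t. (u \<bullet> i) *\<^sub>R M i (c t) + (a \<bullet> i) *\<^sub>R t *\<^sub>R fd (M i) (c t) u)"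
      by (simp add: integral_add del: scaleR_scaleR)
  qed
  also have "\<dots> = integral {0..1} (\<lambda>t. \<Sum>i\<in>Basis. (u \<bullet> i) *\<^sub>R M i (c t) + (a \<bullet> i) *\<^sub>R t *\<^sub>R fd (M i) (c t) u)"
    by (intro integral_sum[symmetric] integrable_continuous_real continuous_intros) auto
  also have "\<dots> = integral {0..1} (\<lambda>t. M u (c t) + t *\<^sub>R fd (M a) (c t) u)"
  proof (rule integral_cong)
    fix t :: real assume t: "t \<in> {0..1}"
    show "(\<Sum>i\<in>Basis. (u \<bullet> i) *\<^sub>R M i (c t) + (a \<bullet> i) *\<^sub>R t *\<^sub>R fd (M i) (c t) u) = M u (c t) + t *\<^sub>R fd (M a) (c t) u"
      unfolding M_sum[OF bdV[OF c[OF t]], of u] fd_sumM[OF c[OF t], of a]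
      by (simp add: sum.distrib scaleR_sum_right mult.commute)
  qed
  also have "\<dots> = integral {0..1} (\<lambda>t. (M u (c t) + t *\<^sub>R fd (M u) (c t) a) +
      t *\<^sub>R (fd (M a) (c t) u - fd (M u) (c t) a))"
    by (simp add: algebra_simps)
  also have "\<dots> = integral {0..1} (\<lambda>t. M u (c t) + t *\<^sub>R fd (M u) (c t) a) +
      integral {0..1} (\<lambda>t. t *\<^sub>R (fd (M a) (c t) u - fd (M u) (c t) a))"
    by (intro integral_add integrable_continuous_real continuous_intros)
  also have "integral {0..1} (\<lambda>t. t *\<^sub>R (fd (M a) (c t) u - fd (M u) (c t) a)) =
      integral {0..1} (\<lambda>t. t *\<^sub>R (G (c t) a (Z u (c t)) - G (c t) u (Z a (c t))))"
    by (intro integral_cong) (simp add: fd_M_swap[OF c, of _ a u])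
  also have "integral {0..1} (\<lambda>t. M u (c t) + t *\<^sub>R fd (M u) (c t) a) = M u x"
  proof (rule integral_unique)
    have "((\<lambda>t. M u (c t) + t *\<^sub>R fd (M u) (c t) a) has_integral 1 *\<^sub>R M u (c 1) - 0 *\<^sub>R M u (c 0)) {0..1}"
    proof (rule fundamental_theorem_of_calculus)
      fix t :: real assume t: "t \<in> {0..1}"
      have "((\<lambda>t. M u (c t)) has_derivative (\<lambda>h. fd (M u) (c t) (h *\<^sub>R a))) (at t within {0..1})"
        by (rule has_derivative_compose[of c "\<lambda>h. h *\<^sub>R a" t "{0..1}" "M u", OF _ C_k_on_has_derivative[OF M_C1 c[OF t]]])
          (auto simp: c_def intro!: derivative_eq_intros)
      then have "((\<lambda>t. M u (c t)) has_vector_derivative fd (M u) (c t) a) (at t within {0..1})"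
        by (simp add: has_vector_derivative_def linM[OF t])
      then show "((\<lambda>t. t *\<^sub>R M u (c t)) has_vector_derivative M u (c t) + t *\<^sub>R fd (M u) (c t) a) (at t within {0..1})"
        by (auto intro!: derivative_eq_intros)
    qed simp
    then show "((\<lambda>t. M u (c t) + t *\<^sub>R fd (M u) (c t) a) has_integral M u x) {0..1}"
      by (simp add: c_def a_def)
  qed
  finally show ?thesis
    by (simp add: M_def G_diff2[OF bdV[OF x]] c_def a_def)
qed

lemma step_C1: "C_k_on 1 (step w Y) (ball q r)"
proof -
  have "C_k_on (Suc 0) (step w Y) (ball q r)"
  proof (rule C_k_on_SucI[OF open_ball step_has_derivative])
    fix u
    have eq: "integral {0..1} (\<lambda>t. fd (M i) (ray x t) (t *\<^sub>R u)) =
        integral (cbox 0 1) (\<lambda>t. t *\<^sub>R fd (M i) (ray x t) u)" if "x \<in> ball q r" for i x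
      unfolding cbox_interval
      by (intro integral_cong linear_cmul[OF has_derivative_linear[OF C_k_on_has_derivative[OF M_C1 seg]]] that)
    have "continuous_on (ball q r) (\<lambda>x. - (\<Sum>i\<in>Basis. (u \<bullet> i) *\<^sub>R integral (cbox 0 1) (\<lambda>t. M i (ray x t))
     + ((x - q) \<bullet> i) *\<^sub>R integral (cbox 0 1) (\<lambda>t. t *\<^sub>R fd (M i) (ray x t) u)))"
      by (intro continuous_intros integral_continuous_on_param;
          unfold split_beta cbox_interval;
          intro continuous_on_scaleR continuous_on_snd continuous_on_id seg_cont2[OF M_cont] seg_cont2[OF dM_cont])
    then show "C_k_on 0 (\<lambda>x. - (\<Sum>i\<in>Basis. (u \<bullet> i) *\<^sub>R integral {0..1} (\<lambda>t. M i (ray x t))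
     + ((x - q) \<bullet> i) *\<^sub>R integral {0..1} (\<lambda>t. fd (M i) (ray x t) (t *\<^sub>R u)))) (ball q r)"
      unfolding C_k_on.simps by (rule continuous_on_eq) (simp add: eq)
  qed
  then show ?thesis by simp
qed

text \<open>Each of the two \<open>Z\<close> terms is at most
  \<open>C * norm (x - q) * K * norm u\<close>, and \<open>8 * C * r \<le> 1\<close> turns their sum
  into \<open>K / 4 * norm u\<close>. The change \<open>L\<close> of the iterate enters through
  \<open>G x u (step w Y x - Y x)\<close>.\<close>

lemma step_defect_bound:
  assumes x: "x \<in> ball q r" and K: "\<And>y u. y \<in> ball q r \<Longrightarrow> norm (fd Y y u + G y u (Y y)) \<le> K * norm u"
    and L: "norm (step w Y x - Y x) \<le> L"
  shows "norm (fd (step w Y) x u + G x u (step w Y x)) \<le> (C * L + K / 4) * norm u"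
proof -
  have K0: "0 \<le> K * norm u" using K[of q u] r(1) by (smt (verit) centre_in_ball norm_ge_zero)
  have bd: "norm (t *\<^sub>R (G (ray x t) (x - q) (Z u (ray x t))
      - G (ray x t) u (Z (x - q) (ray x t)))) \<le> K / 4 * norm u"
    if t: "t \<in> {0..1}" for t
  proof -
    define y where "y = ray x t"
    have y: "y \<in> ball q r" using seg[OF x t] by (simp add: y_def)
    have "norm (G y (x - q) (Z u y)) \<le> C * norm (x - q) * (K * norm u)"
      by (rule order_trans[OF G_bd[OF y]]) (use C K[OF y] in \<open>auto simp: Z_def intro!: mult_left_mono\<close>)
    moreover have "norm (G y u (Z (x - q) y)) \<le> C * norm u * (K * norm (x - q))"
      by (rule order_trans[OF G_bd[OF y]]) (use C K[OF y] in \<open>auto simp: Z_def intro!: mult_left_mono\<close>)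
    ultimately have "norm (G y (x - q) (Z u y) - G y u (Z (x - q) y)) \<le> (2 * C * norm (x - q)) * (K * norm u)"
      using norm_triangle_ineq4[of "G y (x - q) (Z u y)" "G y u (Z (x - q) y)"] by (simp add: algebra_simps)
    also have "2 * C * norm (x - q) \<le> 1 / 4"
      using C_norm[OF x] by linarith
    then have "(2 * C * norm (x - q)) * (K * norm u) \<le> 1 / 4 * (K * norm u)"
      using K0 by (rule mult_right_mono)
    finally have *: "norm (G y (x - q) (Z u y) - G y u (Z (x - q) y)) \<le> K / 4 * norm u" by simp
    have "\<bar>t\<bar> * norm (G y (x - q) (Z u y) - G y u (Z (x - q) y)) \<le> 1 * norm (G y (x - q) (Z u y) - G y u (Z (x - q) y))"
      using t by (intro mult_right_mono) auto
    with * show ?thesis by (simp add: y_def[symmetric])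
  qed
  have "norm (integral {0..1} (\<lambda>t. t *\<^sub>R (G (ray x t) (x - q) (Z u (ray x t))
      - G (ray x t) u (Z (x - q) (ray x t))))) \<le> integral {0..1} (\<lambda>t::real. K / 4 * norm u)"
  proof (rule integral_norm_bound_integral[OF _ _ bd])
    have "continuous_on {0..1} (\<lambda>t. t *\<^sub>R (fd (M (x - q)) (ray x t) u - fd (M u) (ray x t) (x - q)))"
      by (intro continuous_on_scaleR continuous_on_diff continuous_on_id seg_cont1[OF dM_cont x])
    then show "(\<lambda>t. t *\<^sub>R (G (ray x t) (x - q) (Z u (ray x t))
      - G (ray x t) u (Z (x - q) (ray x t)))) integrable_on {0..1}"
      by (intro integrable_continuous_real) (rule continuous_on_eq, assumption, simp add: fd_M_swap[OF seg[OF x], of _ "x - q" u])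
  qed auto
  then have 1: "norm (integral {0..1} (\<lambda>t. t *\<^sub>R (G (ray x t) (x - q) (Z u (ray x t))
      - G (ray x t) u (Z (x - q) (ray x t))))) \<le> K / 4 * norm u" by simp
  have 2: "norm (G x u (step w Y x - Y x)) \<le> C * norm u * L"
    by (rule order_trans[OF G_bd[OF x]]) (use C L in \<open>auto intro!: mult_left_mono\<close>)
  show ?thesis
    unfolding step_defect[OF x] using norm_triangle_ineq4 1 2 by (smt (verit) distrib_right mult.assoc mult.commute)
qed

end

lemma step_contract:
  assumes "C_k_on 1 Y (ball q r)" "C_k_on 1 Y' (ball q r)" "x \<in> ball q r"
    and L: "\<And>y. y \<in> ball q r \<Longrightarrow> norm (Y y - Y' y) \<le> L"
  shows "norm (step w Y x - step w Y' x) \<le> L / 2"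
proof -
  note x = assms(3)
  define f where "f = (\<lambda>Y t. G (ray x t) (x - q) (Y (ray x t)))"
  have int: "f Y integrable_on {0..1}" if "C_k_on 1 Y (ball q r)" for Y
    using seg_cont1[OF that M_cont[OF that, of "x - q"] x]
    by (intro integrable_continuous_real) (simp add: f_def M_def[OF that])
  have "norm (f Y' t - f Y t) \<le> L / 2" if t: "t \<in> {0..1}" for t
  proof -
    define y where "y = ray x t"
    have y: "y \<in> ball q r" using seg[OF x t] by (simp add: y_def)
    have L0: "0 \<le> L" using L[OF y] norm_ge_zero order_trans by blast
    have "f Y' t - f Y t = G y (x - q) (Y' y - Y y)"
      by (simp add: f_def y_def[symmetric] G_diff2[OF bdV[OF y]])
    also have "norm \<dots> \<le> C * norm (x - q) * L"
      by (rule order_trans[OF G_bd[OF y]]) (use C L[OF y] in \<open>auto simp: norm_minus_commute intro!: mult_left_mono\<close>)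
    also have "C * norm (x - q) \<le> 1 / 2"
      using C_norm[OF x] by linarith
    then have "C * norm (x - q) * L \<le> 1 / 2 * L" using L0 by (rule mult_right_mono)
    finally show ?thesis by simp
  qed
  then have "norm (integral {0..1} (\<lambda>t. f Y' t - f Y t)) \<le> integral {0..1} (\<lambda>t::real. L / 2)"
    by (intro integral_norm_bound_integral integrable_diff int assms) auto
  moreover have "integral {0..1} (\<lambda>t. f Y' t - f Y t) = step w Y x - step w Y' x"
    by (subst integral_diff[OF int[OF assms(2)] int[OF assms(1)]]) (simp add: step_def f_def)
  ultimately show ?thesis by simp
qed

definition iter :: "'b \<Rightarrow> nat \<Rightarrow> 'a \<Rightarrow> 'b" where "iter w n = ((step w) ^^ n) (\<lambda>x. w)"

lemma iter_Suc: "iter w (Suc n) = step w (iter w n)" by (simp add: iter_def)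
lemma iter_0: "iter w 0 = (\<lambda>x. w)" by (simp add: iter_def)

lemma iter_C1: "C_k_on 1 (iter w n) (ball q r)"
proof (induction n)
  case 0 show ?case unfolding iter_0 by (rule C_k_on_const)
next
  case (Suc n) then show ?case unfolding iter_Suc by (rule step_C1)
qed

lemma iter_diff: "x \<in> ball q r \<Longrightarrow> norm (iter w (Suc n) x - iter w n x) \<le> norm w * (1/2) ^ Suc n"
proof (induction n arbitrary: x)
  case 0
  \<comment> \<open>The initial constant \<open>w\<close> is \<open>step w\<close> applied to 0, so
    the first difference is also covered by \<open>step_contract\<close>, with bound
    \<open>norm w\<close>.\<close>
  have "integral {0..1} (\<lambda>t. G (ray x t) (x - q) 0) = integral {0..1} (\<lambda>t::real. 0 :: 'b)"
    by (intro integral_cong G_02 bdV seg 0)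
  then have "step w (\<lambda>x. 0) x = w" by (simp add: step_def)
  moreover have "norm (step w (\<lambda>x. w) x - step w (\<lambda>x. 0) x) \<le> norm w / 2"
    using 0 by (intro step_contract C_k_on_const) auto
  ultimately show ?case by (simp add: iter_Suc iter_0)
next
  case (Suc n)
  then have "norm (step w (iter w (Suc n)) x - step w (iter w n) x) \<le> norm w * (1/2) ^ Suc n / 2"
    by (intro step_contract iter_C1) auto
  then show ?case by (simp add: iter_Suc)
qed

text \<open>The bound reproduces itself under \<open>step_defect_bound\<close>: if d is the bound
  for \<open>n\<close>, then \<open>C * L\<close> with \<open>L\<close> from
  \<open>iter_diff\<close> is d / 4, and the old defect contributes another d / 4, so the defect is
  halved.\<close>

lemma iter_defect:
  "x \<in> ball q r \<Longrightarrow> norm (fd (iter w n) x u + G x u (iter w n x)) \<le> 2 * C * norm w * (1/2) ^ n * norm u"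
proof (induction n arbitrary: x u)
  case 0
  have "norm (G x u w) \<le> C * norm u * norm w" by (rule G_bd[OF 0])
  also have "\<dots> \<le> 2 * C * norm w * norm u" using C by (simp add: mult_ac)
  finally show ?case by (simp add: iter_0 frechet_derivative_const)
next
  case (Suc n)
  have "norm (fd (step w (iter w n)) x u + G x u (step w (iter w n) x))
      \<le> (C * (norm w * (1/2) ^ Suc n) + 2 * C * norm w * (1/2) ^ n / 4) * norm u"
    using iter_diff[OF Suc.prems, of w n]
    by (intro step_defect_bound iter_C1 Suc) (auto simp: iter_Suc)
  then show ?case by (simp add: iter_Suc algebra_simps)
qed

lemma parallel_exists:
  "\<exists>Y. Y q = w \<and> (\<forall>x\<in>ball q r. (Y has_derivative (\<lambda>u. - G x u (Y x))) (at x))"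
proof -
  \<comment> \<open>The iterates are written as partial sums, so that the Weierstrass test gives
    uniform convergence.\<close>
  define D where "D = (\<lambda>n x. iter w (Suc n) x - iter w n x)"
  define Y where "Y = (\<lambda>x. w + (\<Sum>n. D n x))"
  have sumD: "(\<Sum>i<n. D i x) = iter w n x - w" for n x
    unfolding D_def by (subst sum_lessThan_telescope) (simp add: iter_0)
  have sm: "summable (\<lambda>n. norm w * (1/2) ^ Suc n)"
    by (intro summable_mult) (simp add: summable_geometric)
  have "uniform_limit (ball q r) (\<lambda>n x. \<Sum>i<n. D i x) (\<lambda>x. \<Sum>i. D i x) sequentially"
    unfolding D_def by (rule Weierstrass_m_test[OF iter_diff sm])
  then have lim: "uniform_limit (ball q r) (iter w) Y sequentially"
    unfolding sumD uniform_limit_iff Y_def by (simp add: dist_norm algebra_simps)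
  \<comment> \<open>The derivatives of the iterates converge uniformly to
    \<open>- G x u (Y x)\<close>, because their defects tend to 0 and \<open>G\<close> is bounded on
    the ball; so the limit may be differentiated.\<close>
  have "\<exists>g. \<forall>x\<in>ball q r. (\<lambda>n. iter w n x) \<longlonglongrightarrow> g x \<and>
      (g has_derivative (\<lambda>u. - G x u (Y x))) (at x within ball q r)"
  proof (rule has_derivative_sequence[OF convex_ball])
    show "(iter w n has_derivative fd (iter w n) x) (at x within ball q r)" if "x \<in> ball q r" for n x
      by (rule has_derivative_at_withinI[OF Yd[OF iter_C1 that]])
    show "q \<in> ball q r" using r by simp
    then show "(\<lambda>n. iter w n q) \<longlonglongrightarrow> Y q" by (rule tendsto_uniform_limitI[OF lim])
    fix e :: real assume e: "e > 0"
    have "\<forall>\<^sub>F n in sequentially. \<forall>x\<in>ball q r. dist (iter w n x) (Y x) < e / 2 / C"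
      using lim C e unfolding uniform_limit_iff by simp
    moreover have "\<forall>\<^sub>F n in sequentially. 2 * C * norm w * (1/2) ^ n < e / 2"
    proof -
      have "(\<lambda>n. 2 * C * norm w * (1/2) ^ n) \<longlonglongrightarrow> 2 * C * norm w * 0"
        by (intro tendsto_intros LIMSEQ_power_zero) simp
      then show ?thesis using e by (auto dest: order_tendstoD(2)[of _ _ _ "e/2"])
    qed
    ultimately show "\<forall>\<^sub>F n in sequentially. \<forall>x\<in>ball q r. \<forall>h. norm (fd (iter w n) x h - - G x h (Y x)) \<le> e * norm h"
    proof eventually_elim
      case (elim n)
      show ?case
      proof (intro ballI allI)
        fix x h assume x: "x \<in> ball q r"
        have "fd (iter w n) x h - - G x h (Y x) = (fd (iter w n) x h + G x h (iter w n x)) + G x h (Y x - iter w n x)"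
          by (simp add: G_diff2[OF bdV[OF x]])
        also have "norm \<dots> \<le> 2 * C * norm w * (1/2) ^ n * norm h + C * norm h * norm (Y x - iter w n x)"
          by (intro norm_triangle_mono iter_defect[OF x] G_bd[OF x])
        also have "\<dots> \<le> e / 2 * norm h + C * norm h * (e / 2 / C)"
          using elim x C by (intro add_mono mult_right_mono mult_left_mono)
            (auto simp: dist_norm norm_minus_commute less_imp_le)
        also have "\<dots> = e * norm h" using C by (simp add: field_simps)
        finally show "norm (fd (iter w n) x h - - G x h (Y x)) \<le> e * norm h" .
      qed
    qed
  qed
  then obtain g where g: "\<And>x. x \<in> ball q r \<Longrightarrow> (\<lambda>n. iter w n x) \<longlonglongrightarrow> g x"
     "\<And>x. x \<in> ball q r \<Longrightarrow> (g has_derivative (\<lambda>u. - G x u (Y x))) (at x within ball q r)" by blast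
  have gY: "g x = Y x" if "x \<in> ball q r" for x
    using LIMSEQ_unique g(1)[OF that] tendsto_uniform_limitI[OF lim that] by blast
  have "(g has_derivative (\<lambda>u. - G x u (g x))) (at x)" if "x \<in> ball q r" for x
    using g(2)[OF that] gY[OF that] at_within_open[OF that open_ball] by simp
  moreover have "g q = w"
  proof -
    have "iter w n q = w" for n
    proof (cases n)
      case (Suc m)
      have "G q 0 (iter w m q) = 0" using G_01[OF bdV] r by simp
      then show ?thesis by (simp add: Suc iter_Suc step_def)
    qed (simp add: iter_0)
    then show ?thesis using g(1)[of q] r by (simp add: LIMSEQ_const_iff)
  qed
  ultimately show ?thesis by blast
qed

end

text \<open>One radius serves every initial value \<open>w\<close>, because the equation is linear:
  \<open>r\<close> depends only on a bound for \<open>G\<close> near \<open>q\<close>. So a whole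
  frame extends to the same ball.\<close>

theorem (in flat_conn) parallel_sections:
  assumes "q \<in> V"
  obtains r where "r > 0" "ball q r \<subseteq> V"
    "\<And>w. \<exists>Y. Y q = w \<and> (\<forall>x\<in>ball q r. (Y has_derivative (\<lambda>u. - G x u (Y x))) (at x))"
proof -
  obtain R where R: "R > 0" "cball q R \<subseteq> V" using open_V assms open_contains_cball by blast
  obtain C where C: "C > 0" "\<And>x u w. x \<in> cball q R \<Longrightarrow> norm (G x u w) \<le> C * norm u * norm w"
    using G_bound[OF compact_cball R(2)] by metis
  define r where "r = min R (1 / (8 * C))"
  have "r > 0" "r \<le> R" "8 * C * r \<le> 1" using R C by (auto simp: r_def min_def field_simps)
  moreover then have "ball q r \<subseteq> cball q R" by auto
  ultimately interpret picard V G q r C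
    using R C by unfold_locales auto
  show thesis by (rule that[OF r parallel_exists])
qed

section \<open>Affine charts and holomorphic functions\<close>

text \<open>A local diffeomorphism \<open>\<psi>\<close> to an affine model space, along which the
  flat connection and a constant symplectic form are pulled back. Injectivity is asked of its
  derivative only, as \<open>\<psi>\<close> need not be a global chart.\<close>

locale affine_chart =
  fixes U :: "'a::euclidean_space set" and \<psi> :: "'a \<Rightarrow> 'a"
  assumes open_U: "open U" and smooth_\<psi>: "smooth_on \<psi> U"
    and inj_\<psi>: "z \<in> U \<Longrightarrow> fd \<psi> z v = 0 \<Longrightarrow> v = 0"
begin

definition d2 :: "'a \<Rightarrow> 'a \<Rightarrow> 'a \<Rightarrow> 'a" where "d2 z u v = fd (\<lambda>y. fd \<psi> y v) z u"

lemma linear_d\<psi>: "z \<in> U \<Longrightarrow> linear (fd \<psi> z)"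
  by (rule has_derivative_linear[OF smooth_on_has_derivative[OF smooth_\<psi>]])

lemma inj_d\<psi>: "z \<in> U \<Longrightarrow> fd \<psi> z u = fd \<psi> z v \<Longrightarrow> u = v"
  using inj_\<psi>[of z "u - v"] linear_diff[OF linear_d\<psi>] by force

lemma surj_d\<psi>: "z \<in> U \<Longrightarrow> \<exists>v. fd \<psi> z v = w"
  using linear_injective_imp_surjective[OF linear_d\<psi>, of z] inj_d\<psi>[of z]
  by (metis injI surjE)

lemma d\<psi>_d2: "z \<in> U \<Longrightarrow> ((\<lambda>y. fd \<psi> y v) has_derivative (\<lambda>u. d2 z u v)) (at z)"
  unfolding d2_def by (rule smooth_on_has_derivative[OF smooth_on_fd[OF smooth_\<psi>]])

lemma d2_sym: "z \<in> U \<Longrightarrow> d2 z u v = d2 z v u"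
  unfolding d2_def by (rule fd_fd_commute[OF open_U smooth_\<psi>])

lemma linear_d2: "z \<in> U \<Longrightarrow> linear (\<lambda>u. d2 z u v)"
  by (rule has_derivative_linear[OF d\<psi>_d2])

lemma d2_d2: "z \<in> U \<Longrightarrow> fd (\<lambda>y. d2 y v w) z u = fd (\<lambda>y. d2 y u w) z v"
  unfolding d2_def by (rule fd_fd_commute[OF open_U smooth_on_fd[OF smooth_\<psi>]])

context
  fixes G assumes G: "\<And>z u v. z \<in> U \<Longrightarrow> fd \<psi> z (G z u v) = d2 z u v"
begin

lemma G_sym: "z \<in> U \<Longrightarrow> G z u v = G z v u"
proof -
  assume z: "z \<in> U"
  show ?thesis by (rule inj_d\<psi>[OF z]) (simp only: G[OF z] d2_sym[OF z, of u v])
qed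

lemma G_linear: "z \<in> U \<Longrightarrow> linear (\<lambda>u. G z u v)"
  by (rule linearI; rule inj_d\<psi>[of z])
    (simp_all add: G linear_add[OF linear_d\<psi>] linear_cmul[OF linear_d\<psi>] linear_add[OF linear_d2] linear_cmul[OF linear_d2])

lemma G_bilinear: "z \<in> U \<Longrightarrow> bilinear (G z)"
proof -
  assume z: "z \<in> U"
  have "linear (G z u)" for u
    using G_linear[OF z, of u] by (rule back_subst[of linear]) (rule ext, rule G_sym[OF z])
  then show ?thesis using G_linear[OF z] by (simp add: bilinear_def)
qed

text \<open>Differentiating \<open>fd \<psi> z (G z v w) = d2 z v w\<close> shows that the injective
  map \<open>fd \<psi> z\<close> sends either side to a third derivative of \<open>\<psi>\<close>,
  and those are symmetric in \<open>u\<close> and \<open>v\<close>.\<close>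

lemma G_flat:
  assumes z: "z \<in> U" and G': "\<And>u v. smooth_on (\<lambda>z. G z u v) U"
  shows "fd (\<lambda>y. G y v w) z u + G z u (G z v w) = fd (\<lambda>y. G y u w) z v + G z v (G z u w)"
proof -
  have "fd \<psi> z (fd (\<lambda>y. G y v w) z u + G z u (G z v w)) = fd (\<lambda>y. d2 y v w) z u" for u v
  proof -
    have "((\<lambda>y. fd \<psi> y (G y v w)) has_derivative
        (\<lambda>u. d2 z u (G z v w) + fd \<psi> z (fd (\<lambda>y. G y v w) z u))) (at z)"
      by (rule has_derivative_apply[OF open_U z linear_d\<psi> d\<psi>_d2[OF z] smooth_on_has_derivative[OF G' z]])
    from has_derivative_transform_within_open[OF this open_U z G]
    have "fd (\<lambda>y. d2 y v w) z = (\<lambda>u. d2 z u (G z v w) + fd \<psi> z (fd (\<lambda>y. G y v w) z u))"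
      by (rule fd_eq)
    then show ?thesis by (simp add: linear_add[OF linear_d\<psi>[OF z]] G[OF z])
  qed
  then show ?thesis using inj_d\<psi>[OF z] d2_d2[OF z, of v w u] by metis
qed

end

context
  fixes \<Omega> :: "'a \<Rightarrow> 'a \<Rightarrow> real"
  assumes \<Omega>: "bounded_bilinear \<Omega>" and \<Omega>_self: "\<And>a. \<Omega> a a = 0"
    and \<Omega>_nondeg: "\<And>a. (\<And>b. \<Omega> a b = 0) \<Longrightarrow> a = 0"
begin

abbreviation \<omega> where "\<omega> z u v \<equiv> \<Omega> (fd \<psi> z u) (fd \<psi> z v)"

interpretation \<Omega>: bounded_bilinear \<Omega> by (rule \<Omega>)

lemma \<Omega>_swap: "\<Omega> a b = - \<Omega> b a"
  using \<Omega>_self[of "a + b"] \<Omega>_self[of a] \<Omega>_self[of b] by (simp add: \<Omega>.add_left \<Omega>.add_right)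

lemma \<omega>_derivative:
  assumes z: "z \<in> U"
  shows "fd (\<lambda>z. \<omega> z v w) z u = \<Omega> (d2 z u v) (fd \<psi> z w) + \<Omega> (fd \<psi> z v) (d2 z u w)"
proof -
  have "((\<lambda>z. \<omega> z v w) has_derivative (\<lambda>u. \<Omega> (fd \<psi> z v) (d2 z u w) + \<Omega> (d2 z u v) (fd \<psi> z w))) (at z)"
    by (intro bounded_bilinear.FDERIV[OF \<Omega>] d\<psi>_d2 z)
  then show ?thesis by (simp add: fd_eq)
qed

lemma \<omega>_parallel:
  assumes z: "z \<in> U" and G: "\<And>u v. fd \<psi> z (G u v) = d2 z u v"
  shows "fd (\<lambda>z. \<omega> z v w) z u - \<omega> z (G u v) w - \<omega> z v (G u w) = 0"
  unfolding \<omega>_derivative[OF z] by (simp add: G)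

text \<open>The six terms cancel in pairs, since second derivatives of \<open>\<psi>\<close> are
  symmetric and \<open>\<Omega>\<close> is alternating.\<close>

lemma \<omega>_closed:
  assumes z: "z \<in> U"
  shows "fd (\<lambda>z. \<omega> z v w) z u + fd (\<lambda>z. \<omega> z w u) z v + fd (\<lambda>z. \<omega> z u v) z w = 0"
  unfolding \<omega>_derivative[OF z]
  using \<Omega>_swap[of "d2 z u v" "fd \<psi> z w"] \<Omega>_swap[of "d2 z v w" "fd \<psi> z u"] \<Omega>_swap[of "d2 z w u" "fd \<psi> z v"]
  by (simp add: d2_sym[OF z, of v u] d2_sym[OF z, of w v] d2_sym[OF z, of u w])

lemma \<omega>_smooth: "smooth_on (\<lambda>z. \<omega> z v w) U"
  by (rule smooth_on_bilinear[OF open_U \<Omega> smooth_on_fd[OF smooth_\<psi>] smooth_on_fd[OF smooth_\<psi>]])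

lemma \<omega>_nondeg: "z \<in> U \<Longrightarrow> (\<And>v. \<omega> z u v = 0) \<Longrightarrow> u = 0"
  using surj_d\<psi> inj_\<psi> \<Omega>_nondeg[of "fd \<psi> z u"] by metis

lemma \<omega>_bilinear: "z \<in> U \<Longrightarrow> bilinear (\<omega> z)"
  unfolding bilinear_def
  by (auto intro!: linearI simp: linear_add[OF linear_d\<psi>] linear_cmul[OF linear_d\<psi>]
    \<Omega>.add_left \<Omega>.add_right \<Omega>.scaleR_left \<Omega>.scaleR_right)

end

end

section \<open>Holomorphic functions, their gradients and complex Hessians\<close>

lemma cs_J: "Jc.cs c v = c *s v"
  by (simp add: Jc.cs_def J_def vec_eq_iff complex_eq_iff)

lemma complex_linear_mult:
  assumes "linear L" "\<And>v. L (J v) = J1 (L v)"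
  shows "L (c *s v) = c * L v"
proof -
  have "L (Re c *\<^sub>R v + Im c *\<^sub>R J v) = Re c *\<^sub>R L v + Im c *\<^sub>R (\<i> * L v)"
    by (simp only: linear_add[OF assms(1)] linear_cmul[OF assms(1)] assms(2) J1_def)
  then show ?thesis by (simp add: cs_J[symmetric] Jc.cs_def complex_eq_iff)
qed

lemma complex_linear_smult:
  assumes "linear L" "\<And>v. L (J v) = J (L v)"
  shows "L (c *s v) = c *s L v"
proof -
  have "L (Re c *\<^sub>R v + Im c *\<^sub>R J v) = Re c *\<^sub>R L v + Im c *\<^sub>R J (L v)"
    by (simp only: linear_add[OF assms(1)] linear_cmul[OF assms(1)] assms(2))
  then show ?thesis by (simp add: cs_J[symmetric] Jc.cs_def)
qed

lemma complex_linear_expand: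
  assumes "linear L" "\<And>v. L (J v) = J1 (L v)"
  shows "L v = (\<Sum>i\<in>UNIV. v $ i * L (axis i 1))"
proof -
  have "L v = L (\<Sum>i\<in>UNIV. v $ i *s axis i 1)" by (simp only: basis_expansion)
  also have "\<dots> = (\<Sum>i\<in>UNIV. L (v $ i *s axis i 1))" by (rule linear_sum[OF assms(1)])
  finally show ?thesis by (simp only: complex_linear_mult[OF assms])
qed

definition dot :: "complex^'n \<Rightarrow> complex^'n \<Rightarrow> complex" where "dot u v = (\<Sum>i\<in>UNIV. u $ i * v $ i)"

lemma dot_smult: "dot (c *s u) v = c * dot u v" "dot u (c *s v) = c * dot u v"
  by (simp_all add: dot_def sum_distrib_left mult_ac)

definition grad :: "(complex^'n \<Rightarrow> complex) \<Rightarrow> complex^'n \<Rightarrow> complex^'n" where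
  "grad F z = (\<chi> i. dz i F z)"

lemma dz_eq:
  assumes "holo_on J J1 F U" "z \<in> U"
  shows "dz i F z = fd F z (axis i 1)"
  using Jc.holo_on_line[OF assms(1), of z 0 "axis i 1"] assms(2)
  by (simp add: dz_def cs_J DERIV_imp_deriv)

lemma fd_eq_dot_grad:
  assumes "holo_on J J1 F U" "z \<in> U"
  shows "fd F z v = dot v (grad F z)"
  using complex_linear_expand[OF has_derivative_linear[OF holo_onE(1)[OF assms]] holo_onE(2)[OF assms], of v]
  by (simp add: dot_def grad_def dz_eq[OF assms])

locale holo_fun =
  fixes F :: "complex^'n \<Rightarrow> complex" and U
  assumes openU: "open U" and holo_F: "holo_on J J1 F U"
begin

abbreviation "P \<equiv> grad F"

lemma P_holo: "holo_on J J P U"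
  unfolding holo_on_vec_iff
proof
  fix i
  have "holo_on J J1 (\<lambda>z. fd F z (axis i 1)) U" by (rule Jc.holo_on_fd[OF openU holo_F])
  then show "holo_on J J1 (\<lambda>z. P z $ i) U"
    by (rule holo_on_cong[OF openU, rotated]) (simp add: grad_def dz_eq[OF holo_F])
qed

lemma P_smooth: "smooth_on P U"
  by (rule Jc.holo_on_vec_imp_smooth[OF openU P_holo])

lemmas P' = holo_onE(1)[OF P_holo] and P'_J = holo_onE(2)[OF P_holo]

lemma fd_dot_P: "z \<in> U \<Longrightarrow> dot u (fd P z v) = fd (\<lambda>z. fd F z u) z v"
proof -
  assume z: "z \<in> U"
  have "((\<lambda>z. dot u (P z)) has_derivative (\<lambda>v. dot u (fd P z v))) (at z)"
    unfolding dot_def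
    by (intro has_derivative_sum has_derivative_mult_right P'[OF z, unfolded has_derivative_vec_iff, rule_format])
  from has_derivative_transform_within_open[OF this openU z fd_eq_dot_grad[OF holo_F, symmetric]]
  show ?thesis by (simp add: fd_eq)
qed

text \<open>Symmetry of the complex Hessian; equivalently, the sum of dz^i wedge dw_i vanishes along
  \<open>dF F\<close>.\<close>

lemma P'_sym: "z \<in> U \<Longrightarrow> dot u (fd P z v) = dot v (fd P z u)"
  by (simp add: fd_dot_P fd_fd_commute[OF openU Jc.holo_on_imp_smooth[OF openU holo_F], of z v u])

lemma dzdz: "z \<in> U \<Longrightarrow> dz i (dz j F) z = fd P z (axis i 1) $ j"
proof -
  assume z: "z \<in> U"
  have "holo_on J J1 (\<lambda>z. P z $ j) U" using P_holo by (simp add: holo_on_vec_iff)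
  from dz_eq[OF this z] show ?thesis
    unfolding fd_vec_nth[OF P'[OF z]] by (simp add: grad_def)
qed

text \<open>The real functions x^i and y_i along \<open>dF F\<close>, packed as real and imaginary
  parts so that \<open>\<psi>\<close> maps into the same type, as \<open>affine_chart\<close>
  demands. The packing is only real linear.\<close>

definition \<psi> :: "complex^'n \<Rightarrow> complex^'n" where "\<psi> z = (\<chi> i. Complex (Re (z $ i)) (Re (P z $ i)))"

lemma \<psi>_smooth: "smooth_on \<psi> U"
proof (rule smooth_on_vec[OF openU])
  fix i
  have "smooth_on (\<lambda>z. complex_of_real (Re (z $ i)) + \<i> * complex_of_real (Re (P z $ i))) U"
    by (intro smooth_on_add[OF openU] smooth_on_mult[OF openU] smooth_on_const
        smooth_on_linear_compose[OF openU bounded_linear_of_real]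
        smooth_on_linear_compose[OF openU bounded_linear_Re]
        smooth_on_linear_compose[OF openU bounded_linear_vec_nth P_smooth]
        smooth_on_linear[OF openU] bounded_linear_vec_nth)
  then show "smooth_on (\<lambda>z. \<psi> z $ i) U" by (simp add: \<psi>_def Complex_eq)
qed

lemma \<psi>': "z \<in> U \<Longrightarrow> fd \<psi> z v = (\<chi> i. Complex (Re (v $ i)) (Re (fd P z v $ i)))"
proof -
  assume z: "z \<in> U"
  have "(\<psi> has_derivative (\<lambda>v. \<chi> i. Complex (Re (v $ i)) (Re (fd P z v $ i)))) (at z)"
    unfolding has_derivative_vec_iff \<psi>_def
    by (auto simp: Complex_eq intro!: derivative_eq_intros bounded_linear.has_derivative[OF bounded_linear_vec_nth]
      P'[OF z, unfolded has_derivative_vec_iff, rule_format])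
  then show ?thesis by (simp add: fd_eq)
qed

abbreviation "d2P z u v \<equiv> fd (\<lambda>y. fd P y v) z u"

lemma \<psi>'': "z \<in> U \<Longrightarrow> fd (\<lambda>y. fd \<psi> y v) z u = (\<chi> i. Complex 0 (Re (d2P z u v $ i)))"
proof -
  assume z: "z \<in> U"
  have P2: "((\<lambda>y. fd P y v) has_derivative (\<lambda>u. d2P z u v)) (at z)"
    by (rule smooth_on_has_derivative[OF smooth_on_fd[OF P_smooth] z])
  have "((\<lambda>y. \<chi> i. Complex (Re (v $ i)) (Re (fd P y v $ i))) has_derivative (\<lambda>u. \<chi> i. Complex 0 (Re (d2P z u v $ i)))) (at z)"
    unfolding has_derivative_vec_iff
    by (auto simp: Complex_eq intro!: derivative_eq_intros P2[unfolded has_derivative_vec_iff, rule_format])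
  from has_derivative_transform_within_open[OF this openU z \<psi>'[symmetric]]
  show ?thesis by (simp add: fd_eq)
qed

definition cvec :: "real^'n \<Rightarrow> complex^'n" where "cvec a = (\<chi> i. complex_of_real (a $ i))"

definition Hess :: "complex^'n \<Rightarrow> real^'n^'n" where "Hess z = (\<chi> i j. Im (dz i (dz j F) z))"

lemma Hess_mult: "z \<in> U \<Longrightarrow> (Hess z *v a) $ i = Im (fd P z (cvec a) $ i)"
proof -
  assume z: "z \<in> U"
  have "(Hess z *v a) $ i = Im (dot (cvec a) (fd P z (axis i 1)))"
    by (simp add: Hess_def matrix_vector_mult_def dot_def cvec_def dzdz[OF z] Im_sum mult.commute)
  also have "\<dots> = Im (dot (axis i 1) (fd P z (cvec a)))" by (simp only: P'_sym[OF z])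
  also have "dot (axis i 1) (fd P z (cvec a)) = fd P z (cvec a) $ i"
    by (simp add: dot_def axis_def if_distrib[of "\<lambda>x. x * _"] cong: if_cong)
  finally show ?thesis .
qed

lemma P'_mult: "z \<in> U \<Longrightarrow> fd P z (c *s v) = c *s fd P z v"
  by (rule complex_linear_smult[OF has_derivative_linear[OF P'] P'_J])

lemma \<psi>'_imag: "z \<in> U \<Longrightarrow> fd \<psi> z (\<i> *s cvec a) = (\<chi> i. Complex 0 (- (Hess z *v a) $ i))"
  by (simp add: \<psi>' P'_mult Hess_mult vec_eq_iff complex_eq_iff) (simp add: cvec_def)

text \<open>The kernel of \<open>fd \<psi> z\<close> consists of purely imaginary vectors, since the
  x component of the image is the real part of \<open>v\<close>; on imaginary vectors
  \<open>fd \<psi> z\<close> is minus the imaginary Hessian.\<close>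

lemma invertible_Hess_iff: 
  assumes z: "z \<in> U"
  shows "invertible (Hess z) \<longleftrightarrow> (\<forall>v. fd \<psi> z v = 0 \<longrightarrow> v = 0)"
proof -
  have "(\<forall>v. fd \<psi> z v = 0 \<longrightarrow> v = 0) \<longleftrightarrow> (\<forall>a. Hess z *v a = 0 \<longrightarrow> a = 0)"
  proof safe
    fix a assume *: "\<forall>v. fd \<psi> z v = 0 \<longrightarrow> v = 0" and a: "Hess z *v a = 0"
    have "fd \<psi> z (\<i> *s cvec a) = 0" by (simp add: \<psi>'_imag[OF z] a vec_eq_iff complex_eq_iff)
    with * have "\<i> *s cvec a = 0" by blast
    then show "a = 0" by (simp add: cvec_def vec_eq_iff)
  next
    fix v assume *: "\<forall>a. Hess z *v a = 0 \<longrightarrow> a = 0" and v: "fd \<psi> z v = 0"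
    define a where "a = (\<chi> i. Im (v $ i))"
    have "Re (v $ i) = 0" for i using v by (simp add: \<psi>'[OF z] vec_eq_iff complex_eq_iff)
    then have va: "v = \<i> *s cvec a" by (simp add: a_def cvec_def vec_eq_iff complex_eq_iff)
    have "Hess z *v a = 0" using v unfolding va by (simp add: \<psi>'_imag[OF z] vec_eq_iff complex_eq_iff)
    with * have "a = 0" by blast
    then show "v = 0" unfolding va by (simp add: cvec_def vec_eq_iff)
  qed
  then show ?thesis
    unfolding invertible_left_inverse by (simp add: matrix_left_invertible_ker)
qed

lemma nondegenerate_fun_iff: "nondegenerate_fun F U \<longleftrightarrow> (\<forall>z\<in>U. \<forall>v. fd \<psi> z v = 0 \<longrightarrow> v = 0)"
  unfolding nondegenerate_fun_def using invertible_Hess_iff by (simp add: Hess_def)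

end

section \<open>The structure induced by a nondegenerate holomorphic function\<close>

text \<open>\<open>chart_inv (U, id)\<close> is the identity on \<open>U\<close>, with unspecified
  values outside; as \<open>U\<close> is open, the derivative does not see those.\<close>

lemma pd_std:
  assumes "open U" "p \<in> U"
  shows "pd (U, id) f p = fd f p"
proof -
  have "fd (f \<circ> chart_inv (U, id)) p = fd f p"
    by (rule fd_cong[OF assms]) (simp add: chart_inv_def inv_into_f_f[of id, simplified])
  then show ?thesis by (simp add: pd_def fun_eq_iff)
qed

lemma fd_pd_std:
  assumes "open U" "p \<in> U"
  shows "fd (\<lambda>q. pd (U, id) f q v) p = fd (\<lambda>q. fd f q v) p"
  by (rule fd_cong[OF assms]) (simp add: pd_std[OF assms(1)])

lemma smooth_in_chart_std:
  assumes "open U" "S \<subseteq> U" "open S"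
  shows "smooth_in_chart (U, id) f S \<longleftrightarrow> smooth_on f S"
proof -
  have "f (chart_inv (U, id) x) = f x" if "x \<in> S" for x
    using that assms(2) by (auto simp: chart_inv_def inv_into_f_f[of id, simplified])
  moreover have "U \<inter> S = S" using assms(2) by blast
  ultimately show ?thesis
    using smooth_on_cong[OF assms(3), of "f \<circ> chart_inv (U, id)" f] smooth_on_cong[OF assms(3), of f "f \<circ> chart_inv (U, id)"]
    by (auto simp: smooth_in_chart_def)
qed

lemma std_connection_iff:
  fixes U :: "(complex^'n) set"
  assumes "open U"
  shows "connection (std_atlas U) \<Gamma> \<longleftrightarrow>
    (\<forall>z\<in>U. bilinear (\<Gamma> (U, id) z)) \<and> (\<forall>u v. smooth_on (\<lambda>z. \<Gamma> (U, id) z u v) U)"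
proof -
  have "conn_related (U, id) (U, id) id (\<Gamma> (U, id)) (\<Gamma> (U, id)) p" if p: "p \<in> U" for p
  proof -
    have [simp]: "fd (id :: complex^'n \<Rightarrow> complex^'n) q = (\<lambda>v. v)" for q
      by (rule fd_eq) (simp add: id_def)
    show ?thesis
      unfolding conn_related_def snd_conv comp_id pd_std[OF assms p] fd_pd_std[OF assms p]
      by (simp add: frechet_derivative_const)
  qed
  then show ?thesis by (auto simp: connection_def std_atlas_def smooth_in_chart_std[OF assms order_refl assms])
qed

lemma std_flat_iff:
  assumes "open U"
  shows "flat (std_atlas U) \<Gamma> \<longleftrightarrow> (\<forall>z\<in>U. \<forall>u v w.
    fd (\<lambda>y. \<Gamma> (U, id) y v w) z u + \<Gamma> (U, id) z u (\<Gamma> (U, id) z v w) =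
    fd (\<lambda>y. \<Gamma> (U, id) y u w) z v + \<Gamma> (U, id) z v (\<Gamma> (U, id) z u w))"
proof -
  have 1: "cov_deriv \<Gamma> (U, id) (\<lambda>_. w) q v = \<Gamma> (U, id) q v w" if "q \<in> U" for q v w
    by (simp add: cov_deriv_def pd_std[OF assms that] frechet_derivative_const)
  have "cov_deriv \<Gamma> (U, id) (\<lambda>q. cov_deriv \<Gamma> (U, id) (\<lambda>_. w) q v) p u =
      fd (\<lambda>y. \<Gamma> (U, id) y v w) p u + \<Gamma> (U, id) p u (\<Gamma> (U, id) p v w)" if p: "p \<in> U" for p u v w
    unfolding cov_deriv_def[of _ _ "\<lambda>q. cov_deriv \<Gamma> (U, id) (\<lambda>_. w) q v"] pd_std[OF assms p] 1[OF p]
    using fd_cong[OF assms p 1] by simp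
  then show ?thesis by (auto simp: flat_def std_atlas_def)
qed

context holo_fun begin

lemma dF_eq: "dF F z = (z, P z)"
  by (simp add: dF_def grad_def)

lemma dF_has_derivative: "z \<in> U \<Longrightarrow> (dF F has_derivative (\<lambda>v. (v, fd P z v))) (at z)"
  unfolding dF_eq by (intro has_derivative_Pair has_derivative_ident P')

lemma dF_immersion: "holo_immersion_on (dF F) U"
  unfolding holo_immersion_on_def
proof (intro conjI ballI)
  show "holo_on J (map_prod J J) (dF F) U"
    by (rule holo_onI[OF dF_has_derivative]) (simp_all add: P'_J)
  show "inj (frechet_derivative (dF F) (at z))" if "z \<in> U" for z
    unfolding fd_eq[OF dF_has_derivative[OF that]] by (auto intro: injI)
qed

lemma affine_xcoord_iff: "affine_function (std_atlas U) \<Gamma> (xcoord i \<circ> dF F) \<longleftrightarrow>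
    (\<forall>z\<in>U. \<forall>u v. Re (\<Gamma> (U, id) z u v $ i) = 0)"
proof -
  have x: "xcoord i \<circ> dF F = (\<lambda>z. Re (z $ i))" by (simp add: fun_eq_iff xcoord_def dF_def)
  have d: "((\<lambda>z. Re (z $ i)) has_derivative (\<lambda>v. Re (v $ i))) (at z)" for z :: "complex^'n"
    by (intro bounded_linear_imp_has_derivative bounded_linear_compose[OF bounded_linear_Re bounded_linear_vec_nth])
  have "smooth_on (\<lambda>z. Re (z $ i)) U"
    by (intro smooth_on_linear openU bounded_linear_compose[OF bounded_linear_Re bounded_linear_vec_nth])
  then show ?thesis
    by (simp add: affine_function_def std_atlas_def x smooth_in_chart_std[OF openU order_refl openU]
      fd_pd_std[OF openU] pd_std[OF openU] fd_eq[OF d] frechet_derivative_const)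
qed

lemma affine_ycoord_iff: "affine_function (std_atlas U) \<Gamma> (ycoord i \<circ> dF F) \<longleftrightarrow>
    (\<forall>z\<in>U. \<forall>u v. Re (fd P z (\<Gamma> (U, id) z u v) $ i) = Re (d2P z u v $ i))"
proof -
  have y: "ycoord i \<circ> dF F = (\<lambda>z. Re (P z $ i))" by (simp add: fun_eq_iff ycoord_def dF_eq)
  have d: "fd (\<lambda>z. Re (P z $ i)) z v = Re (fd P z v $ i)" if "z \<in> U" for z v
  proof -
    have "((\<lambda>z. Re (P z $ i)) has_derivative (\<lambda>v. Re (fd P z v $ i))) (at z)"
      by (intro bounded_linear.has_derivative[OF bounded_linear_Re] bounded_linear.has_derivative[OF bounded_linear_vec_nth] P' that)
    then show ?thesis by (simp add: fd_eq)
  qed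
  have d2: "fd (\<lambda>q. fd (\<lambda>z. Re (P z $ i)) q v) z u = Re (d2P z u v $ i)" if z: "z \<in> U" for z u v
  proof -
    have "((\<lambda>z. Re (fd P z v $ i)) has_derivative (\<lambda>u. Re (d2P z u v $ i))) (at z)"
      by (intro bounded_linear.has_derivative[OF bounded_linear_Re] bounded_linear.has_derivative[OF bounded_linear_vec_nth]
        smooth_on_has_derivative[OF smooth_on_fd[OF P_smooth] z])
    from has_derivative_transform_within_open[OF this openU z d[symmetric]]
    show ?thesis by (simp add: fd_eq)
  qed
  have "smooth_on (\<lambda>z. Re (P z $ i)) U"
    by (intro smooth_on_linear_compose[OF openU bounded_linear_Re] smooth_on_linear_compose[OF openU bounded_linear_vec_nth] P_smooth)
  then show ?thesis
    by (auto simp: affine_function_def std_atlas_def y smooth_in_chart_std[OF openU order_refl openU]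
      fd_pd_std[OF openU] pd_std[OF openU] d d2)
qed

text \<open>Affinity of all x^i and y_i is one equation for \<open>\<psi>\<close>. It determines
  \<open>\<Gamma>\<close> wherever the derivative of \<open>\<psi>\<close> is injective, which gives
  uniqueness of the induced connection.\<close>

lemma induced_connection_iff: "induced_connection (dF F) U \<Gamma> \<longleftrightarrow>
   flat_torsionfree_connection (std_atlas U) \<Gamma> \<and>
   (\<forall>z\<in>U. \<forall>u v. fd \<psi> z (\<Gamma> (U, id) z u v) = fd (\<lambda>y. fd \<psi> y v) z u)"
  unfolding induced_connection_def affine_xcoord_iff affine_ycoord_iff
  by (auto simp: \<psi>' \<psi>'' vec_eq_iff complex_eq_iff)

end

text \<open>Twice the sum of dx^i wedge dy_i under the packing of (x, y) used in
  \<open>\<psi>\<close>.\<close>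

definition sympl :: "complex^'n \<Rightarrow> complex^'n \<Rightarrow> real" where
  "sympl a b = 2 * (\<Sum>i\<in>UNIV. Re (a $ i) * Im (b $ i) - Re (b $ i) * Im (a $ i))"

lemma sympl_self: "sympl a a = 0" by (simp add: sympl_def)

lemma bounded_bilinear_sympl: "bounded_bilinear sympl"
proof -
  have "bilinear sympl"
    unfolding bilinear_def sympl_def
    by (auto intro!: linearI simp: sum_distrib_left sum.distrib[symmetric] algebra_simps intro!: sum.cong)
  then show ?thesis by (simp add: bilinear_conv_bounded_bilinear)
qed

lemma sympl_nondeg:
  assumes "\<And>b. sympl a b = 0" shows "a = 0"
proof -
  have "a $ i = 0" for i
    using assms[of "axis i 1"] assms[of "axis i \<i>"]
    by (simp add: sympl_def axis_def if_distrib[of Re] if_distrib[of Im] if_distrib[of "\<lambda>x. _ * x"]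
       if_distrib[of "\<lambda>x. x * _"] sum_subtractf sum_negf complex_eq_iff cong: if_cong)
  then show ?thesis by (simp add: vec_eq_iff)
qed

locale nondeg_holo_fun = holo_fun F U for F :: "complex^'n \<Rightarrow> complex" and U +
  assumes nondeg: "nondegenerate_fun F U"
begin

sublocale affine_chart U \<psi>
  using openU \<psi>_smooth nondeg unfolding nondegenerate_fun_iff by unfold_locales auto

text \<open>If \<open>v\<close> and \<open>fd P z v\<close> are both real, then \<i> times the pair
  has vanishing real parts, so \<open>\<i> *s v\<close> lies in the kernel of
  \<open>fd \<psi> z\<close>.\<close>

lemma dF_totally_complex: "totally_complex_on (dF F) U"
  unfolding totally_complex_on_def
proof
  fix z assume z: "z \<in> U"
  have "v = 0" if "(v, fd P z v) \<in> real_cotangent" for v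
  proof -
    have im: "Im (v $ i) = 0" "Im (fd P z v $ i) = 0" for i
      using that by (auto simp: real_cotangent_def complex_is_Real_iff)
    have "fd \<psi> z (\<i> *s v) = 0"
      using im by (simp add: \<psi>'[OF z] P'_mult[OF z] vec_eq_iff complex_eq_iff)
    then have "\<i> *s v = 0" by (rule inj_\<psi>[OF z])
    then show ?thesis by (simp add: vec_eq_iff)
  qed
  moreover have "fd P z 0 = 0" using linear_0[OF has_derivative_linear[OF P'[OF z]]] .
  ultimately show "real_cotangent \<inter> range (frechet_derivative (dF F) (at z)) = {0}"
    unfolding fd_eq[OF dF_has_derivative[OF z]]
    by (auto simp: zero_prod_def) (auto simp: real_cotangent_def image_iff)
qed

lemma induced_connection_unique:
  assumes "induced_connection (dF F) U \<Gamma>" "induced_connection (dF F) U \<Gamma>'" "z \<in> U"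
  shows "\<Gamma> (U, id) z = \<Gamma>' (U, id) z"
proof (intro ext)
  fix u v
  show "\<Gamma> (U, id) z u v = \<Gamma>' (U, id) z u v"
    by (rule inj_d\<psi>[OF assms(3)]) (use assms in \<open>simp add: induced_connection_iff\<close>)
qed

lemma Hess_det: "z \<in> U \<Longrightarrow> det (Hess z) \<noteq> 0"
  using invertible_Hess_iff inj_\<psi> invertible_det_nz by blast

text \<open>The second derivative of \<open>\<psi>\<close> has no x component, so its preimage under
  \<open>fd \<psi> z\<close> is purely imaginary and solves a real linear system with matrix
  \<open>Hess z\<close>. Cramer's rule makes the smooth dependence on \<open>z\<close>
  visible.\<close>

definition christoffel :: "complex^'n \<Rightarrow> complex^'n \<Rightarrow> complex^'n \<Rightarrow> complex^'n" where
  "christoffel z u v = \<i> *s cvec (\<chi> k. det (\<chi> i j. if j = k then - Re (d2P z u v $ i) else Hess z $ i $ j) / det (Hess z))"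

lemma christoffel: "z \<in> U \<Longrightarrow> fd \<psi> z (christoffel z u v) = fd (\<lambda>y. fd \<psi> y v) z u"
proof -
  assume z: "z \<in> U"
  define s where "s = (\<chi> i. - Re (d2P z u v $ i))"
  define \<eta> where "\<eta> = (\<chi> k. det (\<chi> i j. if j = k then s $ i else Hess z $ i $ j) / det (Hess z))"
  have "christoffel z u v = \<i> *s cvec \<eta>" by (simp add: christoffel_def \<eta>_def s_def cong: if_cong)
  moreover have "Hess z *v \<eta> = s"
    using cramer[OF Hess_det[OF z], of \<eta> s] by (simp add: \<eta>_def)
  ultimately have "fd \<psi> z (christoffel z u v) = (\<chi> i. Complex 0 (- s $ i))"
    using \<psi>'_imag[OF z, of \<eta>] by simp
  then show ?thesis by (simp add: \<psi>''[OF z] s_def)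
qed

lemma smooth_det:
  fixes A :: "complex^'n \<Rightarrow> real^'n^'n"
  assumes "\<And>i j. smooth_on (\<lambda>z. A z $ i $ j) U"
  shows "smooth_on (\<lambda>z. det (A z)) U"
  unfolding det_def by (intro smooth_on_sum smooth_on_mult smooth_on_prod smooth_on_const openU assms)

lemma smooth_christoffel: "smooth_on (\<lambda>z. christoffel z u v) U"
proof (rule smooth_on_vec[OF openU])
  fix k
  have "smooth_on (\<lambda>z. Im (fd P z (axis i 1) $ j)) U" for i j
    by (intro smooth_on_linear_compose[OF openU bounded_linear_Im] smooth_on_linear_compose[OF openU bounded_linear_vec_nth]
      smooth_on_fd P_smooth)
  then have H: "smooth_on (\<lambda>z. Hess z $ i $ j) U" for i j
    by (rule smooth_on_cong[OF openU, rotated]) (simp add: Hess_def dzdz)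
  have R: "smooth_on (\<lambda>z. - Re (d2P z u v $ i)) U" for i
    by (intro smooth_on_linear_compose[OF openU bounded_linear_minus[OF bounded_linear_Re]] smooth_on_linear_compose[OF openU bounded_linear_vec_nth]
      smooth_on_fd P_smooth)
  have "smooth_on (\<lambda>z. (\<chi> i j. if j = k then - Re (d2P z u v $ i) else Hess z $ i $ j) $ i $ j) U" for i j
    using H[of i j] R[of i] by (cases "j = k") simp_all
  from smooth_det[OF this] have "smooth_on (\<lambda>z. det (\<chi> i j. if j = k then - Re (d2P z u v $ i) else Hess z $ i $ j) / det (Hess z)) U"
    by (rule smooth_on_divide[OF openU _ smooth_det[OF H] Hess_det])
  then have "smooth_on (\<lambda>z. \<i> * complex_of_real (det (\<chi> i j. if j = k then - Re (d2P z u v $ i) else Hess z $ i $ j) / det (Hess z))) U"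
    by (intro smooth_on_mult[OF openU] smooth_on_const smooth_on_linear_compose[OF openU bounded_linear_of_real])
  then show "smooth_on (\<lambda>z. christoffel z u v $ k) U"
    by (simp add: christoffel_def cvec_def)
qed

lemma induced_connection_exists: "induced_connection (dF F) U (\<lambda>\<kappa>. christoffel)"
proof -
  have c: "fd \<psi> z (christoffel z u v) = d2 z u v" if "z \<in> U" for z u v
    using christoffel[OF that] by (simp add: d2_def)
  have "connection (std_atlas U) (\<lambda>\<kappa>. christoffel)"
    using G_bilinear[of christoffel, OF c] smooth_christoffel by (simp add: std_connection_iff[OF openU])
  moreover have "flat (std_atlas U) (\<lambda>\<kappa>. christoffel)"
    unfolding std_flat_iff[OF openU] using G_flat[of christoffel, OF c _ smooth_christoffel] by blast
  moreover have "torsionfree (std_atlas U) (\<lambda>\<kappa>. christoffel)"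
    using G_sym[of christoffel, OF c] by (simp add: torsionfree_def std_atlas_def)
  ultimately show ?thesis
    using christoffel by (simp add: induced_connection_iff flat_torsionfree_connection_def)
qed

lemma induced_form_eq:
  assumes "p \<in> U"
  shows "induced_form (dF F) (U, id) p u v = sympl (fd \<psi> p u) (fd \<psi> p v)"
  by (simp add: induced_form_def sympl_def pd_std[OF openU assms] fd_eq[OF dF_has_derivative[OF assms]]
     xcoord_def ycoord_def \<psi>'[OF assms])

text \<open>\<open>J\<close> turns real parts into minus imaginary parts, so the two sides are the
  same sum over imaginary and over real parts. Their difference is, up to a factor, the real part of
  the sum of dz^i wedge dw_i, which vanishes by symmetry of the Hessian.\<close>

lemma J_invariant_form: 
  assumes "z \<in> U"
  shows "sympl (fd \<psi> z (J u)) (fd \<psi> z (J v)) = sympl (fd \<psi> z u) (fd \<psi> z v)"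
proof -
  define a b where "a = fd P z u" and "b = fd P z v"
  have "Re (\<Sum>i\<in>UNIV. u $ i * b $ i) = Re (\<Sum>i\<in>UNIV. v $ i * a $ i)"
    using P'_sym[OF assms, of u v] by (simp add: dot_def a_def b_def)
  then have *: "(\<Sum>i\<in>UNIV. Re (u $ i) * Re (b $ i) - Im (u $ i) * Im (b $ i)) =
      (\<Sum>i\<in>UNIV. Re (v $ i) * Re (a $ i) - Im (v $ i) * Im (a $ i))"
    by (simp add: Re_sum)
  have "fd P z (J u) = J a" "fd P z (J v) = J b" by (simp_all add: P'_J[OF assms] a_def b_def)
  then have "sympl (fd \<psi> z (J u)) (fd \<psi> z (J v)) = 2 * (\<Sum>i\<in>UNIV. Im (u $ i) * Im (b $ i) - Im (v $ i) * Im (a $ i))"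
    by (simp add: sympl_def \<psi>'[OF assms] J_def)
  also have "(\<Sum>i\<in>UNIV. Im (u $ i) * Im (b $ i) - Im (v $ i) * Im (a $ i)) =
      (\<Sum>i\<in>UNIV. Re (u $ i) * Re (b $ i) - Re (v $ i) * Re (a $ i))"
    using * by (simp add: sum_subtractf)
  finally show ?thesis by (simp add: sympl_def \<psi>'[OF assms] a_def b_def)
qed

lemma std_symplectic: "symplectic_form (std_atlas U) (induced_form (dF F))"
proof -
  let ?w = "\<lambda>z u v. sympl (fd \<psi> z u) (fd \<psi> z v)"
  note w = induced_form_eq
  note facts = \<omega>_smooth[OF bounded_bilinear_sympl sympl_self sympl_nondeg]
    \<omega>_closed[OF bounded_bilinear_sympl sympl_self sympl_nondeg]
    \<omega>_nondeg[OF bounded_bilinear_sympl sympl_self sympl_nondeg]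
    \<omega>_bilinear[OF bounded_bilinear_sympl sympl_self sympl_nondeg]
  have eq: "induced_form (dF F) (U, id) z = ?w z" if "z \<in> U" for z
    using w[OF that] by (simp add: fun_eq_iff)
  have sm: "smooth_on (\<lambda>p. induced_form (dF F) (U, id) p u v) U" for u v
    by (rule smooth_on_cong[OF openU _ facts(1)]) (simp add: w)
  have fdw: "fd (\<lambda>p. induced_form (dF F) (U, id) p u v) z = fd (\<lambda>z. ?w z u v) z" if "z \<in> U" for z u v
    by (rule fd_cong[OF openU that w])
  have "form_related (U, id) (U, id) id (induced_form (dF F) (U, id)) (induced_form (dF F) (U, id)) p" if "p \<in> U" for p
  proof -
    have [simp]: "fd (id :: complex^'n \<Rightarrow> complex^'n) q = (\<lambda>v. v)" for q
      by (rule fd_eq) (simp add: id_def)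
    show ?thesis by (simp add: form_related_def pd_std[OF openU that] comp_id del: id_apply) simp
  qed
  then show ?thesis
    unfolding symplectic_form_def std_atlas_def
    using sm facts by (auto simp: smooth_in_chart_std[OF openU order_refl openU] pd_std[OF openU] fdw eq sympl_self)
qed

lemma std_parallel:
  assumes "\<And>z u v. z \<in> U \<Longrightarrow> fd \<psi> z (\<Gamma> (U, id) z u v) = d2 z u v"
  shows "parallel_form (std_atlas U) \<Gamma> (induced_form (dF F))"
proof -
  let ?w = "\<lambda>z u v. sympl (fd \<psi> z u) (fd \<psi> z v)"
  note w = induced_form_eq
  have fdw: "fd (\<lambda>p. induced_form (dF F) (U, id) p u v) z = fd (\<lambda>z. ?w z u v) z" if "z \<in> U" for z u v
    by (rule fd_cong[OF openU that w])
  show ?thesis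
    unfolding parallel_form_def std_atlas_def
    using \<omega>_parallel[OF bounded_bilinear_sympl sympl_self sympl_nondeg _ assms]
    by (simp add: pd_std[OF openU] fdw w)
qed

lemma std_J_invariant: "J_invariant (std_atlas U) (induced_form (dF F))"
  by (simp add: J_invariant_def std_atlas_def induced_form_eq J_invariant_form)

end

section \<open>Conic holomorphic functions\<close>

lemma std_complex_manifold:
  fixes U :: "(complex^'n) set"
  assumes "open U"
  shows "complex_manifold (top_of_set U) (std_atlas U)"
proof -
  have "second_countable (euclidean :: (complex^'n) topology)"
  proof -
    obtain B :: "(complex^'n) set set" where B: "countable B" "\<And>C. C \<in> B \<Longrightarrow> open C"
        "\<And>S. open S \<Longrightarrow> \<exists>U. U \<subseteq> B \<and> S = \<Union>U"
      using univ_second_countable by blast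
    have "\<exists>C\<in>B. x \<in> C \<and> C \<subseteq> S" if "open S" "x \<in> S" for S x
      using B(3)[OF that(1)] that(2) by blast
    then show ?thesis unfolding second_countable_def open_openin[symmetric]
      by (intro exI[of _ B] conjI B(1)) (use B(2) in auto)
  qed
  then have "second_countable (top_of_set U)" by (rule second_countable_subtopology)
  moreover have "Hausdorff_space (top_of_set U)"
    by (intro Hausdorff_space_subtopology Hausdorff_space_euclidean)
  moreover have "holo_on J J (snd (U, id) \<circ> chart_inv (U, id)) U"
    by (rule holo_on_cong[OF assms, where f="\<lambda>x. x"])
      (auto simp: chart_inv_def inv_into_f_f[of id, simplified] intro!: holo_onI)
  ultimately show ?thesis
    using assms by (simp add: complex_manifold_def std_atlas_def homeomorphic_map_id subtopology_subtopology)
qed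

lemma dot_eqI: "(\<And>v. dot v a = dot v b) \<Longrightarrow> a = b"
proof -
  assume *: "\<And>v. dot v a = dot v b"
  have "a $ i = b $ i" for i
    using *[of "axis i 1"] by (simp add: dot_def axis_def if_distrib[of "\<lambda>x. x * _"] cong: if_cong)
  then show ?thesis by (simp add: vec_eq_iff)
qed

lemma smult_has_derivative:
  "((\<lambda>(l, x). l *s x) has_derivative (\<lambda>(h, v). h *s x + l *s v)) (at (l, x :: complex^'n))"
  unfolding has_derivative_vec_iff split_beta
  by (auto intro!: derivative_eq_intros bounded_linear.has_derivative[OF bounded_linear_vec_nth])

lemma continuous_on_smult: "continuous_on S (\<lambda>z :: complex \<times> (complex^'n). fst z *s snd z)"
  unfolding vector_scalar_mult_def by (intro continuous_intros)

locale conic_holo_fun = nondeg_holo_fun F U for F :: "complex^'n \<Rightarrow> complex" and U +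
  assumes conic: "conic_fun F U"
begin

lemma euler: "z \<in> U \<Longrightarrow> dot z (P z) = 2 * F z"
proof -
  assume z: "z \<in> U"
  have "((\<lambda>c. F (0 + Jc.cs c z)) has_field_derivative fd F (0 + Jc.cs 1 z) z) (at 1)"
    by (rule Jc.holo_on_line[OF holo_F]) (use z in \<open>simp add: cs_J\<close>)
  then have "((\<lambda>c. F (c *s z)) has_field_derivative fd F z z) (at 1)" by (simp add: cs_J)
  moreover have "\<forall>\<^sub>F l in nhds 1. F (l *s z) = l\<^sup>2 * F z" using conic z by (simp add: conic_fun_def)
  ultimately have "((\<lambda>l. l\<^sup>2 * F z) has_field_derivative fd F z z) (at 1)"
    using DERIV_cong_ev[OF refl _ refl, of "\<lambda>c. F (c *s z)" "\<lambda>l. l\<^sup>2 * F z" 1 "fd F z z"] by simp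
  moreover have "((\<lambda>l. l\<^sup>2 * F z) has_field_derivative 2 * F z) (at 1)"
    by (auto intro!: derivative_eq_intros)
  ultimately show ?thesis using DERIV_unique fd_eq_dot_grad[OF holo_F z] by metis
qed

text \<open>Euler's relation is differentiated and the arguments are exchanged by
  \<open>P'_sym\<close>; the result is Euler's relation for \<open>P\<close>, which is homogeneous
  of degree one.\<close>

lemma P'_radial: "z \<in> U \<Longrightarrow> fd P z z = P z"
proof -
  assume z: "z \<in> U"
  have "((\<lambda>z. dot z (P z)) has_derivative (\<lambda>v. dot v (P z) + dot z (fd P z v))) (at z)"
    unfolding dot_def sum.distrib[symmetric]
    by (intro has_derivative_sum) (auto intro!: derivative_eq_intros bounded_linear.has_derivative[OF bounded_linear_vec_nth]
      P'[OF z, unfolded has_derivative_vec_iff, rule_format] simp: add.commute mult.commute)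
  from has_derivative_transform_within_open[OF this openU z euler]
  have "((\<lambda>z. 2 * F z) has_derivative (\<lambda>v. dot v (P z) + dot z (fd P z v))) (at z)" .
  moreover have "((\<lambda>z. 2 * F z) has_derivative (\<lambda>v. 2 * dot v (P z))) (at z)"
    using holo_onE(1)[OF holo_F z] by (auto simp: fd_eq_dot_grad[OF holo_F z, symmetric] intro!: derivative_eq_intros)
  ultimately have *: "(\<lambda>v. dot v (P z) + dot z (fd P z v)) = (\<lambda>v. 2 * dot v (P z))" by (rule has_derivative_unique)
  have "dot v (fd P z z) = dot v (P z)" for v
    using fun_cong[OF *, of v] P'_sym[OF z, of v z] by simp
  then show ?thesis by (rule dot_eqI)
qed

text \<open>Differentiating \<open>P'_radial\<close> leaves only the second-order term. The factor
  \<open>c\<close> is there because orbits of the action move in all complex multiples of the radial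
  direction.\<close>

lemma d2P_radial: "z \<in> U \<Longrightarrow> d2P z (c *s z) u = 0"
proof -
  assume z: "z \<in> U"
  have "((\<lambda>y. fd P y y) has_derivative (\<lambda>u. d2P z u z + fd P z u)) (at z)"
    by (rule has_derivative_apply[OF openU z has_derivative_linear[OF P']
        smooth_on_has_derivative[OF smooth_on_fd[OF P_smooth] z] has_derivative_ident])
  from has_derivative_transform_within_open[OF this openU z P'_radial]
  have "(\<lambda>u. d2P z u z + fd P z u) = fd P z" using P'[OF z] by (rule has_derivative_unique)
  then have "d2P z u z = 0" using fun_cong[of "\<lambda>u. d2P z u z + fd P z u" "fd P z" u] by simp
  then have "d2P z z u = 0" using fd_fd_commute[OF openU P_smooth z, of u z] by simp
  moreover have "d2P z (c *s z) u = c *s d2P z z u"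
    by (rule complex_linear_smult[OF has_derivative_linear[OF smooth_on_has_derivative[OF smooth_on_fd[OF P_smooth] z]]
        holo_onE(2)[OF Jc.holo_on_vec_fd[OF openU P_holo] z]])
  ultimately show ?thesis by simp
qed

lemma connection_radial:
  assumes "induced_connection (dF F) U \<Gamma>" "z \<in> U"
  shows "\<Gamma> (U, id) z (c *s z) u = 0"
proof -
  have "fd \<psi> z (\<Gamma> (U, id) z (c *s z) u) = (\<chi> i. Complex 0 (Re (d2P z (c *s z) u $ i)))"
    using assms by (simp add: induced_connection_iff \<psi>'')
  also have "\<dots> = 0" by (simp add: d2P_radial[OF assms(2)] vec_eq_iff complex_eq_iff)
  finally show ?thesis by (rule inj_\<psi>[OF assms(2)])
qed

definition W :: "(complex \<times> (complex^'n)) set" where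
  "W = {lz. fst lz \<noteq> 0 \<and> snd lz \<in> U \<and> fst lz *s snd lz \<in> U}"

lemma open_W: "open W"
proof -
  have "W = ((- {0}) \<times> U) \<inter> (\<lambda>z. fst z *s snd z) -` U" by (auto simp: W_def)
  moreover have "open (((- {0}) \<times> U) \<inter> (\<lambda>z. fst z *s snd z) -` U)"
    by (intro continuous_open_preimage continuous_on_smult openU open_Times) auto
  ultimately show ?thesis by simp
qed

lemma std_local_action: "local_action (top_of_set U) (std_atlas U) W (\<lambda>l z. l *s z)"
proof -
  have prod: "prod_topology (top_of_set (- {0 :: complex})) (top_of_set U) = top_of_set ((- {0}) \<times> U)"
    by (simp add: subtopology_Times[symmetric])
  have sub: "W \<subseteq> (- {0}) \<times> U" by (auto simp: W_def)
  have "openin (prod_topology (top_of_set (- {0})) (top_of_set U)) W"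
    unfolding prod using open_W sub by (auto simp: openin_open)
  moreover have "continuous_map (subtopology (prod_topology (top_of_set (- {0})) (top_of_set U)) W) (top_of_set U) (\<lambda>(l, z). l *s z)"
    unfolding prod using sub by (auto simp: subtopology_subtopology Int_absorb1 split_beta continuous_on_smult W_def)
  moreover have "holo_on (map_prod J1 J) J (\<lambda>(l, x). snd (U, id) (l *s chart_inv (U, id) x))
       {(l, snd (U, id) p) | l p. (l, p) \<in> W \<and> p \<in> fst (U, id) \<and> l *s p \<in> fst (U, id)}"
  proof -
    have "holo_on (map_prod J1 J) J (\<lambda>(l, x). l *s x) W"
    proof (rule holo_onI)
      fix z assume "z \<in> W"
      show "((\<lambda>(l, x). l *s x) has_derivative (\<lambda>(h, v). h *s snd z + fst z *s v)) (at z)"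
        using smult_has_derivative[where l="fst z" and x="snd z"] by simp
      show "(\<lambda>(h, v). h *s snd z + fst z *s v) (map_prod J1 J v) = J ((\<lambda>(h, v). h *s snd z + fst z *s v) v)" for v
        by (simp add: split_beta J_def J1_def vec_eq_iff algebra_simps)
    qed
    then have "holo_on (map_prod J1 J) J (\<lambda>(l, x). snd (U, id) (l *s chart_inv (U, id) x)) W"
      by (rule holo_on_cong[OF open_W, rotated]) (auto simp: W_def chart_inv_def inv_into_f_f[of id, simplified])
    then show ?thesis by (rule holo_on_subset) (auto simp: W_def)
  qed
  moreover have "{1} \<times> U \<subseteq> W" by (auto simp: W_def)
  ultimately show ?thesis
    by (simp add: local_action_def std_atlas_def)
qed

lemma std_conic_action:
  assumes \<Gamma>: "induced_connection (dF F) U \<Gamma>"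
  shows "conic_action (top_of_set U) (std_atlas U) \<Gamma> W (\<lambda>l z. l *s z)"
proof -
  have *: "pd (U, id) (id \<circ> (\<lambda>z. l *s z)) p (Y p) = Re l *\<^sub>R Y (l *s p) + Im l *\<^sub>R J (Y (l *s p))"
    if S: "openin (top_of_set U) S" and sm: "smooth_in_chart (U, id) Y S"
      and par: "\<And>p u. p \<in> S \<Longrightarrow> cov_deriv \<Gamma> (U, id) Y p u = 0"
      and p: "p \<in> S" and l: "l \<in> connected_component_set {m. (m, p) \<in> W \<and> m *s p \<in> S} 1"
    for S p l and Y :: "complex^'n \<Rightarrow> complex^'n"
  proof -
    have S': "open S" "S \<subseteq> U" using S openU by (auto simp: openin_open_eq)
    have pU: "p \<in> U" using p S' by auto
    have Ys: "smooth_on Y S" using sm by (simp add: smooth_in_chart_std[OF openU S'(2,1)])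
    have Yd: "fd Y z u = - \<Gamma> (U, id) z u (Y z)" if "z \<in> S" for z u
      using par[OF that, of u] S' that by (auto simp: cov_deriv_def pd_std[OF openU] add_eq_0_iff subset_iff)
    define Q where "Q = {m. (m, p) \<in> W \<and> m *s p \<in> S}"
    have Q: "Q = (- {0}) \<inter> (\<lambda>m. m *s p) -` S" using pU S' by (auto simp: Q_def W_def)
    have contm: "continuous_on A (\<lambda>m. m *s p)" for A
      unfolding vector_scalar_mult_def by (intro continuous_intros)
    have "open Q" unfolding Q by (intro continuous_open_preimage contm S') auto
    then have opC: "open (connected_component_set Q 1)" by (rule open_connected_component)
    have "((\<lambda>m. Y (m *s p)) has_derivative (\<lambda>h. 0)) (at m)" if m: "m \<in> connected_component_set Q 1" for m
    proof -
      have mO: "m \<in> Q" using m connected_component_subset by blast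
      then have m0: "m \<noteq> 0" "m *s p \<in> S" by (auto simp: Q)
      have "((\<lambda>m. m *s p) has_derivative (\<lambda>h. h *s p)) (at m)"
        unfolding has_derivative_vec_iff by (auto intro!: derivative_eq_intros)
      from has_derivative_compose[OF this smooth_on_has_derivative[OF Ys m0(2)]]
      have "((\<lambda>m. Y (m *s p)) has_derivative (\<lambda>h. fd Y (m *s p) (h *s p))) (at m)" .
      moreover have "fd Y (m *s p) (h *s p) = 0" for h
      proof -
        \<comment> \<open>The velocity \<open>h *s p\<close> of the orbit is rewritten as a multiple
          of the point \<open>m *s p\<close> it has reached, where it is therefore radial.\<close>
        have "\<Gamma> (U, id) (m *s p) ((h / m) *s (m *s p)) (Y (m *s p)) = 0"
          using m0 S' by (intro connection_radial[OF \<Gamma>]) auto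
        then show ?thesis using m0 by (simp add: Yd)
      qed
      ultimately show ?thesis by simp
    qed
    moreover have "l \<in> connected_component_set Q 1" "1 \<in> connected_component_set Q 1"
      using l unfolding Q_def by (auto simp: connected_component_refl_eq dest: connected_component_in)
    ultimately have "Y (l *s p) = Y (1 *s p)"
      using has_derivative_zero_unique_connected[OF opC connected_connected_component, of "\<lambda>m. Y (m *s p)" l 1] by simp
    then have "Y (l *s p) = Y p" by simp
    moreover have "((\<lambda>z. l *s z) has_derivative (\<lambda>z. l *s z)) (at p)"
      unfolding has_derivative_vec_iff by (auto intro!: derivative_eq_intros bounded_linear.has_derivative[OF bounded_linear_vec_nth])
    ultimately show ?thesis
      by (simp add: pd_std[OF openU pU] fd_eq cs_J[symmetric] Jc.cs_def del: id_apply)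
  qed
  show ?thesis
    unfolding conic_action_def
  proof (intro allI impI ballI)
    fix S Y p l \<kappa> \<kappa>'
    assume S: "openin (top_of_set U) S" and par: "parallel_vector_field (std_atlas U) \<Gamma> S Y" and p: "p \<in> S"
      and l: "l \<in> connected_component_set {m. (m, p) \<in> W \<and> m *s p \<in> S} 1"
      and "\<kappa> \<in> std_atlas U" "\<kappa>' \<in> std_atlas U"
    then have \<kappa>: "\<kappa> = (U, id)" "\<kappa>' = (U, id)" by (simp_all add: std_atlas_def)
    have "smooth_in_chart (U, id) (Y (U, id)) S"
      using par by (simp add: parallel_vector_field_def vector_field_def std_atlas_def)
    moreover have "cov_deriv \<Gamma> (U, id) (Y (U, id)) p u = 0" if "p \<in> S" for p u
      using par that openin_imp_subset[OF S] by (auto simp: parallel_vector_field_def std_atlas_def)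
    ultimately show "pd \<kappa> (snd \<kappa>' \<circ> (\<lambda>z. l *s z)) p (Y \<kappa> p) =
        Re l *\<^sub>R Y \<kappa>' (l *s p) + Im l *\<^sub>R J (Y \<kappa>' (l *s p))"
      using *[OF S _ _ p l, of "Y (U, id)"] by (simp add: \<kappa>)
  qed
qed

theorem conic_Kaehler_std:
  assumes \<Gamma>: "induced_connection (dF F) U \<Gamma>"
  shows "conic_Kaehler_manifold (top_of_set U) (std_atlas U) \<Gamma> (induced_form (dF F))"
proof -
  have "parallel_form (std_atlas U) \<Gamma> (induced_form (dF F))"
    by (rule std_parallel) (use \<Gamma> in \<open>simp add: induced_connection_iff d2_def\<close>)
  then show ?thesis
    using std_complex_manifold[OF openU] std_local_action std_conic_action[OF \<Gamma>] std_symplectic std_J_invariant \<Gamma>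
    unfolding conic_Kaehler_manifold_def conic_complex_manifold_def induced_connection_iff by blast
qed

end

section \<open>Indefinite Hermitian forms\<close>

locale herm_form =
  fixes w :: "complex^'n \<Rightarrow> complex^'n \<Rightarrow> real"
  assumes w_bilinear: "bilinear w" and w_self: "w u u = 0"
    and w_nondeg: "(\<And>v. w u v = 0) \<Longrightarrow> u = 0" and w_J: "w (J u) (J v) = w u v"
begin

lemma w_lin1: "linear (\<lambda>u. w u v)" and w_lin2: "linear (w u)"
  using w_bilinear by (auto simp: bilinear_def)

lemmas w_simps = linear_add[OF w_lin1] linear_add[OF w_lin2] linear_cmul[OF w_lin1] linear_cmul[OF w_lin2]
  linear_diff[OF w_lin1] linear_diff[OF w_lin2] linear_0[OF w_lin1] linear_0[OF w_lin2]
  linear_neg[OF w_lin1] linear_neg[OF w_lin2]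

lemma w_swap: "w u v = - w v u"
proof -
  have "0 = w (u + v) (u + v)" by (simp only: w_self)
  also have "\<dots> = w u u + w v u + (w u v + w v v)"
    by (simp only: linear_add[OF w_lin1] linear_add[OF w_lin2] ac_simps)
  finally show ?thesis by (simp add: w_self)
qed

definition g where "g u v = w u (J v)"

lemma g_sym: "g u v = g v u"
  using w_J[of u "J v"] w_swap[of "J u" v] by (simp add: g_def J_J w_simps)

lemma g_J: "g (J u) (J v) = g u v"
  by (simp add: g_def w_J)

lemma g_J2: "g u (J v) = - w u v"
  by (simp add: g_def J_J w_simps)

lemma g_lin2: "linear (g u)"
  unfolding g_def using linear_compose[OF linear_J w_lin2[of u]] by (simp add: o_def)

lemma g_lin1: "linear (\<lambda>u. g u v)"
  unfolding g_def by (rule w_lin1)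

lemmas g_simps = linear_add[OF g_lin1] linear_add[OF g_lin2] linear_cmul[OF g_lin1] linear_cmul[OF g_lin2]
  linear_diff[OF g_lin1] linear_diff[OF g_lin2] linear_0[OF g_lin1] linear_0[OF g_lin2]

definition good :: "(complex^'n) set \<Rightarrow> bool" where
  "good B \<longleftrightarrow> finite B \<and> (\<forall>b\<in>B. \<bar>g b b\<bar> = 2) \<and> (\<forall>b\<in>B. \<forall>c\<in>B. w b c = 0 \<and> (b \<noteq> c \<longrightarrow> g b c = 0))"

lemma inj_J: "inj J"
  by (metis J_J injI minus_minus)

lemma good_orth:
  assumes "good B" "s \<in> B \<union> J ` B" "t \<in> B \<union> J ` B"
  shows "s \<noteq> t \<Longrightarrow> g s t = 0" "g s s \<noteq> 0"
proof -
  have gw: "g (J b) c = w b c" for b c using g_sym[of "J b" c] g_J2[of c b] w_swap[of c b] by simp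
  have wg: "w (J b) c = - g b c" for b c using g_J2[of "J b" c] g_J[of b c] by simp
  show "s \<noteq> t \<Longrightarrow> g s t = 0" using assms by (auto simp: good_def g_J2 gw wg inj_eq[OF inj_J])
  show "g s s \<noteq> 0" using assms by (auto simp: good_def g_J)
qed

lemma good_independent:
  assumes "good B" shows "independent (B \<union> J ` B)"
proof (rule independent_if_scalars_zero)
  show fin: "finite (B \<union> J ` B)" using assms by (simp add: good_def)
  fix f x assume sum: "(\<Sum>x\<in>B \<union> J ` B. f x *\<^sub>R x) = 0" and x: "x \<in> B \<union> J ` B"
  have "0 = g x (\<Sum>y\<in>B \<union> J ` B. f y *\<^sub>R y)" by (simp add: sum g_simps)
  also have "\<dots> = (\<Sum>y\<in>B \<union> J ` B. f y * g x y)" by (simp add: linear_sum[OF g_lin2] g_simps)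
  also have "\<dots> = (\<Sum>y\<in>B \<union> J ` B. if y = x then f x * g x x else 0)"
    by (intro sum.cong refl) (use good_orth(1)[OF assms x] in auto)
  also have "\<dots> = f x * g x x" using x fin by simp
  finally show "f x = 0" using good_orth(2)[OF assms x x] by simp
qed

lemma good_disjoint: "good B \<Longrightarrow> B \<inter> J ` B = {}"
  by (auto simp: good_def) (metis g_J2 abs_zero neg_equal_0_iff_equal zero_neq_numeral)

lemma good_card: "good B \<Longrightarrow> card (B \<union> J ` B) = 2 * card B"
  using card_Un_disjoint[OF _ _ good_disjoint, of B] card_image[OF inj_on_subset[OF inj_J], of B]
  by (auto simp: good_def)

text \<open>One step of Gram-Schmidt in indefinite signature. The complement \<open>W\<close> of the
  span is \<open>J\<close>-invariant and inherits nondegeneracy, so it contains a vector of nonzero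
  length.\<close>

lemma good_extend:
  assumes B: "good B" and span: "span (B \<union> J ` B) \<noteq> UNIV"
  shows "\<exists>C. good C \<and> card C = Suc (card B)"
proof -
  let ?T = "B \<union> J ` B"
  define W where "W = {y. \<forall>t\<in>?T. g t y = 0}"
  define pr where "pr = (\<lambda>x. x - (\<Sum>t\<in>?T. (g t x / g t t) *\<^sub>R t))"
  have fin: "finite ?T" using B by (simp add: good_def)
  have prW: "pr x \<in> W" for x
  proof -
    have "g s (pr x) = 0" if s: "s \<in> ?T" for s
    proof -
      have "g s (\<Sum>t\<in>?T. (g t x / g t t) *\<^sub>R t) = (\<Sum>t\<in>?T. (g t x / g t t) * g s t)"
        by (simp add: linear_sum[OF g_lin2] g_simps)
      also have "\<dots> = (\<Sum>t\<in>?T. if t = s then g s x else 0)"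
        by (intro sum.cong refl) (use good_orth[OF B s] in auto)
      also have "\<dots> = g s x" using s fin by simp
      finally show ?thesis by (simp add: pr_def g_simps)
    qed
    then show ?thesis by (simp add: W_def)
  qed
  have WJ: "J y \<in> W" if "y \<in> W" for y
  proof -
    have "g b (J y) = 0 \<and> g (J b) (J y) = 0" if b: "b \<in> B" for b
    proof -
      have "g (J b) (J (J y)) = g b (J y)" by (rule g_J)
      then have "g b (J y) = - g (J b) y" using linear_neg[OF g_lin2, of "J b" y] by (simp add: J_J)
      then show ?thesis using \<open>y \<in> W\<close> b by (simp add: W_def g_J)
    qed
    then show ?thesis by (auto simp: W_def)
  qed
  \<comment> \<open>Otherwise \<open>g\<close> vanishes on \<open>W\<close> by polarisation;
    \<open>pr x\<close> is then orthogonal to \<open>W\<close> and to the span, hence to everything,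
    so it is 0 and \<open>x\<close> lies in the span.\<close>
  have "\<exists>y\<in>W. g y y \<noteq> 0"
  proof (rule ccontr)
    assume "\<not> ?thesis"
    then have iso: "g y y = 0" if "y \<in> W" for y using that by blast
    have gW: "g y z = 0" if "y \<in> W" "z \<in> W" for y z
    proof -
      have "y + z \<in> W" using that by (simp add: W_def g_simps)
      then show ?thesis
        using iso[OF that(1)] iso[OF that(2)] iso[of "y + z"] g_sym[of y z] by (simp add: g_simps)
    qed
    obtain x where x: "x \<notin> span ?T" using span by auto
    have "g (pr x) u = 0" for u
    proof -
      have u: "u = pr u + (\<Sum>t\<in>?T. (g t u / g t t) *\<^sub>R t)" by (simp add: pr_def)
      have "g (pr x) t = 0" if "t \<in> ?T" for t
        using prW[of x] that g_sym[of t "pr x"] by (auto simp: W_def)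
      then have "g (pr x) (\<Sum>t\<in>?T. (g t u / g t t) *\<^sub>R t) = 0"
        by (simp add: linear_sum[OF g_lin2] g_simps)
      with gW[OF prW prW, of x u] show ?thesis
        by (subst u) (simp only: linear_add[OF g_lin2] add_0_left)
    qed
    then have "w (pr x) v = 0" for v using g_J2[of "pr x" v] by simp
    then have "pr x = 0" by (rule w_nondeg)
    then have "x = (\<Sum>t\<in>?T. (g t x / g t t) *\<^sub>R t)" by (simp add: pr_def)
    also have "\<dots> \<in> span ?T" by (intro span_sum span_scale span_base)
    finally show False using x by simp
  qed
  then obtain y where y: "y \<in> W" "g y y \<noteq> 0" by blast
  define c where "c = sqrt (2 / \<bar>g y y\<bar>)"
  define z where "z = c *\<^sub>R y"
  have zW: "z \<in> W" using y by (simp add: z_def W_def g_simps)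
  have "g z z = c^2 * g y y" by (simp add: z_def g_simps power2_eq_square)
  then have zz: "\<bar>g z z\<bar> = 2" using y by (simp add: c_def abs_mult)
  have bz: "g b z = 0" "w b z = 0" if "b \<in> B" for b
    using zW WJ[OF zW] that g_J2[of b z] by (auto simp: W_def)
  then have zb: "g z b = 0" "w z b = 0" if "b \<in> B" for b
    using that g_sym[of z b] w_swap[of z b] by auto
  have "z \<notin> B" using bz(1)[of z] zz by auto
  then have "good (insert z B) \<and> card (insert z B) = Suc (card B)"
    using B zz bz zb by (auto simp: good_def w_self)
  then show ?thesis by blast
qed

text \<open>A good set of maximal size is a unitary frame up to scaling, with \<open>e i\<close>
  recording the signature. Its real span is Lagrangian for \<open>w\<close>, and as the frame and
  its image under \<open>J\<close> together span everything, this real span is also totally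
  real.\<close>

lemma lagrangian_frame:
  obtains v :: "'n \<Rightarrow> complex^'n" and e :: "'n \<Rightarrow> real"
  where "\<And>i. e i * e i = 1" "\<And>i j. w (v i) (v j) = 0"
    "\<And>i j. w (v i) (J (v j)) = (if i = j then 2 * e i else 0)"
    "\<And>u. (\<And>i. w (v i) u = 0) \<Longrightarrow> (\<And>i. w (J (v i)) u = 0) \<Longrightarrow> u = 0"
proof -
  have bound: "card B \<le> CARD('n)" if "good B" for B
  proof -
    have "card (B \<union> J ` B) \<le> DIM(complex^'n)"
      using independent_card_le[OF good_independent[OF that]] by simp
    then show ?thesis using good_card[OF that] by simp
  qed
  have "good {}" by (simp add: good_def)
  then have "\<exists>B. good B \<and> (\<forall>C. good C \<longrightarrow> card C \<le> card B)"
    using ex_has_greatest_nat[of good "{}" card "CARD('n) + 1"] bound by (metis less_Suc_eq_le Suc_eq_plus1)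
  then obtain B where B: "good B" "\<And>C. good C \<Longrightarrow> card C \<le> card B" by blast
  have span: "span (B \<union> J ` B) = UNIV"
    using good_extend[OF B(1)] B(2) by (metis not_less_eq_eq order_refl)
  have "dim (UNIV :: (complex^'n) set) = card (B \<union> J ` B)"
    using dim_eq_card_independent[OF good_independent[OF B(1)]] span by (metis dim_span)
  then have "card B = CARD('n)" using good_card[OF B(1)] by simp
  then obtain v where v: "bij_betw v (UNIV :: 'n set) B"
    using finite_same_card_bij[of "UNIV :: 'n set" B] B(1) by (auto simp: good_def)
  have vB: "v i \<in> B" for i using v by (auto simp: bij_betw_def)
  have vinj: "v i = v j \<longleftrightarrow> i = j" for i j using v by (auto simp: bij_betw_def inj_on_def)
  define e where "e i = g (v i) (v i) / 2" for i
  show thesis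
  proof (rule that[of e v])
    show "e i * e i = 1" for i
    proof -
      have "\<bar>e i\<bar> = 1" using B(1) vB[of i] by (simp add: good_def e_def)
      then show ?thesis by (metis abs_mult_self_eq mult_1)
    qed
    show "w (v i) (v j) = 0" for i j using B(1) vB by (simp add: good_def)
    show "w (v i) (J (v j)) = (if i = j then 2 * e i else 0)" for i j
      using B(1) vB[of i] vB[of j] vinj[of i j] by (auto simp: good_def e_def g_def)
    fix u assume u: "\<And>i. w (v i) u = 0" "\<And>i. w (J (v i)) u = 0"
    have "w t u = 0" if "t \<in> B \<union> J ` B" for t
      using that u v by (auto simp: bij_betw_def)
    then have "w t u = 0" if "t \<in> span (B \<union> J ` B)" for t
      using linear_eq_0_on_span[OF w_lin1[of u] _ that] by blast
    then have "w u t = 0" for t using span w_swap[of u t] by simp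
    then show "u = 0" by (rule w_nondeg)
  qed
qed

end

text \<open>By the assumed Euler relation \<open>F (c *s z) / c^2\<close> has derivative 0 in
  \<open>c\<close>; so it is constant on a ball around 1 that avoids 0 and keeps
  \<open>c *s z\<close> in \<open>U\<close>.\<close>

lemma euler_imp_conic:
  assumes "open U" "holo_on J J1 F U" "\<And>z. z \<in> U \<Longrightarrow> fd F z z = 2 * F z"
  shows "conic_fun F U"
  unfolding conic_fun_def
proof
  fix z assume z: "z \<in> U"
  have contm: "continuous_on A (\<lambda>m. m *s z)" for A
    unfolding vector_scalar_mult_def by (intro continuous_intros)
  have "open ((- {0}) \<inter> (\<lambda>m. m *s z) -` U)"
    by (intro continuous_open_preimage contm assms(1)) auto
  moreover have "1 \<in> (- {0}) \<inter> (\<lambda>m. m *s z) -` U" using z by simp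
  ultimately obtain d where d: "d > 0" "ball 1 d \<subseteq> (- {0}) \<inter> (\<lambda>m. m *s z) -` U"
    using open_contains_ball by blast
  have "((\<lambda>c. F (c *s z) / c^2) has_field_derivative 0) (at c within ball 1 d)" if "c \<in> ball 1 d" for c
  proof -
    have c: "c \<noteq> 0" "c *s z \<in> U" using that d by auto
    have "((\<lambda>c. F (0 + Jc.cs c z)) has_field_derivative fd F (0 + Jc.cs c z) z) (at c)"
      by (rule Jc.holo_on_line[OF assms(2)]) (use c in \<open>simp add: cs_J\<close>)
    then have F: "((\<lambda>c. F (c *s z)) has_field_derivative fd F (c *s z) z) (at c)" by (simp add: cs_J)
    have "c * fd F (c *s z) z = 2 * F (c *s z)"
      using assms(3)[OF c(2)] complex_linear_mult[OF has_derivative_linear[OF holo_onE(1)[OF assms(2) c(2)]] holo_onE(2)[OF assms(2) c(2)], of c z]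
      by simp
    then have "fd F (c *s z) z * c^2 = F (c *s z) * (2 * c)"
      by (simp add: power2_eq_square) (metis mult.assoc mult.commute)
    then have "((\<lambda>c. F (c *s z) / c^2) has_field_derivative 0) (at c)"
      using c by (auto intro!: derivative_eq_intros F)
    then show ?thesis by (rule has_field_derivative_at_within)
  qed
  then obtain k where k: "\<And>c. c \<in> ball 1 d \<Longrightarrow> F (c *s z) / c^2 = k"
    using has_field_derivative_zero_constant[OF convex_ball, of "1::complex" d "\<lambda>c. F (c *s z) / c^2"] by blast
  have "F (l *s z) = l\<^sup>2 * F z" if "l \<in> ball 1 d" for l
    using k[OF that] k[of 1] d that by (auto simp: field_simps)
  then show "\<forall>\<^sub>F l in nhds 1. F (l *s z) = l\<^sup>2 * F z"
    using eventually_nhds_in_open[of "ball 1 d" "1::complex"] d(1) by (auto elim: eventually_mono)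
qed

section \<open>Special coordinates in a chart\<close>

lemma has_derivative_Complex:
  assumes "(f has_derivative f') (at x)" "(g has_derivative g') (at x)"
  shows "((\<lambda>x. Complex (f x) (g x)) has_derivative (\<lambda>u. Complex (f' u) (g' u))) (at x)"
  unfolding Complex_eq using assms by (auto intro!: derivative_eq_intros)

lemma has_derivative_Re:
  "(f has_derivative f') (at x) \<Longrightarrow> ((\<lambda>x. Re (f x)) has_derivative (\<lambda>u. Re (f' u))) (at x)"
  by (rule bounded_linear.has_derivative[OF bounded_linear_Re])

lemma J_nth: "J v $ i = \<i> * v $ i"
  by (simp add: J_def)

text \<open>A local model seen in a region \<open>N\<close> of a chart: \<open>z\<close> is a
  holomorphic coordinate change with inverse \<open>g\<close>, and the last two assumptions say that
  \<open>G\<close> and \<open>w\<close> are the pull-backs by \<open>z\<close> of the connection and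
  the form induced by \<open>F\<close>.\<close>

locale special_coords =
  fixes G :: "complex^'n \<Rightarrow> complex^'n \<Rightarrow> complex^'n \<Rightarrow> complex^'n"
    and w :: "complex^'n \<Rightarrow> complex^'n \<Rightarrow> complex^'n \<Rightarrow> real"
    and N U and z g :: "complex^'n \<Rightarrow> complex^'n" and F :: "complex^'n \<Rightarrow> complex"
  assumes open_N: "open N" and open_U: "open U" and hom: "homeomorphism N U z g"
    and z_holo: "holo_on J J z N" and g_holo: "holo_on J J g U"
    and F_holo: "holo_on J J1 F U" and F_nondeg: "nondegenerate_fun F U"
    and conn_eq: "x \<in> N \<Longrightarrow>
      fd (\<lambda>x. holo_fun.\<psi> F (z x)) x (G x u v) = fd (\<lambda>y. fd (\<lambda>x. holo_fun.\<psi> F (z x)) y v) x u"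
    and form_eq: "x \<in> N \<Longrightarrow>
      w x u v = sympl (fd (\<lambda>x. holo_fun.\<psi> F (z x)) x u) (fd (\<lambda>x. holo_fun.\<psi> F (z x)) x v)"

text \<open>\<open>\<xi>\<close> stands for the generator of the action. \<open>\<xi>_par\<close>
  speaks of parallel fields only, since the definition of a conic action tests nothing else; a
  parallel frame extends it to all vectors in \<open>nabla_\<xi>\<close>.\<close>

locale conic_chart = flat_conn V G
  for V :: "(complex^'n) set" and G :: "complex^'n \<Rightarrow> complex^'n \<Rightarrow> complex^'n \<Rightarrow> complex^'n" +
  fixes w :: "complex^'n \<Rightarrow> complex^'n \<Rightarrow> complex^'n \<Rightarrow> real" and \<xi> :: "complex^'n \<Rightarrow> complex^'n"
  assumes G_sym: "x \<in> V \<Longrightarrow> G x u v = G x v u"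
    and w_smooth: "smooth_on (\<lambda>x. w x u v) V"
    and w_herm: "x \<in> V \<Longrightarrow> herm_form (w x)"
    and w_par: "x \<in> V \<Longrightarrow> fd (\<lambda>x. w x v v') x u = w x (G x u v) v' + w x v (G x u v')"
    and \<xi>_holo: "holo_on J J \<xi> V"
    and \<xi>_par: "ball q r \<subseteq> V \<Longrightarrow> (\<And>x. x \<in> ball q r \<Longrightarrow> (Y has_derivative (\<lambda>u. - G x u (Y x))) (at x)) \<Longrightarrow>
      x \<in> ball q r \<Longrightarrow> fd \<xi> x (Y x) + G x (\<xi> x) (Y x) = Y x \<and>
        J (fd \<xi> x (Y x)) + G x (J (\<xi> x)) (Y x) = J (Y x)"
begin

lemma w_lin1: "x \<in> V \<Longrightarrow> linear (\<lambda>u. w x u v)" and w_lin2: "x \<in> V \<Longrightarrow> linear (w x u)"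
  using herm_form.w_lin1[OF w_herm] herm_form.w_lin2[OF w_herm] by auto

lemma w_swap: "x \<in> V \<Longrightarrow> w x u v = - w x v u"
  by (rule herm_form.w_swap[OF w_herm])

lemma w_J: "x \<in> V \<Longrightarrow> w x (J u) (J v) = w x u v"
  by (rule herm_form.w_J[OF w_herm])

text \<open>The product rule for a parallel form; \<open>a' u + G x u (a x)\<close> is the covariant
  derivative of \<open>a\<close>.\<close>

lemma w_has_derivative:
  assumes x: "x \<in> V" and a: "(a has_derivative a') (at x)" and b: "(b has_derivative b') (at x)"
  shows "((\<lambda>x. w x (a x) (b x)) has_derivative
    (\<lambda>u. w x (a' u + G x u (a x)) (b x) + w x (a x) (b' u + G x u (b x)))) (at x)"
proof -
  have "((\<lambda>y. w y c (b y)) has_derivative (\<lambda>u. (w x (G x u c) (b x) + w x c (G x u (b x))) + w x c (b' u))) (at x)" for c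
  proof -
    have "((\<lambda>x. w x c d) has_derivative (\<lambda>u. w x (G x u c) d + w x c (G x u d))) (at x)" for d
    proof -
      have "fd (\<lambda>x. w x c d) x = (\<lambda>u. w x (G x u c) d + w x c (G x u d))"
        by (rule ext) (rule w_par[OF x])
      then show ?thesis using smooth_on_has_derivative[OF w_smooth x, of c d] by simp
    qed
    from has_derivative_apply[where A="\<lambda>y. w y c", OF open_V x w_lin2 this b] show ?thesis .
  qed
  from has_derivative_apply[where A="\<lambda>y a. w y a (b y)", OF open_V x w_lin1 this a]
  show ?thesis
    by (simp add: linear_add[OF w_lin1[OF x]] linear_add[OF w_lin2[OF x]] ac_simps)
qed

context
  fixes q r
  assumes r: "r > 0" and BV: "ball q r \<subseteq> V"
begin

definition par :: "(complex^'n \<Rightarrow> complex^'n) \<Rightarrow> bool" where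
  "par Y \<longleftrightarrow> (\<forall>x\<in>ball q r. (Y has_derivative (\<lambda>u. - G x u (Y x))) (at x))"

lemma par: "par Y \<Longrightarrow> x \<in> ball q r \<Longrightarrow> (Y has_derivative (\<lambda>u. - G x u (Y x))) (at x)"
  by (simp add: par_def)

lemma inV: "x \<in> ball q r \<Longrightarrow> x \<in> V" using BV by auto

lemma w_par_const:
  assumes "par Y" "par Y'" "x \<in> ball q r"
  shows "w x (Y x) (Y' x) = w q (Y q) (Y' q)"
proof (rule has_derivative_zero_unique_connected[OF open_ball connected_ball _ assms(3), where f="\<lambda>x. w x (Y x) (Y' x)"])
  fix x assume x: "x \<in> ball q r"
  from w_has_derivative[OF inV[OF x] par[OF assms(1) x] par[OF assms(2) x]]
  show "((\<lambda>x. w x (Y x) (Y' x)) has_derivative (\<lambda>x. 0)) (at x)"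
    by (simp add: linear_0[OF w_lin1[OF inV[OF x]]] linear_0[OF w_lin2[OF inV[OF x]]])
qed (use r in simp)

definition Z :: "(complex^'n \<Rightarrow> complex^'n) \<Rightarrow> complex^'n \<Rightarrow> complex" where
  "Z Y x = Complex (w x (Y x) (\<xi> x)) (- w x (Y x) (J (\<xi> x)))"

definition dZ :: "(complex^'n \<Rightarrow> complex^'n) \<Rightarrow> complex^'n \<Rightarrow> complex^'n \<Rightarrow> complex" where
  "dZ Y x u = Complex (w x (Y x) u) (- w x (Y x) (J u))"

lemma dZ_J: "x \<in> V \<Longrightarrow> dZ Y x (J u) = \<i> * dZ Y x u"
  by (simp add: dZ_def J_J linear_neg[OF w_lin2] complex_eq_iff)

lemma dZ_\<xi>: "dZ Y x (\<xi> x) = Z Y x"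
  by (simp add: dZ_def Z_def)

lemma dZ_has_derivative:
  assumes "par Y" "x \<in> ball q r"
  shows "((\<lambda>x. w x (Y x) v) has_derivative (\<lambda>u. w x (Y x) (G x u v))) (at x)"
  using w_has_derivative[OF inV[OF assms(2)] par[OF assms] has_derivative_const[of v]]
  by (simp add: linear_0[OF w_lin1[OF inV[OF assms(2)]]])

text \<open>\<nabla>\<xi> = id and \<nabla>(J\<xi>) = J at \<open>x\<close>. The second does not
  follow from the first, as \<open>J\<close> is not assumed parallel.\<close>

definition nabla_\<xi> :: "complex^'n \<Rightarrow> bool" where
  "nabla_\<xi> x \<longleftrightarrow> (\<forall>u. fd \<xi> x u + G x u (\<xi> x) = u \<and> J (fd \<xi> x u) + G x u (J (\<xi> x)) = J u)"

text \<open>For parallel \<open>Y\<close> only the covariant derivatives of \<xi> and J\<xi> remain,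
  and these are the identity and J.\<close>

lemma Z_has_derivative:
  assumes "par Y" "x \<in> ball q r" "nabla_\<xi> x"
  shows "(Z Y has_derivative dZ Y x) (at x)"
proof -
  note x = inV[OF assms(2)]
  note \<xi>' = holo_onE(1)[OF \<xi>_holo x]
  have J\<xi>': "((\<lambda>x. J (\<xi> x)) has_derivative (\<lambda>u. J (fd \<xi> x u))) (at x)"
    using bounded_linear.has_derivative[OF _ \<xi>'] linear_J linear_conv_bounded_linear by blast
  have "((\<lambda>x. w x (Y x) (\<xi> x)) has_derivative (\<lambda>u. w x (Y x) u)) (at x)"
    using w_has_derivative[OF x par[OF assms(1,2)] \<xi>'] assms(3)
    by (simp add: linear_0[OF w_lin1[OF x]] nabla_\<xi>_def)
  moreover have "((\<lambda>x. w x (Y x) (J (\<xi> x))) has_derivative (\<lambda>u. w x (Y x) (J u))) (at x)"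
    using w_has_derivative[OF x par[OF assms(1,2)] J\<xi>'] assms(3)
    by (simp add: linear_0[OF w_lin1[OF x]] nabla_\<xi>_def)
  ultimately show ?thesis
    unfolding Z_def[abs_def] dZ_def[abs_def] by (intro has_derivative_Complex has_derivative_minus)
qed

text \<open>\<open>Y' i\<close> is the parallel field extending \<open>J (v i)\<close>; away from
  \<open>q\<close> it may differ from \<open>J (Y i x)\<close>. The pairings of parallel fields
  under \<open>w\<close> are constant, so the normal form of the frame at \<open>q\<close> persists
  on the ball.\<close>

context
  fixes Y Y' :: "'n \<Rightarrow> complex^'n \<Rightarrow> complex^'n" and v :: "'n \<Rightarrow> complex^'n" and e :: "'n \<Rightarrow> real"
  assumes parY: "par (Y i)" and parY': "par (Y' i)"
    and Yq: "Y i q = v i" and Y'q: "Y' i q = J (v i)"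
    and e: "e i * e i = 1"
    and vv: "w q (v i) (v j) = 0" and vJv: "w q (v i) (J (v j)) = (if i = j then 2 * e i else 0)"
    and v_nondeg: "(\<And>i. w q (v i) u = 0) \<Longrightarrow> (\<And>i. w q (J (v i)) u = 0) \<Longrightarrow> u = 0"
begin

definition L :: "complex^'n \<Rightarrow> complex^'n \<Rightarrow> complex^'n" where
  "L x c = (\<Sum>i\<in>UNIV. Re (c $ i) *\<^sub>R Y i x + Im (c $ i) *\<^sub>R Y' i x)"

lemma q_ball: "q \<in> ball q r" using r by simp

lemma pairing:
  assumes "x \<in> ball q r"
  shows "w x (Y i x) (Y j x) = 0" "w x (Y' i x) (Y' j x) = 0"
    "w x (Y i x) (Y' j x) = (if i = j then 2 * e i else 0)" "w x (Y' i x) (Y j x) = - (if i = j then 2 * e i else 0)"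
proof -
  show "w x (Y i x) (Y j x) = 0" using w_par_const[OF parY parY assms] by (simp add: Yq vv)
  show "w x (Y' i x) (Y' j x) = 0" using w_par_const[OF parY' parY' assms] by (simp add: Y'q w_J[OF inV[OF q_ball]] vv)
  show *: "w x (Y i x) (Y' j x) = (if i = j then 2 * e i else 0)" for i j
    using w_par_const[OF parY parY' assms] by (simp add: Yq Y'q vJv)
  show "w x (Y' i x) (Y j x) = - (if i = j then 2 * e i else 0)"
    using *[of j i] w_swap[OF inV[OF assms], of "Y' i x" "Y j x"] by auto
qed

lemma w_L:
  assumes "x \<in> ball q r"
  shows "w x (Y i x) (L x c) = 2 * e i * Im (c $ i)" "w x (Y' i x) (L x c) = - (2 * e i * Re (c $ i))"
  unfolding L_def
  by (simp_all add: linear_sum[OF w_lin2[OF inV[OF assms]]] linear_add[OF w_lin2[OF inV[OF assms]]]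
      linear_cmul[OF w_lin2[OF inV[OF assms]]] pairing[OF assms] if_distrib[of "\<lambda>x. _ * x"] if_distrib[of uminus] cong: if_cong)

lemma linear_L: "linear (L x)"
  by (rule linearI) (simp_all add: L_def sum.distrib[symmetric] scaleR_sum_right algebra_simps)

text \<open>By \<open>w_L\<close> the coefficients \<open>c\<close> can be recovered from
  \<open>L x c\<close>, so the fields \<open>Y i\<close>, \<open>Y' i\<close> form a real frame at
  every point of the ball.\<close>

lemma surj_L:
  assumes "x \<in> ball q r"
  obtains c where "u = L x c"
proof -
  have "c = 0" if "L x c = 0" for c
  proof -
    have "e i \<noteq> 0" for i using e[of i] by auto
    moreover have "2 * e i * Im (c $ i) = 0" "2 * e i * Re (c $ i) = 0" for i
      using w_L[OF assms, of i c] that linear_0[OF w_lin2[OF inV[OF assms]]] by auto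
    ultimately show ?thesis by (simp add: vec_eq_iff complex_eq_iff)
  qed
  then have "inj (L x)" using linear_injective_0[OF linear_L] by blast
  then have "surj (L x)" by (intro linear_injective_imp_surjective[OF linear_L]) simp_all
  then show thesis using that by (metis surjE)
qed

text \<open>The defects \<open>D\<close> and \<open>D'\<close> are linear in \<open>u\<close> and
  vanish on a frame of parallel fields; torsion-freeness then swaps the arguments of
  \<open>G\<close>.\<close>

lemma nabla_\<xi>: assumes x: "x \<in> ball q r" shows "nabla_\<xi> x"
proof -
  note xV = inV[OF x]
  have lin\<xi>: "linear (fd \<xi> x)" by (rule has_derivative_linear[OF holo_onE(1)[OF \<xi>_holo xV]])
  define D where "D = (\<lambda>u. fd \<xi> x u + G x (\<xi> x) u - u)"
  define D' where "D' = (\<lambda>u. J (fd \<xi> x u) + G x (J (\<xi> x)) u - J u)"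
  have lin: "linear D" "linear D'"
    by (rule linearI; simp add: D_def D'_def linear_add[OF lin\<xi>] linear_cmul[OF lin\<xi>] G_add2[OF xV] G_scale2[OF xV]
        J_add J_scaleR algebra_simps)+
  have "D (Y i x) = 0" "D (Y' i x) = 0" "D' (Y i x) = 0" "D' (Y' i x) = 0" for i
    using \<xi>_par[OF BV par[OF parY] x, of i] \<xi>_par[OF BV par[OF parY'] x, of i] by (auto simp: D_def D'_def)
  then have "D (L x c) = 0" "D' (L x c) = 0" for c
    unfolding L_def by (simp_all add: linear_sum[OF lin(1)] linear_sum[OF lin(2)] linear_add[OF lin(1)] linear_add[OF lin(2)]
        linear_cmul[OF lin(1)] linear_cmul[OF lin(2)])
  then have "D u = 0" "D' u = 0" for u using surj_L[OF x, of u] by metis+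
  then show ?thesis
    unfolding nabla_\<xi>_def by (auto simp: D_def D'_def G_sym[OF xV, of _ "\<xi> x"] G_sym[OF xV, of _ "J (\<xi> x)"])
qed

text \<open>The constants here and in \<open>p\<close> are chosen so that for
  \<open>u = L x c\<close> the real parts of dz^i and dp_i are \<open>Re (c $ i)\<close> and
  \<open>e i * Im (c $ i)\<close>. By \<open>pairing\<close> these are canonical coordinates for
  \<open>w\<close>, up to the factor 2 in \<open>sympl\<close>.\<close>

definition z :: "complex^'n \<Rightarrow> complex^'n" where "z x = (\<chi> i. complex_of_real (- e i / 2) * Z (Y' i) x)"
definition p :: "complex^'n \<Rightarrow> complex^'n" where "p x = (\<chi> i. complex_of_real (1 / 2) * Z (Y i) x)"
definition dz' :: "complex^'n \<Rightarrow> complex^'n \<Rightarrow> complex^'n" where "dz' x u = (\<chi> i. complex_of_real (- e i / 2) * dZ (Y' i) x u)"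
definition dp :: "complex^'n \<Rightarrow> complex^'n \<Rightarrow> complex^'n" where "dp x u = (\<chi> i. complex_of_real (1 / 2) * dZ (Y i) x u)"

lemma z_has_derivative: "x \<in> ball q r \<Longrightarrow> (z has_derivative dz' x) (at x)"
  unfolding has_derivative_vec_iff z_def dz'_def vec_lambda_beta
  by (intro allI has_derivative_mult_right Z_has_derivative[OF parY' _ nabla_\<xi>])

lemma p_has_derivative: "x \<in> ball q r \<Longrightarrow> (p has_derivative dp x) (at x)"
  unfolding has_derivative_vec_iff p_def dp_def vec_lambda_beta
  by (intro allI has_derivative_mult_right Z_has_derivative[OF parY _ nabla_\<xi>])

lemma dz'_J: "x \<in> ball q r \<Longrightarrow> dz' x (J u) = J (dz' x u)"
  by (simp add: dz'_def dZ_J[OF inV] J_nth vec_eq_iff)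

lemma symplectic_coords:
  assumes x: "x \<in> ball q r"
  shows "w x u u' = 2 * (\<Sum>i\<in>UNIV. Re (dz' x u $ i) * Re (dp x u' $ i) - Re (dz' x u' $ i) * Re (dp x u $ i))"
proof -
  obtain c where c: "u = L x c" by (rule surj_L[OF x])
  have ee: "e i * (e i * t) = t" for i t using e[of i] by (simp flip: mult.assoc)
  have "w x u u' = (\<Sum>i\<in>UNIV. Re (c $ i) * w x (Y i x) u' + Im (c $ i) * w x (Y' i x) u')"
    unfolding c by (subst L_def) (simp add: linear_sum[OF w_lin1[OF inV[OF x]]] linear_add[OF w_lin1[OF inV[OF x]]]
      linear_cmul[OF w_lin1[OF inV[OF x]]])
  also have "\<dots> = (\<Sum>i\<in>UNIV. 2 * (Re (dz' x u $ i) * Re (dp x u' $ i) - Re (dz' x u' $ i) * Re (dp x u $ i)))"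
    by (intro sum.cong refl) (simp add: dz'_def dp_def dZ_def c w_L[OF x] ee algebra_simps)
  finally show ?thesis by (simp add: sum_distrib_left)
qed

text \<open>Imaginary parts are minus the real parts at \<open>J u\<close>. So the real and
  imaginary parts of the difference are multiples of w(u, u') - w(J u, J u') and of w(u, J u') + w(J
  u, u'), and both vanish by J-invariance.\<close>

lemma lagrangian:
  assumes x: "x \<in> ball q r"
  shows "dot (dz' x u) (dp x u') = dot (dp x u) (dz' x u')"
proof -
  have im: "Im (dz' x u $ i) = - Re (dz' x (J u) $ i)" "Im (dp x u $ i) = - Re (dp x (J u) $ i)" for u i
    by (simp_all add: dz'_def dp_def dZ_def)
  have 1: "(\<Sum>i\<in>UNIV. Re (dz' x u $ i) * Re (dp x u' $ i) - Re (dz' x u' $ i) * Re (dp x u $ i)) = w x u u' / 2" for u u'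
    using symplectic_coords[OF x, of u u'] by simp
  have "w x (J u) u' = w x (J (J u)) (J u')" by (simp only: w_J[OF inV[OF x]])
  then have 2: "w x (J u) u' = - w x u (J u')" by (simp add: J_J linear_neg[OF w_lin1[OF inV[OF x]]])
  have "Re (dot (dz' x u) (dp x u') - dot (dp x u) (dz' x u')) =
     (\<Sum>i\<in>UNIV. Re (dz' x u $ i) * Re (dp x u' $ i) - Re (dz' x u' $ i) * Re (dp x u $ i)) -
     (\<Sum>i\<in>UNIV. Re (dz' x (J u) $ i) * Re (dp x (J u') $ i) - Re (dz' x (J u') $ i) * Re (dp x (J u) $ i))"
    by (simp add: dot_def im sum_subtractf[symmetric] algebra_simps flip: sum.distrib)
  also have "\<dots> = 0" unfolding 1 by (simp add: w_J[OF inV[OF x]])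
  finally have re: "Re (dot (dz' x u) (dp x u')) = Re (dot (dp x u) (dz' x u'))" by simp
  have "Im (dot (dz' x u) (dp x u') - dot (dp x u) (dz' x u')) =
     - (\<Sum>i\<in>UNIV. Re (dz' x u $ i) * Re (dp x (J u') $ i) - Re (dz' x (J u') $ i) * Re (dp x u $ i)) -
     (\<Sum>i\<in>UNIV. Re (dz' x (J u) $ i) * Re (dp x u' $ i) - Re (dz' x u' $ i) * Re (dp x (J u) $ i))"
    by (simp add: dot_def im sum_subtractf[symmetric] algebra_simps flip: sum.distrib sum_negf)
  also have "\<dots> = 0" unfolding 1 using 2 by simp
  finally have im: "Im (dot (dz' x u) (dp x u')) = Im (dot (dp x u) (dz' x u'))" by simp
  show ?thesis using re im by (rule complex_eqI)
qed

definition \<Phi> :: "complex^'n \<Rightarrow> complex" where "\<Phi> x = dot (z x) (p x) / 2"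

lemma \<Phi>_has_derivative:
  assumes x: "x \<in> ball q r"
  shows "(\<Phi> has_derivative (\<lambda>u. dot (dz' x u) (p x))) (at x)"
proof -
  have z\<xi>: "dz' x (\<xi> x) = z x" "dp x (\<xi> x) = p x"
    by (simp_all add: dz'_def dp_def z_def p_def dZ_\<xi>)
  have "((\<lambda>x. (\<Sum>i\<in>UNIV. z x $ i * p x $ i) / 2) has_derivative
     (\<lambda>u. (\<Sum>i\<in>UNIV. z x $ i * dp x u $ i + dz' x u $ i * p x $ i) / 2)) (at x)"
    using z_has_derivative[OF x] p_has_derivative[OF x] unfolding has_derivative_vec_iff
    by (intro bounded_linear.has_derivative[OF bounded_linear_divide] has_derivative_sum has_derivative_mult) auto
  moreover have "(\<Sum>i\<in>UNIV. z x $ i * dp x u $ i + dz' x u $ i * p x $ i) / 2 = dot (dz' x u) (p x)" for u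
  proof -
    have "(\<Sum>i\<in>UNIV. z x $ i * dp x u $ i + dz' x u $ i * p x $ i) = dot (z x) (dp x u) + dot (dz' x u) (p x)"
      by (simp add: dot_def sum.distrib)
    also have "dot (z x) (dp x u) = dot (p x) (dz' x u)"
      using lagrangian[OF x, of "\<xi> x" u] by (simp add: z\<xi>)
    also have "\<dots> = dot (dz' x u) (p x)" by (simp add: dot_def mult.commute)
    finally show ?thesis by simp
  qed
  ultimately show ?thesis by (simp add: \<Phi>_def[abs_def] dot_def)
qed

text \<open>At \<open>q\<close> the fields \<open>Y' i\<close> equal \<open>J (v i)\<close>, so the
  imaginary part of \<open>dZ\<close> tests \<open>u\<close> against \<open>v i\<close> as well.
  Elsewhere this may fail, hence the inverse function theorem in \<open>normal_form\<close>.\<close>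

lemma dz'_inj_q: "dz' q u = 0 \<Longrightarrow> u = 0"
proof -
  assume *: "dz' q u = 0"
  have e0: "e i \<noteq> 0" for i using e[of i] by auto
  have "dZ (Y' i) q u = 0" for i
  proof -
    have "dz' q u $ i = 0" using * by simp
    then show ?thesis using e0[of i] by (simp add: dz'_def)
  qed
  then have "w q (J (v i)) u = 0 \<and> w q (J (v i)) (J u) = 0" for i
    by (simp add: dZ_def Y'q complex_eq_iff)
  then show ?thesis using w_J[OF inV[OF q_ball]] by (intro v_nondeg) auto
qed

lemma dz'_cont: "continuous_on (ball q r) (\<lambda>x. dz' x u)"
proof -
  have "continuous_on (ball q r) (\<lambda>x. w x (Y' i x) u)" for i u
    by (rule continuous_at_imp_continuous_on, rule ballI, rule has_derivative_continuous[OF dZ_has_derivative[OF parY']])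
  then show ?thesis
    unfolding dz'_def dZ_def Complex_eq by (intro continuous_intros)
qed

lemma normal_form:
  obtains N U g F where "N \<subseteq> ball q r" "q \<in> N" "special_coords G w N U z g F" "conic_fun F U"
proof -
  note dz = z_has_derivative
  have bl: "bounded_linear (dz' x)" if "x \<in> ball q r" for x
    by (rule has_derivative_bounded_linear[OF dz[OF that]])
  have ba: "blinfun_apply (Blinfun (dz' x)) = dz' x" if "x \<in> ball q r" for x
    by (rule bounded_linear_Blinfun_apply[OF bl[OF that]])
  have "inj (dz' q)" using linear_injective_0[OF has_derivative_linear[OF dz[OF q_ball]]] dz'_inj_q by blast
  then obtain l where l: "linear l" "l \<circ> dz' q = id"
    using linear_injective_left_inverse[OF has_derivative_linear[OF dz[OF q_ball]]] by blast
  have "Blinfun l o\<^sub>L Blinfun (dz' q) = id_blinfun"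
    using l by (intro blinfun_eqI) (simp add: ba[OF q_ball] bounded_linear_Blinfun_apply linear_conv_bounded_linear fun_eq_iff)
  moreover have "continuous_on (ball q r) (\<lambda>x. Blinfun (dz' x))"
  proof (rule continuous_on_blinfun_componentwise)
    show "continuous_on (ball q r) (\<lambda>x. blinfun_apply (Blinfun (dz' x)) i)" for i
      by (rule continuous_on_eq[OF dz'_cont[of i]]) (simp add: ba del: mem_ball)
  qed
  moreover have "\<And>x. x \<in> ball q r \<Longrightarrow> (z has_derivative blinfun_apply (Blinfun (dz' x))) (at x)"
    using dz ba by simp
  ultimately obtain N U g g' where N: "open N" "N \<subseteq> ball q r" "q \<in> N" "open U" "homeomorphism N U z g"
    and g: "\<And>y. y \<in> U \<Longrightarrow> (g has_derivative g' y) (at y)"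
      "\<And>y. y \<in> U \<Longrightarrow> g' y = inv (blinfun_apply (Blinfun (dz' (g y))))"
      "\<And>y. y \<in> U \<Longrightarrow> bij (blinfun_apply (Blinfun (dz' (g y))))"
    using inverse_function_theorem[of "ball q r" z "\<lambda>x. Blinfun (dz' x)" q "Blinfun l"] q_ball by (metis open_ball)
  have NB: "x \<in> N \<Longrightarrow> x \<in> ball q r" for x using N(2) by auto
  have gN: "g y \<in> N" "z (g y) = y" if "y \<in> U" for y
    using that N(5) by (auto simp: homeomorphism_def)
  have zU: "z x \<in> U" "g (z x) = x" if "x \<in> N" for x
    using that N(5) by (auto simp: homeomorphism_def)
  have g': "dz' (g y) (g' y u) = u" "g' y (dz' (g y) u) = u" if "y \<in> U" for y u
    using g(2,3)[OF that] ba[OF NB[OF gN(1)[OF that]]] by (simp_all add: bij_is_surj surj_f_inv_f bij_is_inj inv_f_f)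
  have holo_z: "holo_on J J z N"
    by (rule holo_onI[OF dz dz'_J]) (use NB in auto)
  have holo_g: "holo_on J J g U"
  proof (rule holo_onI[OF g(1)])
    fix y u assume y: "y \<in> U"
    have "J u = dz' (g y) (J (g' y u))" using dz'_J[OF NB[OF gN(1)[OF y]]] g'(1)[OF y] by simp
    then show "g' y (J u) = J (g' y u)" using g'(2)[OF y] by simp
  qed
  \<comment> \<open>\<open>\<Phi>\<close> has the sum of p_i dz^i as its differential, so in the
    coordinates \<open>z\<close> the gradient of \<open>F\<close> is \<open>p\<close>.\<close>
  define F where "F = (\<lambda>y. \<Phi> (g y))"
  have F': "(F has_derivative (\<lambda>u. dot u (p (g y)))) (at y)" if "y \<in> U" for y
  proof -
    have "(F has_derivative (\<lambda>u. dot (dz' (g y) (g' y u)) (p (g y)))) (at y)"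
      unfolding F_def
      by (rule has_derivative_compose[OF g(1)[OF that] \<Phi>_has_derivative[OF NB[OF gN(1)[OF that]]]])
    then show ?thesis by (simp add: g'(1)[OF that])
  qed
  have holo_F: "holo_on J J1 F U"
    by (rule holo_onI[OF F']) (simp_all add: J_def J1_def dot_smult)
  interpret F: holo_fun F U by unfold_locales (rule N(4), rule holo_F)
  have grad: "grad F y = p (g y)" if "y \<in> U" for y
    by (rule dot_eqI) (simp add: fd_eq_dot_grad[OF holo_F that, symmetric] fd_eq[OF F'[OF that]])
  \<comment> \<open>In the chart the map \<open>\<psi>\<close> of \<open>F\<close> becomes (Re z, Re
    p), which reduces the connection and form equations to statements about \<open>dz'\<close> and
    \<open>dp\<close>.\<close>
  have \<Theta>: "F.\<psi> (z x) = (\<chi> i. Complex (Re (z x $ i)) (Re (p x $ i)))" if "x \<in> N" for x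
    by (simp add: F.\<psi>_def grad[OF zU(1)[OF that]] zU(2)[OF that])
  have \<Theta>': "fd (\<lambda>x. F.\<psi> (z x)) x u = (\<chi> i. Complex (Re (dz' x u $ i)) (Re (dp x u $ i)))" if x: "x \<in> N" for x u
  proof -
    have "((\<lambda>x. \<chi> i. Complex (Re (z x $ i)) (Re (p x $ i))) has_derivative
        (\<lambda>u. \<chi> i. Complex (Re (dz' x u $ i)) (Re (dp x u $ i)))) (at x)"
      unfolding has_derivative_vec_iff vec_lambda_beta
      by (intro allI has_derivative_Complex has_derivative_Re
        z_has_derivative[unfolded has_derivative_vec_iff, rule_format, OF NB[OF x]]
        p_has_derivative[unfolded has_derivative_vec_iff, rule_format, OF NB[OF x]])
    from has_derivative_transform_within_open[OF this N(1) x \<Theta>[symmetric]] show ?thesis by (simp add: fd_eq)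
  qed
  \<comment> \<open>The real parts of \<open>dz'\<close> and \<open>dp\<close> are multiples of
    \<open>w x (Y i x) u\<close> with a parallel field in the first slot, and differentiating such a
    pairing in \<open>x\<close> just inserts \<open>G x u v\<close>. So the real parts of
    \<open>z\<close> and \<open>p\<close> are affine.\<close>
  have 1: "fd (\<lambda>x. F.\<psi> (z x)) x (G x u v) = fd (\<lambda>y. fd (\<lambda>x. F.\<psi> (z x)) y v) x u" if x: "x \<in> N" for x u v
  proof -
    have re: "Re (dz' x u $ i) = - e i / 2 * w x (Y' i x) u" "Re (dp x u $ i) = 1 / 2 * w x (Y i x) u" for i x u
      by (simp_all add: dz'_def dp_def dZ_def)
    have "((\<lambda>y. \<chi> i. Complex (- e i / 2 * w y (Y' i y) v) (1 / 2 * w y (Y i y) v)) has_derivative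
        (\<lambda>u. \<chi> i. Complex (- e i / 2 * w x (Y' i x) (G x u v)) (1 / 2 * w x (Y i x) (G x u v)))) (at x)"
      unfolding has_derivative_vec_iff vec_lambda_beta
      by (intro allI has_derivative_Complex has_derivative_mult_right dZ_has_derivative parY parY' NB[OF x])
    from has_derivative_transform_within_open[OF this N(1) x, of "\<lambda>y. fd (\<lambda>x. F.\<psi> (z x)) y v"]
    have "fd (\<lambda>y. fd (\<lambda>x. F.\<psi> (z x)) y v) x =
        (\<lambda>u. \<chi> i. Complex (- e i / 2 * w x (Y' i x) (G x u v)) (1 / 2 * w x (Y i x) (G x u v)))"
      unfolding \<Theta>'[unfolded re] by (intro fd_eq) (simp add: \<Theta>' re)
    then show ?thesis by (simp add: \<Theta>'[OF x] re)
  qed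
  have 2: "w x u v = sympl (fd (\<lambda>x. F.\<psi> (z x)) x u) (fd (\<lambda>x. F.\<psi> (z x)) x v)" if x: "x \<in> N" for x u v
    by (simp add: symplectic_coords[OF NB[OF x], of u v] sympl_def \<Theta>'[OF x])
  \<comment> \<open>A vector killed by the derivative of \<open>\<psi>\<close> pulls back to one in
    the radical of \<open>w\<close>, by the expression of \<open>w\<close> through
    \<open>sympl\<close> just obtained.\<close>
  have nd: "nondegenerate_fun F U"
    unfolding F.nondegenerate_fun_iff
  proof (intro ballI allI impI)
    fix y u assume y: "y \<in> U" and u: "fd F.\<psi> y u = 0"
    define x where "x = g y"
    have x: "x \<in> N" "z x = y" using gN[OF y] by (auto simp: x_def)
    have "fd (\<lambda>x. F.\<psi> (z x)) x (g' y u) = fd F.\<psi> y (dz' x (g' y u))"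
      using fd_compose[OF dz[OF NB[OF x(1)]], of F.\<psi>] smooth_on_has_derivative[OF F.\<psi>_smooth y] x(2) by simp
    also have "\<dots> = 0" using u g'(1)[OF y] by (simp add: x_def)
    finally have "w x (g' y u) v = 0" for v
      using 2[OF x(1), of "g' y u" v] by (simp add: sympl_def)
    then have "g' y u = 0" using herm_form.w_nondeg[OF w_herm[OF inV[OF NB[OF x(1)]]]] by blast
    then show "u = 0"
      using g'(1)[OF y, of u] linear_0[OF has_derivative_linear[OF dz[OF NB[OF x(1)]]]] by (simp add: x_def)
  qed
  have "conic_fun F U"
  proof (rule euler_imp_conic[OF N(4) holo_F])
    fix y assume y: "y \<in> U"
    show "fd F y y = 2 * F y"
      using fd_eq[OF F'[OF y]] gN(2)[OF y] by (simp add: F_def \<Phi>_def)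
  qed
  moreover have "special_coords G w N U z g F"
    by (rule special_coords.intro[OF N(1,4,5) holo_z holo_g holo_F nd 1 2])
  ultimately show thesis using that[OF N(2,3)] by blast
qed

end

end

theorem conic_normal_form:
  assumes "q \<in> V"
  obtains N U z g F where "N \<subseteq> V" "q \<in> N" "special_coords G w N U z g F" "conic_fun F U"
proof (rule parallel_sections[OF assms])
  fix r :: real assume r: "r > 0" "ball q r \<subseteq> V"
    and ex: "\<And>a. \<exists>Y. Y q = a \<and> (\<forall>x\<in>ball q r. (Y has_derivative (\<lambda>u. - G x u (Y x))) (at x))"
  have "\<exists>Y. Y q = a \<and> par q r Y" for a
    using ex[of a] unfolding par_def[OF r] .
  then obtain Yf where "\<forall>a. Yf a q = a \<and> par q r (Yf a)"
    using choice[of "\<lambda>a Y. Y q = a \<and> par q r Y"] by blast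
  then have Yf: "\<And>a. Yf a q = a" "\<And>a. par q r (Yf a)" by auto
  show thesis
  proof (rule herm_form.lagrangian_frame[OF w_herm[OF assms]])
    fix v :: "'n \<Rightarrow> complex^'n" and e :: "'n \<Rightarrow> real"
    assume v: "\<And>i. e i * e i = 1" "\<And>i j. w q (v i) (v j) = 0"
      "\<And>i j. w q (v i) (J (v j)) = (if i = j then 2 * e i else 0)"
      "\<And>u. (\<And>i. w q (v i) u = 0) \<Longrightarrow> (\<And>i. w q (J (v i)) u = 0) \<Longrightarrow> u = 0"
    show thesis
    proof (rule normal_form[OF r, of "\<lambda>i. Yf (v i)" "\<lambda>i. Yf (J (v i))" v e, OF Yf(2) Yf(2) Yf(1) Yf(1) v(1-3)])
      show "u = 0" if "\<And>i. w q (v i) u = 0" "\<And>i. w q (J (v i)) u = 0" for u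
        by (rule v(4)[OF that])
    qed (use that r(2) in blast)
  qed
qed

end

section \<open>Conic Kaehler manifolds in charts\<close>

locale cmanifold =
  fixes X :: "'a topology" and A :: "('a, 'n::finite) chart set"
  assumes complex_manifold: "complex_manifold X A"
begin

lemma chart:
  assumes "\<kappa> \<in> A"
  shows "openin X (fst \<kappa>)" "open (snd \<kappa> ` fst \<kappa>)" "fst \<kappa> \<subseteq> topspace X"
    "homeomorphic_map (subtopology X (fst \<kappa>)) (top_of_set (snd \<kappa> ` fst \<kappa>)) (snd \<kappa>)"
  using complex_manifold assms openin_subset by (auto simp: complex_manifold_def)

lemma inj_chart: "\<kappa> \<in> A \<Longrightarrow> inj_on (snd \<kappa>) (fst \<kappa>)"
  using homeomorphic_imp_injective_map[OF chart(4)] chart(3) by (simp add: Int_absorb1 topspace_subtopology)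

lemma chart_inv [simp]:
  "\<kappa> \<in> A \<Longrightarrow> p \<in> fst \<kappa> \<Longrightarrow> chart_inv \<kappa> (snd \<kappa> p) = p"
  "x \<in> snd \<kappa> ` fst \<kappa> \<Longrightarrow> snd \<kappa> (chart_inv \<kappa> x) = x"
  "x \<in> snd \<kappa> ` fst \<kappa> \<Longrightarrow> chart_inv \<kappa> x \<in> fst \<kappa>"
  by (auto simp: chart_inv_def inv_into_f_f[OF inj_chart] f_inv_into_f inv_into_into)

lemma open_image:
  assumes "\<kappa> \<in> A" "openin X S"
  shows "open (snd \<kappa> ` (fst \<kappa> \<inter> S))"
proof -
  have "openin (subtopology X (fst \<kappa>)) (fst \<kappa> \<inter> S)"
    using assms(2) by (auto simp: openin_subtopology)
  then have "openin (top_of_set (snd \<kappa> ` fst \<kappa>)) (snd \<kappa> ` (fst \<kappa> \<inter> S))"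
    using homeomorphic_imp_open_map[OF chart(4)[OF assms(1)]] by (simp add: open_map_def)
  then show ?thesis using chart(2)[OF assms(1)] openin_open_trans by blast
qed

lemma openin_preimage:
  assumes "\<kappa> \<in> A" "open T"
  shows "openin X {p \<in> fst \<kappa>. snd \<kappa> p \<in> T}"
proof -
  have "continuous_map (subtopology X (fst \<kappa>)) (top_of_set (snd \<kappa> ` fst \<kappa>)) (snd \<kappa>)"
    by (rule homeomorphic_imp_continuous_map[OF chart(4)[OF assms(1)]])
  then have "openin (subtopology X (fst \<kappa>)) {p \<in> topspace (subtopology X (fst \<kappa>)). snd \<kappa> p \<in> snd \<kappa> ` fst \<kappa> \<inter> T}"
    by (rule openin_continuous_map_preimage) (use assms(2) in \<open>auto simp: openin_open\<close>)
  moreover have "{p \<in> topspace (subtopology X (fst \<kappa>)). snd \<kappa> p \<in> snd \<kappa> ` fst \<kappa> \<inter> T} = {p \<in> fst \<kappa>. snd \<kappa> p \<in> T}"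
    using chart(3)[OF assms(1)] by (auto simp: topspace_subtopology)
  ultimately show ?thesis using chart(1)[OF assms(1)] openin_trans_full by metis
qed

definition transition where "transition \<kappa> \<kappa>' x = snd \<kappa>' (chart_inv \<kappa> x)"

lemma transition_holo:
  assumes "\<kappa> \<in> A" "\<kappa>' \<in> A"
  shows "holo_on J J (transition \<kappa> \<kappa>') (snd \<kappa> ` (fst \<kappa> \<inter> fst \<kappa>'))"
  using complex_manifold assms by (simp add: complex_manifold_def transition_def[abs_def] o_def)

lemma open_overlap: "\<kappa> \<in> A \<Longrightarrow> \<kappa>' \<in> A \<Longrightarrow> open (snd \<kappa> ` (fst \<kappa> \<inter> fst \<kappa>'))"
  by (rule open_image[OF _ chart(1)])

lemma transition_smooth:
  assumes "\<kappa> \<in> A" "\<kappa>' \<in> A"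
  shows "smooth_on (transition \<kappa> \<kappa>') (snd \<kappa> ` (fst \<kappa> \<inter> fst \<kappa>'))"
  by (rule Jc.holo_on_vec_imp_smooth[OF open_overlap[OF assms] transition_holo[OF assms]])

lemma pd_pd:
  assumes "\<kappa> \<in> A" "p \<in> fst \<kappa>"
  shows "pd \<kappa> (\<lambda>q. pd \<kappa> f q v) p u = fd (\<lambda>y. fd (\<lambda>x. f (chart_inv \<kappa> x)) y v) (snd \<kappa> p) u"
proof -
  have "fd ((\<lambda>q. pd \<kappa> f q v) \<circ> chart_inv \<kappa>) (snd \<kappa> p) = fd (\<lambda>y. fd (\<lambda>x. f (chart_inv \<kappa> x)) y v) (snd \<kappa> p)"
    by (rule fd_cong[OF chart(2)[OF assms(1)]]) (use assms in \<open>auto simp: pd_def o_def\<close>)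
  then show ?thesis by (simp add: pd_def)
qed

lemma conn_related_iff:
  assumes "\<kappa> \<in> A" "p \<in> fst \<kappa>"
  shows "conn_related \<kappa> \<kappa>' f G G' p \<longleftrightarrow> (\<forall>u v.
    G' (f p) (fd (\<lambda>x. snd \<kappa>' (f (chart_inv \<kappa> x))) (snd \<kappa> p) u) (fd (\<lambda>x. snd \<kappa>' (f (chart_inv \<kappa> x))) (snd \<kappa> p) v) =
    fd (\<lambda>x. snd \<kappa>' (f (chart_inv \<kappa> x))) (snd \<kappa> p) (G p u v) -
    fd (\<lambda>y. fd (\<lambda>x. snd \<kappa>' (f (chart_inv \<kappa> x))) y v) (snd \<kappa> p) u)"
  unfolding conn_related_def pd_pd[OF assms] by (simp add: pd_def o_def)

end

locale conic_Kaehler = 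
  fixes X :: "'a topology" and A :: "('a, 'n::finite) chart set" and \<Gamma> \<omega>
  assumes Kaehler: "conic_Kaehler_manifold X A \<Gamma> \<omega>"

sublocale conic_Kaehler \<subseteq> cmanifold
  using Kaehler by unfold_locales (simp add: conic_Kaehler_manifold_def conic_complex_manifold_def)

context conic_Kaehler begin

lemma connection: "connection A \<Gamma>" and flat: "flat A \<Gamma>" and torsionfree: "torsionfree A \<Gamma>"
  and sympl_form: "symplectic_form A \<omega>" and par_form: "parallel_form A \<Gamma> \<omega>" and J_inv: "J_invariant A \<omega>"
  using Kaehler by (auto simp: conic_Kaehler_manifold_def conic_complex_manifold_def flat_torsionfree_connection_def)

lemma conn_trans:
  assumes "\<kappa> \<in> A" "\<kappa>' \<in> A" "p \<in> fst \<kappa>" "p \<in> fst \<kappa>'"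
  shows "\<Gamma> \<kappa>' p (fd (transition \<kappa> \<kappa>') (snd \<kappa> p) u) (fd (transition \<kappa> \<kappa>') (snd \<kappa> p) v) =
    fd (transition \<kappa> \<kappa>') (snd \<kappa> p) (\<Gamma> \<kappa> p u v) - fd (\<lambda>y. fd (transition \<kappa> \<kappa>') y v) (snd \<kappa> p) u"
proof -
  have "conn_related \<kappa> \<kappa>' id (\<Gamma> \<kappa>) (\<Gamma> \<kappa>') p" using connection assms by (simp add: connection_def)
  then show ?thesis unfolding conn_related_iff[OF assms(1,3)] by (simp add: transition_def[abs_def])
qed

lemma form_trans:
  assumes "\<kappa> \<in> A" "\<kappa>' \<in> A" "p \<in> fst \<kappa>" "p \<in> fst \<kappa>'"
  shows "\<omega> \<kappa>' p (fd (transition \<kappa> \<kappa>') (snd \<kappa> p) u) (fd (transition \<kappa> \<kappa>') (snd \<kappa> p) v) = \<omega> \<kappa> p u v"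
  using sympl_form assms by (simp add: symplectic_form_def form_related_def pd_def transition_def[abs_def] o_def)

context
  fixes \<kappa>0 assumes \<kappa>0: "\<kappa>0 \<in> A"
begin

abbreviation "D \<equiv> fst \<kappa>0"
abbreviation "h \<equiv> snd \<kappa>0"
abbreviation "k \<equiv> chart_inv \<kappa>0"
abbreviation "V \<equiv> h ` D"
definition "G x u v = \<Gamma> \<kappa>0 (k x) u v"
definition "w x u v = \<omega> \<kappa>0 (k x) u v"

lemma openV: "open V" by (rule chart(2)[OF \<kappa>0])

lemma kV [simp]: "x \<in> V \<Longrightarrow> k x \<in> D" "x \<in> V \<Longrightarrow> h (k x) = x" "p \<in> D \<Longrightarrow> k (h p) = p"
  using \<kappa>0 by simp_all

lemma G_flat_conn: "flat_conn V G"
proof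
  show "open V" by (rule openV)
  show "bilinear (G x)" if "x \<in> V" for x
    using connection \<kappa>0 kV(1)[OF that] unfolding connection_def G_def by (simp add: eta_contract_eq)
  show "smooth_on (\<lambda>x. G x u v) V" for u v
    using connection \<kappa>0 by (auto simp: connection_def smooth_in_chart_def G_def o_def)
  fix x u v c assume x: "x \<in> V"
  have cd: "cov_deriv \<Gamma> \<kappa>0 (\<lambda>_. c) q v = \<Gamma> \<kappa>0 q v c" for q v c
    by (simp add: cov_deriv_def pd_def o_def frechet_derivative_const)
  have "cov_deriv \<Gamma> \<kappa>0 (\<lambda>q. \<Gamma> \<kappa>0 q v c) (k x) u = fd (\<lambda>y. G y v c) x u + G x u (G x v c)" for u v
    using x by (simp add: cov_deriv_def pd_def o_def G_def)
  moreover have "cov_deriv \<Gamma> \<kappa>0 (\<lambda>q. cov_deriv \<Gamma> \<kappa>0 (\<lambda>_. c) q v) (k x) u -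
      cov_deriv \<Gamma> \<kappa>0 (\<lambda>q. cov_deriv \<Gamma> \<kappa>0 (\<lambda>_. c) q u) (k x) v = 0"
    using flat \<kappa>0 kV(1)[OF x] unfolding flat_def by blast
  ultimately show "fd (\<lambda>y. G y v c) x u + G x u (G x v c) = fd (\<lambda>y. G y u c) x v + G x v (G x u c)"
    by (simp add: cd)
qed

interpretation fc: flat_conn V G by (rule G_flat_conn)

lemma w_herm: "x \<in> V \<Longrightarrow> herm_form (w x)"
proof
  assume x: "x \<in> V"
  have s: "bilinear (\<omega> \<kappa>0 (k x)) \<and> (\<forall>u. \<omega> \<kappa>0 (k x) u u = 0) \<and> (\<forall>u. (\<forall>v. \<omega> \<kappa>0 (k x) u v = 0) \<longrightarrow> u = 0)"
    using sympl_form \<kappa>0 kV(1)[OF x] unfolding symplectic_form_def by blast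
  have wx: "w x = \<omega> \<kappa>0 (k x)" by (simp add: w_def fun_eq_iff)
  show "bilinear (w x)" "w x u u = 0" for u using s by (simp_all add: wx)
  show "u = 0" if "\<And>v. w x u v = 0" for u using s that by (simp add: wx)
  show "w x (J u) (J v) = w x u v" for u v
    using J_inv \<kappa>0 kV(1)[OF x] by (simp add: J_invariant_def wx)
qed

lemma w_smooth: "smooth_on (\<lambda>x. w x u v) V"
  using sympl_form \<kappa>0 by (auto simp: symplectic_form_def smooth_in_chart_def w_def o_def)

lemma w_par: "x \<in> V \<Longrightarrow> fd (\<lambda>x. w x v v') x u = w x (G x u v) v' + w x v (G x u v')"
proof -
  assume x: "x \<in> V"
  have "pd \<kappa>0 (\<lambda>q. \<omega> \<kappa>0 q v v') (k x) u - \<omega> \<kappa>0 (k x) (\<Gamma> \<kappa>0 (k x) u v) v' - \<omega> \<kappa>0 (k x) v (\<Gamma> \<kappa>0 (k x) u v') = 0"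
    using par_form \<kappa>0 kV(1)[OF x] unfolding parallel_form_def by blast
  then show ?thesis using x by (simp add: pd_def o_def w_def G_def)
qed

text \<open>A parallel field needs components in every chart of the atlas, so \<open>Y\<close> is
  carried over by the coordinate changes. It stays parallel because the inhomogeneous term in
  \<open>conn_trans\<close> cancels the derivative of the Jacobian.\<close>

lemma parallel_vector_field:
  assumes T: "open T" "T \<subseteq> V" and Y: "\<And>x. x \<in> T \<Longrightarrow> (Y has_derivative (\<lambda>u. - G x u (Y x))) (at x)"
  shows "parallel_vector_field A \<Gamma> {p \<in> D. h p \<in> T} (\<lambda>\<kappa> p. pd \<kappa>0 (snd \<kappa>) p (Y (h p)))"
proof -
  define S where "S = {p \<in> D. h p \<in> T}"
  have S: "openin X S" unfolding S_def by (rule openin_preimage[OF \<kappa>0 T(1)])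
  have Ys: "smooth_on Y T" by (rule fc.parallel_smooth[OF T Y])
  have field: "pd \<kappa>0 (snd \<kappa>) p (Y (h p)) = fd (transition \<kappa>0 \<kappa>) (h p) (Y (h p))" for \<kappa> p
    by (simp add: pd_def transition_def[abs_def] o_def)
  have loc: "smooth_on (\<lambda>x. fd (transition \<kappa>0 \<kappa>) (transition \<kappa> \<kappa>0 x) (Y (transition \<kappa> \<kappa>0 x))) (snd \<kappa> ` (fst \<kappa> \<inter> S))
      \<and> (\<forall>x\<in>snd \<kappa> ` (fst \<kappa> \<inter> S). \<forall>u.
         fd (\<lambda>x. fd (transition \<kappa>0 \<kappa>) (transition \<kappa> \<kappa>0 x) (Y (transition \<kappa> \<kappa>0 x))) x u =
         - \<Gamma> \<kappa> (chart_inv \<kappa> x) u (fd (transition \<kappa>0 \<kappa>) (transition \<kappa> \<kappa>0 x) (Y (transition \<kappa> \<kappa>0 x))))"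
    if \<kappa>: "\<kappa> \<in> A" for \<kappa>
  proof -
    define R where "R = snd \<kappa> ` (fst \<kappa> \<inter> S)"
    define \<tau> \<sigma> where "\<tau> = transition \<kappa> \<kappa>0" and "\<sigma> = transition \<kappa>0 \<kappa>"
    have R: "open R" unfolding R_def by (rule open_image[OF \<kappa> S])
    have Rsub: "R \<subseteq> snd \<kappa> ` (fst \<kappa> \<inter> D)" by (auto simp: R_def S_def)
    have \<tau>s: "smooth_on \<tau> R" unfolding \<tau>_def by (rule smooth_on_subset[OF transition_smooth[OF \<kappa> \<kappa>0] Rsub])
    have \<sigma>s: "smooth_on \<sigma> (h ` (D \<inter> fst \<kappa>))" unfolding \<sigma>_def by (rule transition_smooth[OF \<kappa>0 \<kappa>])
    have \<tau>T: "\<tau> x \<in> T" "\<tau> x \<in> h ` (D \<inter> fst \<kappa>)" "\<tau> x \<in> V" "\<sigma> (\<tau> x) = x" "k (\<tau> x) = chart_inv \<kappa> x" if "x \<in> R" for x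
      using that \<kappa> by (auto simp: R_def S_def \<tau>_def \<sigma>_def transition_def)
    have lin: "linear (fd \<sigma> (\<tau> x))" if "x \<in> R" for x
      by (rule has_derivative_linear[OF smooth_on_has_derivative[OF \<sigma>s \<tau>T(2)[OF that]]])
    have "smooth_on (\<lambda>x. fd \<sigma> (\<tau> x) (Y (\<tau> x))) R"
    proof (rule smooth_on_apply[where A="\<lambda>x. fd \<sigma> (\<tau> x)" and b="\<lambda>x. Y (\<tau> x)", OF R lin])
      show "smooth_on (\<lambda>x. fd \<sigma> (\<tau> x) c) R" for c
        by (rule smooth_on_compose[OF R \<tau>s smooth_on_fd[OF \<sigma>s]]) (use \<tau>T in auto)
      show "smooth_on (\<lambda>x. Y (\<tau> x)) R"
        by (rule smooth_on_compose[OF R \<tau>s Ys]) (use \<tau>T in auto)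
    qed
    moreover have "fd (\<lambda>x. fd \<sigma> (\<tau> x) (Y (\<tau> x))) x u = - \<Gamma> \<kappa> (chart_inv \<kappa> x) u (fd \<sigma> (\<tau> x) (Y (\<tau> x)))"
      if x: "x \<in> R" for x u
    proof -
      note \<tau>' = smooth_on_has_derivative[OF \<tau>s x]
      define u0 where "u0 = fd \<tau> x u"
      have "((\<lambda>x. Y (\<tau> x)) has_derivative (\<lambda>u. - G (\<tau> x) (fd \<tau> x u) (Y (\<tau> x)))) (at x)"
        by (rule has_derivative_compose[OF \<tau>' Y[OF \<tau>T(1)[OF x]]])
      moreover have "((\<lambda>x. fd \<sigma> (\<tau> x) c) has_derivative (\<lambda>u. fd (\<lambda>y. fd \<sigma> y c) (\<tau> x) (fd \<tau> x u))) (at x)" for c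
        by (rule has_derivative_compose[OF \<tau>' smooth_on_has_derivative[OF smooth_on_fd[OF \<sigma>s] \<tau>T(2)[OF x]]])
      ultimately have "fd (\<lambda>x. fd \<sigma> (\<tau> x) (Y (\<tau> x))) x =
          (\<lambda>u. fd (\<lambda>y. fd \<sigma> y (Y (\<tau> x))) (\<tau> x) (fd \<tau> x u) + fd \<sigma> (\<tau> x) (- G (\<tau> x) (fd \<tau> x u) (Y (\<tau> x))))"
        by (intro fd_eq has_derivative_apply[where A="\<lambda>x. fd \<sigma> (\<tau> x)" and b="\<lambda>x. Y (\<tau> x)", OF R x lin])
      then have "fd (\<lambda>x. fd \<sigma> (\<tau> x) (Y (\<tau> x))) x u = fd (\<lambda>y. fd \<sigma> y (Y (\<tau> x))) (\<tau> x) u0 - fd \<sigma> (\<tau> x) (G (\<tau> x) u0 (Y (\<tau> x)))"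
        by (simp add: u0_def linear_neg[OF lin[OF x]])
      moreover have "fd \<sigma> (\<tau> x) u0 = u"
      proof -
        have "((\<lambda>x. \<sigma> (\<tau> x)) has_derivative (\<lambda>u. fd \<sigma> (\<tau> x) (fd \<tau> x u))) (at x)"
          by (rule has_derivative_compose[OF \<tau>' smooth_on_has_derivative[OF \<sigma>s \<tau>T(2)[OF x]]])
        from has_derivative_transform_within_open[OF this R x \<tau>T(4)]
        have "(\<lambda>u. fd \<sigma> (\<tau> x) (fd \<tau> x u)) = (\<lambda>u. u)" using has_derivative_ident has_derivative_unique by blast
        then show ?thesis by (simp add: u0_def fun_eq_iff)
      qed
      moreover have "\<Gamma> \<kappa> (k (\<tau> x)) (fd \<sigma> (\<tau> x) u0) (fd \<sigma> (\<tau> x) (Y (\<tau> x))) =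
          fd \<sigma> (\<tau> x) (G (\<tau> x) u0 (Y (\<tau> x))) - fd (\<lambda>y. fd \<sigma> y (Y (\<tau> x))) (\<tau> x) u0"
        using conn_trans[OF \<kappa>0 \<kappa>, of "k (\<tau> x)" u0 "Y (\<tau> x)"] \<tau>T(2,3)[OF x] by (auto simp: \<sigma>_def G_def)
      ultimately show ?thesis by (simp add: \<tau>T(5)[OF x])
    qed
    ultimately show ?thesis unfolding R_def \<tau>_def \<sigma>_def by blast
  qed
  have comp: "(\<lambda>p. pd \<kappa>0 (snd \<kappa>) p (Y (h p))) \<circ> chart_inv \<kappa> =
      (\<lambda>x. fd (transition \<kappa>0 \<kappa>) (transition \<kappa> \<kappa>0 x) (Y (transition \<kappa> \<kappa>0 x)))" for \<kappa>
    by (simp add: fun_eq_iff field transition_def)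
  have "vector_field A S (\<lambda>\<kappa> p. pd \<kappa>0 (snd \<kappa>) p (Y (h p)))"
    unfolding vector_field_def smooth_in_chart_def comp
  proof (intro conjI ballI)
    show "smooth_on (\<lambda>x. fd (transition \<kappa>0 \<kappa>) (transition \<kappa> \<kappa>0 x) (Y (transition \<kappa> \<kappa>0 x))) (snd \<kappa> ` (fst \<kappa> \<inter> S))" if "\<kappa> \<in> A" for \<kappa>
      using loc[OF that] by blast
    fix \<kappa> \<kappa>' p assume \<kappa>: "\<kappa> \<in> A" "\<kappa>' \<in> A" and p: "p \<in> fst \<kappa> \<inter> fst \<kappa>' \<inter> S"
    then have pD: "p \<in> D" by (simp add: S_def)
    let ?R = "h ` (D \<inter> (fst \<kappa> \<inter> fst \<kappa>'))"
    have R: "open ?R" "h p \<in> ?R" using open_image[OF \<kappa>0 openin_Int[OF chart(1)[OF \<kappa>(1)] chart(1)[OF \<kappa>(2)]]] pD p by auto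
    have t: "transition \<kappa>0 \<kappa> (h p) = snd \<kappa> p" using pD by (simp add: transition_def)
    have "(transition \<kappa>0 \<kappa> has_derivative fd (transition \<kappa>0 \<kappa>) (h p)) (at (h p))"
      by (rule smooth_on_has_derivative[OF transition_smooth[OF \<kappa>0 \<kappa>(1)]]) (use p pD in blast)
    moreover have "(transition \<kappa> \<kappa>' has_derivative fd (transition \<kappa> \<kappa>') (snd \<kappa> p)) (at (transition \<kappa>0 \<kappa> (h p)))"
      unfolding t by (rule smooth_on_has_derivative[OF transition_smooth[OF \<kappa>]]) (use p in blast)
    ultimately have "((\<lambda>x. transition \<kappa> \<kappa>' (transition \<kappa>0 \<kappa> x)) has_derivative
        (\<lambda>u. fd (transition \<kappa> \<kappa>') (snd \<kappa> p) (fd (transition \<kappa>0 \<kappa>) (h p) u))) (at (h p))"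
      by (rule has_derivative_compose)
    moreover have "transition \<kappa> \<kappa>' (transition \<kappa>0 \<kappa> x) = transition \<kappa>0 \<kappa>' x" if "x \<in> ?R" for x
      using that \<kappa> by (auto simp: transition_def)
    ultimately have "(transition \<kappa>0 \<kappa>' has_derivative (\<lambda>u. fd (transition \<kappa> \<kappa>') (snd \<kappa> p) (fd (transition \<kappa>0 \<kappa>) (h p) u))) (at (h p))"
      using has_derivative_transform_within_open R by blast
    then show "pd \<kappa>0 (snd \<kappa>') p (Y (h p)) = pd \<kappa> (snd \<kappa>') p (pd \<kappa>0 (snd \<kappa>) p (Y (h p)))"
      unfolding field by (simp add: fd_eq pd_def o_def transition_def[abs_def])
  qed
  moreover have "cov_deriv \<Gamma> \<kappa> (\<lambda>p. pd \<kappa>0 (snd \<kappa>) p (Y (h p))) p u = 0"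
    if \<kappa>: "\<kappa> \<in> A" and p: "p \<in> fst \<kappa> \<inter> S" for \<kappa> p u
  proof -
    have "transition \<kappa> \<kappa>0 (snd \<kappa> p) = h p" "chart_inv \<kappa> (snd \<kappa> p) = p" using \<kappa> p by (simp_all add: transition_def)
    moreover have "fd (\<lambda>x. fd (transition \<kappa>0 \<kappa>) (transition \<kappa> \<kappa>0 x) (Y (transition \<kappa> \<kappa>0 x))) (snd \<kappa> p) u =
         - \<Gamma> \<kappa> (chart_inv \<kappa> (snd \<kappa> p)) u (fd (transition \<kappa>0 \<kappa>) (transition \<kappa> \<kappa>0 (snd \<kappa> p)) (Y (transition \<kappa> \<kappa>0 (snd \<kappa> p))))"
      using loc[OF \<kappa>] p by blast
    ultimately show ?thesis
      unfolding cov_deriv_def pd_def[of \<kappa>] comp by (simp add: field)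
  qed
  ultimately show ?thesis
    unfolding parallel_vector_field_def S_def[symmetric] by blast
qed

text \<open>The equation of the action is differentiated in \<open>l\<close> at 1. Its left-hand
  side becomes a mixed second derivative, which by symmetry is the derivative of \<xi> in the
  direction Y; on the right Y is differentiated along the orbit, where the parallel equation yields
  the \<open>G\<close> term.\<close>

lemma conic_vector_field:
  obtains \<xi> where "holo_on J J \<xi> V" and
    "\<And>q r Y x. ball q r \<subseteq> V \<Longrightarrow> (\<And>x. x \<in> ball q r \<Longrightarrow> (Y has_derivative (\<lambda>u. - G x u (Y x))) (at x)) \<Longrightarrow>
      x \<in> ball q r \<Longrightarrow> fd \<xi> x (Y x) + G x (\<xi> x) (Y x) = Y x \<and>
        J (fd \<xi> x (Y x)) + G x (J (\<xi> x)) (Y x) = J (Y x)"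
proof -
  obtain W \<phi> where act: "local_action X A W \<phi>" and conic: "conic_action X A \<Gamma> W \<phi>"
    using Kaehler unfolding conic_Kaehler_manifold_def conic_complex_manifold_def by blast
  \<comment> \<open>The action read in the chart, holomorphic in \<open>l\<close> and
    \<open>x\<close> jointly on the set \<open>\<Omega>\<close>; once \<open>\<Omega>\<close> is
    known to be open, this makes it smooth in both variables together.\<close>
  define \<Phi> where "\<Phi> = (\<lambda>(l, x). h (\<phi> l (k x)))"
  define \<Omega> where "\<Omega> = {(l, h p) | l p. (l, p) \<in> W \<and> p \<in> D \<and> \<phi> l p \<in> D}"
  have holo\<Phi>: "holo_on (map_prod J1 J) J \<Phi> \<Omega>"
    using act \<kappa>0 unfolding local_action_def \<Phi>_def \<Omega>_def by blast
  let ?P = "prod_topology (top_of_set (- {0 :: complex})) X"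
  define W' where "W' = {lp \<in> W. snd lp \<in> D \<and> \<phi> (fst lp) (snd lp) \<in> D}"
  have W: "openin ?P W" and cont: "continuous_map (subtopology ?P W) X (\<lambda>(l, p). \<phi> l p)"
    using act by (auto simp: local_action_def)
  have "openin ?P W'"
  proof -
    have Wt: "W \<subseteq> topspace ?P" using W by (rule openin_subset)
    have "openin (subtopology ?P W) {lp \<in> topspace (subtopology ?P W). (\<lambda>(l, p). \<phi> l p) lp \<in> D}"
      by (rule openin_continuous_map_preimage[OF cont chart(1)[OF \<kappa>0]])
    then have 1: "openin ?P {lp \<in> topspace (subtopology ?P W). (\<lambda>(l, p). \<phi> l p) lp \<in> D}"
      using W openin_trans_full by blast
    have 2: "openin ?P ((- {0}) \<times> D)"
      using chart(1)[OF \<kappa>0] by (subst openin_prod_Times_iff) auto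
    have "W' = {lp \<in> topspace (subtopology ?P W). (\<lambda>(l, p). \<phi> l p) lp \<in> D} \<inter> ((- {0}) \<times> D)"
      using Wt by (auto simp: W'_def topspace_subtopology)
    then show ?thesis using openin_Int[OF 1 2] by simp
  qed
  have open\<Omega>: "open \<Omega>"
    unfolding open_prod_def
  proof
    fix lx assume "lx \<in> \<Omega>"
    then obtain l p where lp: "lx = (l, h p)" "(l, p) \<in> W'" "p \<in> D" by (auto simp: \<Omega>_def W'_def)
    then obtain U1 V1 where UV: "openin (top_of_set (- {0})) U1" "openin X V1" "l \<in> U1" "p \<in> V1" "U1 \<times> V1 \<subseteq> W'"
      using \<open>openin ?P W'\<close> unfolding openin_prod_topology_alt by meson
    have "open U1" by (rule openin_open_trans[OF UV(1)]) auto
    moreover have "open (h ` (D \<inter> V1))" by (rule open_image[OF \<kappa>0 UV(2)])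
    moreover have "U1 \<times> h ` (D \<inter> V1) \<subseteq> \<Omega>" using UV(5) by (fastforce simp: \<Omega>_def W'_def)
    ultimately show "\<exists>S T. open S \<and> open T \<and> lx \<in> S \<times> T \<and> S \<times> T \<subseteq> \<Omega>"
      using lp UV by blast
  qed
  have \<phi>1: "\<phi> 1 p = p" if "p \<in> D" for p
    using act chart(3)[OF \<kappa>0] that by (auto simp: local_action_def)
  have one: "(1, x) \<in> \<Omega>" "\<Phi> (1, x) = x" if "x \<in> V" for x
  proof -
    have "(1, k x) \<in> W" using act chart(3)[OF \<kappa>0] kV(1)[OF that] by (auto simp: local_action_def)
    then have "(1, h (k x)) \<in> \<Omega>" using \<phi>1[OF kV(1)[OF that]] kV(1)[OF that] unfolding \<Omega>_def by fastforce
    then show "(1, x) \<in> \<Omega>" "\<Phi> (1, x) = x" using that by (auto simp: \<Phi>_def \<phi>1)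
  qed
  have \<Phi>s: "smooth_on \<Phi> \<Omega>" by (rule Jp.holo_on_vec_imp_smooth[OF open\<Omega> holo\<Phi>])
  note \<Phi>' = smooth_on_has_derivative[OF \<Phi>s]
  note holo\<Phi>' = Jp.holo_on_vec_fd[OF open\<Omega> holo\<Phi>]
  \<comment> \<open>The velocity of the orbits at \<open>l = 1\<close> in the direction 1; the
    direction \<i> gives \<open>J (\<xi> x)\<close> by holomorphy.\<close>
  define \<xi> where "\<xi> = (\<lambda>x. fd \<Phi> (1, x) (1, 0))"
  have emb: "holo_on J (map_prod J1 J) (\<lambda>x. (1, x)) V"
    by (rule holo_onI[where f'="\<lambda>x v. (0, v)"]) (auto simp: J1_def intro!: derivative_eq_intros)
  have \<xi>_holo: "holo_on J J \<xi> V"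
    unfolding \<xi>_def by (rule holo_on_compose[OF emb holo\<Phi>']) (use one in auto)
  have \<xi>': "fd \<xi> x v = fd (\<lambda>y. fd \<Phi> y (1, 0)) (1, x) (0, v)" if "x \<in> V" for x v
  proof -
    have "((\<lambda>x. (1::complex, x)) has_derivative (\<lambda>v. (0, v))) (at x)" by (auto intro!: derivative_eq_intros)
    from fd_eq[OF has_derivative_compose[OF this smooth_on_has_derivative[OF smooth_on_fd[OF \<Phi>s] one(1)[OF that]]]]
    show ?thesis unfolding \<xi>_def by simp
  qed
  show thesis
  proof (rule that[OF \<xi>_holo])
    fix q r Y x
    assume B: "ball q r \<subseteq> V" and Y: "\<And>x. x \<in> ball q r \<Longrightarrow> (Y has_derivative (\<lambda>u. - G x u (Y x))) (at x)"
      and x: "x \<in> ball q r"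
    have xV: "x \<in> V" using x B by auto
    define S where "S = {p \<in> D. h p \<in> ball q r}"
    define Yh :: "('a, 'n) vfield" where "Yh = (\<lambda>\<kappa> p. pd \<kappa>0 (snd \<kappa>) p (Y (h p)))"
    have S: "openin X S" unfolding S_def by (rule openin_preimage[OF \<kappa>0 open_ball])
    have par: "parallel_vector_field A \<Gamma> S Yh"
      unfolding S_def Yh_def by (rule parallel_vector_field[OF open_ball B Y])
    have Yh: "Yh \<kappa>0 p = Y (h p)" if "p \<in> D" for p
    proof -
      have "fd (h \<circ> k) (h p) = fd (\<lambda>x. x) (h p)"
        by (rule fd_cong[OF openV]) (use that in auto)
      also have "\<dots> = (\<lambda>v. v)" by (rule fd_eq) (rule has_derivative_ident)
      finally show ?thesis by (simp add: Yh_def pd_def)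
    qed
    \<comment> \<open>\<open>l\<close> is confined to a ball around 1 that keeps the orbit of
      \<open>x\<close> in the domain of \<open>Y\<close>. Being connected, this ball lies in the
      component of 1 to which \<open>conic_action\<close> applies.\<close>
    have "continuous_on \<Omega> \<Phi>" by (rule smooth_on_imp_continuous[OF \<Phi>s])
    then have "open (\<Omega> \<inter> \<Phi> -` ball q r)" by (intro continuous_open_preimage open\<Omega> open_ball)
    then have "open ((\<lambda>m. (m, x)) -` (\<Omega> \<inter> \<Phi> -` ball q r))"
      by (intro open_vimage continuous_intros)
    moreover have "1 \<in> (\<lambda>m. (m, x)) -` (\<Omega> \<inter> \<Phi> -` ball q r)" using one[OF xV] x by simp
    ultimately obtain d where d: "d > 0" "ball 1 d \<subseteq> (\<lambda>m. (m, x)) -` (\<Omega> \<inter> \<Phi> -` ball q r)"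
      using open_contains_ball by blast
    have in\<Omega>: "(m, x) \<in> \<Omega>" "\<Phi> (m, x) \<in> ball q r" "(m, k x) \<in> W" "\<phi> m (k x) \<in> S" "\<phi> m (k x) \<in> D" if "m \<in> ball 1 d" for m
    proof -
      show *: "(m, x) \<in> \<Omega>" "\<Phi> (m, x) \<in> ball q r" using d(2) that by auto
      show "(m, k x) \<in> W" "\<phi> m (k x) \<in> D" using *(1) by (auto simp: \<Omega>_def)
      then show "\<phi> m (k x) \<in> S" using *(2) by (simp add: S_def \<Phi>_def)
    qed
    have eq: "fd \<Phi> (l, x) (0, Y x) = l *s Y (\<Phi> (l, x))" if l: "l \<in> ball 1 d" for l
    proof -
      have kx: "k x \<in> S" using x xV by (simp add: S_def)
      have "ball 1 d \<subseteq> connected_component_set {m. (m, k x) \<in> W \<and> \<phi> m (k x) \<in> S} 1"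
        using in\<Omega> d(1) by (intro connected_component_maximal) auto
      then have "l \<in> connected_component_set {m. (m, k x) \<in> W \<and> \<phi> m (k x) \<in> S} 1" using l by blast
      then have "pd \<kappa>0 (h \<circ> \<phi> l) (k x) (Yh \<kappa>0 (k x)) =
            Re l *\<^sub>R Yh \<kappa>0 (\<phi> l (k x)) + Im l *\<^sub>R J (Yh \<kappa>0 (\<phi> l (k x)))"
        using conic S par kx \<kappa>0 kV(1)[OF xV] in\<Omega>(5)[OF l] unfolding conic_action_def by blast
      then have "fd (\<lambda>y. \<Phi> (l, y)) x (Y x) = l *s Y (\<Phi> (l, x))"
        using xV in\<Omega>(5)[OF l]
        by (simp add: Yh pd_def o_def \<Phi>_def cs_J[symmetric] Jc.cs_def)
      moreover have "fd (\<lambda>y. \<Phi> (l, y)) x (Y x) = fd \<Phi> (l, x) (0, Y x)"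
      proof -
        have "((\<lambda>y. (l, y)) has_derivative (\<lambda>v. (0, v))) (at x)" by (auto intro!: derivative_eq_intros)
        from fd_eq[OF has_derivative_compose[OF this \<Phi>'[OF in\<Omega>(1)[OF l]]]] show ?thesis by simp
      qed
      ultimately show ?thesis by simp
    qed
    have slice: "((\<lambda>l. (l, x)) has_derivative (\<lambda>c. (c, 0))) (at 1)" by (auto intro!: derivative_eq_intros)
    have "((\<lambda>l. fd \<Phi> (l, x) (0, Y x)) has_derivative (\<lambda>c. fd (\<lambda>y. fd \<Phi> y (0, Y x)) (1, x) (c, 0))) (at 1)"
      by (rule has_derivative_compose[OF slice smooth_on_has_derivative[OF smooth_on_fd[OF \<Phi>s] one(1)[OF xV]]])
    from has_derivative_transform_within_open[OF this open_ball _ eq, of 1 d, simplified, OF d(1)]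
    have L: "((\<lambda>l. l *s Y (\<Phi> (l, x))) has_derivative (\<lambda>c. fd (\<lambda>y. fd \<Phi> y (0, Y x)) (1, x) (c, 0))) (at 1)"
      by simp
    have "((\<lambda>l. \<Phi> (l, x)) has_derivative (\<lambda>c. fd \<Phi> (1, x) (c, 0))) (at 1)"
      by (rule has_derivative_compose[OF slice \<Phi>'[OF one(1)[OF xV]]])
    moreover have "(Y has_derivative (\<lambda>u. - G x u (Y x))) (at (\<Phi> (1, x)))" using Y[OF x] one[OF xV] by simp
    ultimately have "((\<lambda>l. Y (\<Phi> (l, x))) has_derivative (\<lambda>c. - G x (fd \<Phi> (1, x) (c, 0)) (Y x))) (at 1)"
      by (rule has_derivative_compose)
    from has_derivative_compose[OF has_derivative_Pair[OF has_derivative_ident this] smult_has_derivative[where l=1]]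
    have Rr: "((\<lambda>l. l *s Y (\<Phi> (l, x))) has_derivative (\<lambda>c. c *s Y x + 1 *s (- G x (fd \<Phi> (1, x) (c, 0)) (Y x)))) (at 1)"
      by (simp add: one[OF xV])
    have main: "fd (\<lambda>y. fd \<Phi> y (0, Y x)) (1, x) (c, 0) = c *s Y x - G x (fd \<Phi> (1, x) (c, 0)) (Y x)" for c
      using fun_cong[OF has_derivative_unique[OF L Rr], of c] by simp
    have sym: "fd (\<lambda>y. fd \<Phi> y (0, Y x)) (1, x) (1, 0) = fd \<xi> x (Y x)"
      using fd_fd_commute[OF open\<Omega> \<Phi>s one(1)[OF xV], of "(0, Y x)" "(1, 0)"] \<xi>'[OF xV] by simp
    have i: "map_prod J1 J (1, 0 :: complex^'n) = (\<i>, 0)" by (simp add: J1_def J_def)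
    have "fd \<xi> x (Y x) + G x (\<xi> x) (Y x) = Y x"
      using main[of 1] sym by (simp add: \<xi>_def)
    \<comment> \<open>Here the direction is \<i>: as \<open>(\<i>, 0)\<close> is the image of
      \<open>(1, 0)\<close> under the complex structure, each derivative in this direction is
      \<open>J\<close> of the one in direction 1.\<close>
    moreover have "J (fd \<xi> x (Y x)) + G x (J (\<xi> x)) (Y x) = J (Y x)"
      using main[of \<i>] holo_onE(2)[OF holo\<Phi>'[of "(0, Y x)"] one(1)[OF xV], of "(1, 0)"]
        holo_onE(2)[OF holo\<Phi> one(1)[OF xV], of "(1, 0)"] sym
      unfolding i by (simp add: \<xi>_def J_def)
    ultimately show "fd \<xi> x (Y x) + G x (\<xi> x) (Y x) = Y x \<and> J (fd \<xi> x (Y x)) + G x (J (\<xi> x)) (Y x) = J (Y x)"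
      by blast
  qed
qed

lemma conic_chart_exists: obtains \<xi> where "conic_chart V G w \<xi>"
proof (rule conic_vector_field)
  fix \<xi> assume 1: "holo_on J J \<xi> V" and 2: "\<And>q r Y x. ball q r \<subseteq> V \<Longrightarrow> (\<And>x. x \<in> ball q r \<Longrightarrow> (Y has_derivative (\<lambda>u. - G x u (Y x))) (at x)) \<Longrightarrow>
      x \<in> ball q r \<Longrightarrow> fd \<xi> x (Y x) + G x (\<xi> x) (Y x) = Y x \<and> J (fd \<xi> x (Y x)) + G x (J (\<xi> x)) (Y x) = J (Y x)"
  have "conic_chart V G w \<xi>"
  proof (intro conic_chart.intro conic_chart_axioms.intro)
    show "flat_conn V G" by (rule G_flat_conn)
    show "G x u v = G x v u" if "x \<in> V" for x u v
      using torsionfree \<kappa>0 kV(1)[OF that] by (simp add: torsionfree_def G_def)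
  qed (fact w_smooth w_herm w_par 1 2)+
  then show thesis by (rule that)
qed

end

end

section \<open>Local models\<close>

context conic_Kaehler begin

context
  fixes \<kappa>0 and N U :: "(complex^'n) set" and z g :: "complex^'n \<Rightarrow> complex^'n" and F :: "complex^'n \<Rightarrow> complex"
  assumes \<kappa>0: "\<kappa>0 \<in> A"
    and N_sub: "N \<subseteq> snd \<kappa>0 ` fst \<kappa>0" and special: "special_coords (G \<kappa>0) (w \<kappa>0) N U z g F"
begin

interpretation S: special_coords "G \<kappa>0" "w \<kappa>0" N U z g F by (rule special)

interpretation F: nondeg_holo_fun F U
  by unfold_locales (rule S.open_U, rule S.F_holo, rule S.F_nondeg)

abbreviation "h0 \<equiv> snd \<kappa>0"
abbreviation "k0 \<equiv> chart_inv \<kappa>0"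
definition "M = {p \<in> fst \<kappa>0. h0 p \<in> N}"
definition "f p = z (h0 p)"

lemma openin_M: "openin X M"
  unfolding M_def by (rule openin_preimage[OF \<kappa>0 S.open_N])

lemma M_sub: "M \<subseteq> fst \<kappa>0" "M \<subseteq> topspace X"
  using openin_subset[OF openin_M] by (auto simp: M_def)

lemma zg: "x \<in> N \<Longrightarrow> z x \<in> U" "x \<in> N \<Longrightarrow> g (z x) = x" "y \<in> U \<Longrightarrow> g y \<in> N" "y \<in> U \<Longrightarrow> z (g y) = y"
  using S.hom by (auto simp: homeomorphism_def)

lemma k0: "x \<in> N \<Longrightarrow> k0 x \<in> M" "x \<in> N \<Longrightarrow> h0 (k0 x) = x" "p \<in> M \<Longrightarrow> k0 (h0 p) = p" "p \<in> M \<Longrightarrow> h0 p \<in> N"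
  using N_sub \<kappa>0 by (auto simp: M_def subset_iff)

lemma f_homeomorphic: "homeomorphic_map (subtopology X M) (top_of_set U) f"
proof -
  let ?V = "h0 ` fst \<kappa>0"
  obtain k' where k': "homeomorphic_maps (subtopology X (fst \<kappa>0)) (top_of_set ?V) h0 k'"
    using chart(4)[OF \<kappa>0] homeomorphic_map_maps by blast
  have h_cont: "continuous_map (subtopology X M) (top_of_set N) h0"
  proof -
    have "continuous_map (subtopology X (fst \<kappa>0)) euclidean h0"
      using k' continuous_map_into_fulltopology by (auto simp: homeomorphic_maps_def)
    then have "continuous_map (subtopology X M) euclidean h0"
      using continuous_map_from_subtopology_mono M_sub(1) by blast
    then show ?thesis using k0(4) by (auto simp: continuous_map_in_subtopology topspace_subtopology)
  qed
  have k_cont: "continuous_map (top_of_set N) (subtopology X M) k0"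
  proof -
    have "continuous_map (top_of_set ?V) X k'"
      using k' continuous_map_into_fulltopology by (auto simp: homeomorphic_maps_def)
    then have "continuous_map (top_of_set N) X k'"
      using continuous_map_from_subtopology_mono N_sub by blast
    \<comment> \<open>\<open>chart_inv\<close> is only a choice of preimages; its continuity comes
      from agreement with the topological inverse \<open>k'\<close>.\<close>
    moreover have "k' x = k0 x" if "x \<in> N" for x
    proof -
      have "x \<in> ?V" using that N_sub by auto
      then obtain p where "p \<in> fst \<kappa>0" "x = h0 p" by auto
      moreover have "k' (h0 p) = p" if "p \<in> fst \<kappa>0" for p
        using k' that chart(3)[OF \<kappa>0] by (auto simp: homeomorphic_maps_def topspace_subtopology subset_iff)
      ultimately show ?thesis using \<kappa>0 by simp
    qed
    ultimately have "continuous_map (top_of_set N) X k0"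
      by (metis (no_types, lifting) continuous_map_eq topspace_euclidean_subtopology)
    then show ?thesis using k0(1) by (auto simp: continuous_map_in_subtopology)
  qed
  have "continuous_map (top_of_set N) (top_of_set U) z" "continuous_map (top_of_set U) (top_of_set N) g"
    using S.hom by (auto simp: homeomorphism_def)
  then have "continuous_map (subtopology X M) (top_of_set U) (z \<circ> h0)" "continuous_map (top_of_set U) (subtopology X M) (k0 \<circ> g)"
    using continuous_map_compose h_cont k_cont by blast+
  then have "homeomorphic_maps (subtopology X M) (top_of_set U) f (k0 \<circ> g)"
    using k0 zg by (auto simp: homeomorphic_maps_def f_def[abs_def] o_def topspace_subtopology)
  then show ?thesis using homeomorphic_map_maps by blast
qed

lemma inv_f: "y \<in> U \<Longrightarrow> inv_into M f y = k0 (g y)"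
proof -
  assume y: "y \<in> U"
  have "inj_on f M" by (rule inj_on_inverseI[of _ "\<lambda>y. k0 (g y)"]) (simp add: f_def zg k0)
  then show ?thesis by (rule inv_into_f_eq) (use y in \<open>simp_all add: k0 zg f_def\<close>)
qed

lemma f_holo: "holo_map_on A (std_atlas U) M f"
  unfolding holo_map_on_def std_atlas_def
proof (intro ballI)
  fix \<kappa> and \<kappa>' :: "(complex^'n, 'n) chart" assume \<kappa>: "\<kappa> \<in> A" and "\<kappa>' \<in> {(U, id)}"
  then have \<kappa>': "\<kappa>' = (U, id)" by simp
  let ?R = "snd \<kappa> ` {p \<in> fst \<kappa> \<inter> M. f p \<in> fst \<kappa>'}"
  have "holo_on J J (transition \<kappa> \<kappa>0) ?R"
    by (rule holo_on_subset[OF transition_holo[OF \<kappa> \<kappa>0]]) (use M_sub in auto)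
  then have "holo_on J J (\<lambda>x. z (transition \<kappa> \<kappa>0 x)) ?R"
    by (rule holo_on_compose[OF _ S.z_holo]) (use \<kappa> k0 in \<open>auto simp: transition_def\<close>)
  then show "holo_on J J (snd \<kappa>' \<circ> f \<circ> chart_inv \<kappa>) ?R"
    by (simp add: \<kappa>' o_def f_def transition_def)
qed

lemma inv_f_holo: "holo_map_on (std_atlas U) A U (inv_into M f)"
  unfolding holo_map_on_def std_atlas_def
proof (intro ballI)
  fix \<kappa> \<kappa>' assume "\<kappa> \<in> {(U, id :: complex^'n \<Rightarrow> complex^'n)}" and \<kappa>': "\<kappa>' \<in> A"
  then have \<kappa>: "\<kappa> = (U, id)" by simp
  let ?R = "snd \<kappa> ` {y \<in> fst \<kappa> \<inter> U. inv_into M f y \<in> fst \<kappa>'}"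
  \<comment> \<open>Written as a preimage under \<open>g\<close>, the domain is seen to be open,
    which \<open>holo_on_cong\<close> requires.\<close>
  have R: "?R = U \<inter> g -` (h0 ` (fst \<kappa>0 \<inter> fst \<kappa>'))"
  proof -
    have "k0 (g y) \<in> fst \<kappa>' \<longleftrightarrow> g y \<in> h0 ` (fst \<kappa>0 \<inter> fst \<kappa>')" if y: "y \<in> U" for y
    proof -
      obtain x where x: "x \<in> fst \<kappa>0" "g y = h0 x" using zg(3)[OF y] N_sub by auto
      then show ?thesis
        using \<kappa>0 inj_on_image_mem_iff[OF inj_chart[OF \<kappa>0] x(1), of "fst \<kappa>0 \<inter> fst \<kappa>'"] by simp
    qed
    then show ?thesis using \<kappa>0 by (auto simp: \<kappa> inv_f)
  qed
  have oR: "open ?R"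
    unfolding R by (intro continuous_open_preimage Jc.holo_on_continuous[OF S.g_holo] S.open_U open_overlap \<kappa>0 \<kappa>')
  have hR: "holo_on J J (\<lambda>y. transition \<kappa>0 \<kappa>' (g y)) ?R"
    unfolding R
    by (rule holo_on_compose[OF holo_on_subset[OF S.g_holo] transition_holo[OF \<kappa>0 \<kappa>']]) auto
  have eR: "transition \<kappa>0 \<kappa>' (g y) = (snd \<kappa>' \<circ> inv_into M f \<circ> chart_inv \<kappa>) y" if "y \<in> ?R" for y
    using that by (auto simp: \<kappa> inv_f transition_def Defs.chart_inv_def inv_into_f_f[of id, simplified])
  show "holo_on J J (snd \<kappa>' \<circ> inv_into M f \<circ> chart_inv \<kappa>) ?R"
    by (rule holo_on_cong[OF oR eR hR])
qed

lemma z_smooth: "smooth_on z N"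
  by (rule Jc.holo_on_vec_imp_smooth[OF S.open_N S.z_holo])

lemma fd_\<psi>z: "x \<in> N \<Longrightarrow> fd (\<lambda>x. F.\<psi> (z x)) x u = fd F.\<psi> (z x) (fd z x u)"
proof -
  assume x: "x \<in> N"
  from fd_compose[OF smooth_on_has_derivative[OF z_smooth x], of F.\<psi>,
      OF smooth_on_has_derivative[OF F.\<psi>_smooth zg(1)[OF x]]]
  show ?thesis by simp
qed

text \<open>The two sides are compared after applying the injective derivative of
  \<open>\<psi>\<close>: the second derivative of \<open>\<psi>\<close> composed with
  \<open>z\<close> is expanded, with \<open>conn_eq\<close> for \<open>G\<close> and the defining
  equation of the induced connection for \<open>\<Delta>\<close>.\<close>

lemma base_conn:
  assumes "induced_connection (dF F) U \<Delta>" "x \<in> N"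
  shows "\<Delta> (U, id) (z x) (fd z x u) (fd z x v) = fd z x (G \<kappa>0 x u v) - fd (\<lambda>y. fd z y v) x u"
proof (rule F.inj_d\<psi>[OF zg(1)[OF assms(2)]])
  note lin = F.linear_d\<psi>[OF zg(1)[OF assms(2)]]
  have "fd F.\<psi> (z x) (fd z x (G \<kappa>0 x u v)) = fd (\<lambda>y. fd (\<lambda>x. F.\<psi> (z x)) y v) x u"
    using S.conn_eq[OF assms(2), of u v] fd_\<psi>z[OF assms(2)] by simp
  also have "\<dots> = fd (\<lambda>y. fd F.\<psi> y (fd z x v)) (z x) (fd z x u) + fd F.\<psi> (z x) (fd (\<lambda>y. fd z y v) x u)"
    by (rule fd_fd_compose[OF S.open_N z_smooth F.\<psi>_smooth _ assms(2)]) (use zg in auto)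
  also have "fd (\<lambda>y. fd F.\<psi> y (fd z x v)) (z x) (fd z x u) = fd F.\<psi> (z x) (\<Delta> (U, id) (z x) (fd z x u) (fd z x v))"
    using assms(1) zg(1)[OF assms(2)] by (simp add: F.induced_connection_iff)
  finally show "fd F.\<psi> (z x) (\<Delta> (U, id) (z x) (fd z x u) (fd z x v)) =
      fd F.\<psi> (z x) (fd z x (G \<kappa>0 x u v) - fd (\<lambda>y. fd z y v) x u)"
    by (simp add: linear_diff[OF lin])
qed

context
  fixes \<kappa> p assumes \<kappa>: "\<kappa> \<in> A" and p: "p \<in> fst \<kappa> \<inter> M"
begin

abbreviation "t \<equiv> transition \<kappa> \<kappa>0"
abbreviation "x0 \<equiv> snd \<kappa> p"

lemma region: "open (snd \<kappa> ` (fst \<kappa> \<inter> M))" "x0 \<in> snd \<kappa> ` (fst \<kappa> \<inter> M)" "smooth_on t (snd \<kappa> ` (fst \<kappa> \<inter> M))"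
    "t ` (snd \<kappa> ` (fst \<kappa> \<inter> M)) \<subseteq> N" "t x0 = h0 p" "h0 p \<in> N" "p \<in> fst \<kappa>" "p \<in> fst \<kappa>0" "k0 (h0 p) = p"
proof -
  show "open (snd \<kappa> ` (fst \<kappa> \<inter> M))" by (rule open_image[OF \<kappa> openin_M])
  show "smooth_on t (snd \<kappa> ` (fst \<kappa> \<inter> M))"
    by (rule smooth_on_subset[OF transition_smooth[OF \<kappa> \<kappa>0]]) (use M_sub in auto)
  show "t ` (snd \<kappa> ` (fst \<kappa> \<inter> M)) \<subseteq> N" "t x0 = h0 p"
    using \<kappa> p k0 by (auto simp: transition_def)
qed (use p k0 M_sub in auto)

lemma f_chart: "(\<lambda>x. snd (U, id) (f (chart_inv \<kappa> x))) = (\<lambda>x. z (t x))"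
  by (simp add: f_def transition_def)

lemma fd_zt: "fd (\<lambda>x. z (t x)) x0 u = fd z (h0 p) (fd t x0 u)"
  using fd_compose[OF smooth_on_has_derivative[OF region(3,2)], of z "fd z (t x0)"]
    smooth_on_has_derivative[OF z_smooth region(6)] region(5) by simp

text \<open>In the chart \<open>\<kappa>\<close> the map \<open>f\<close> is the coordinate change
  to \<open>\<kappa>0\<close> followed by \<open>z\<close>. The transformation laws of the two
  factors compose, and the inhomogeneous terms add up by the chain rule for second
  derivatives.\<close>

lemma f_conn:
  assumes \<Delta>: "induced_connection (dF F) U \<Delta>"
  shows "conn_related \<kappa> (U, id) f (\<Gamma> \<kappa>) (\<Delta> (U, id)) p"
  unfolding conn_related_iff[OF \<kappa> region(7)] f_chart
proof (intro allI)
  fix u v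
  have "fd (\<lambda>y. fd (\<lambda>x. z (t x)) y v) x0 u =
      fd (\<lambda>y. fd z y (fd t x0 v)) (t x0) (fd t x0 u) + fd z (t x0) (fd (\<lambda>y. fd t y v) x0 u)"
    by (rule fd_fd_compose[OF region(1,3) z_smooth region(4,2)])
  moreover have "G \<kappa>0 (h0 p) (fd t x0 u) (fd t x0 v) = fd t x0 (\<Gamma> \<kappa> p u v) - fd (\<lambda>y. fd t y v) x0 u"
    using conn_trans[OF \<kappa> \<kappa>0 region(7,8), of u v] region(9) by (simp add: G_def[OF \<kappa>0])
  moreover have "linear (fd z (h0 p))"
    by (rule has_derivative_linear[OF smooth_on_has_derivative[OF z_smooth region(6)]])
  ultimately show "\<Delta> (U, id) (f p) (fd (\<lambda>x. z (t x)) x0 u) (fd (\<lambda>x. z (t x)) x0 v) =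
      fd (\<lambda>x. z (t x)) x0 (\<Gamma> \<kappa> p u v) - fd (\<lambda>y. fd (\<lambda>x. z (t x)) y v) x0 u"
    using base_conn[OF \<Delta> region(6), of "fd t x0 u" "fd t x0 v"]
    by (simp add: fd_zt region(5) f_def linear_diff)
qed

lemma f_form: "form_related \<kappa> (U, id) f (\<omega> \<kappa>) (induced_form (dF F) (U, id)) p"
  unfolding form_related_def
proof (intro allI)
  fix u v
  have pd: "pd \<kappa> (snd (U, id) \<circ> f) p u = fd z (h0 p) (fd t x0 u)" for u
    unfolding pd_def o_def f_chart by (rule fd_zt)
  have "\<omega> \<kappa> p u v = w \<kappa>0 (h0 p) (fd t x0 u) (fd t x0 v)"
    using form_trans[OF \<kappa> \<kappa>0 region(7,8), of u v] region(9) by (simp add: w_def[OF \<kappa>0])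
  then show "induced_form (dF F) (U, id) (f p) (pd \<kappa> (snd (U, id) \<circ> f) p u) (pd \<kappa> (snd (U, id) \<circ> f) p v) = \<omega> \<kappa> p u v"
    unfolding pd using zg(1)[OF region(6)] S.form_eq[OF region(6)] fd_\<psi>z[OF region(6)]
    by (simp add: F.induced_form_eq f_def)
qed

end

lemma f_iso:
  assumes "induced_connection (dF F) U \<Delta>"
  shows "conic_Kaehler_iso_on M X A \<Gamma> \<omega> (top_of_set U) (std_atlas U) \<Delta> (induced_form (dF F)) f"
  unfolding conic_Kaehler_iso_on_def
  using f_homeomorphic f_holo inv_f_holo f_conn[OF _ _ assms] f_form
  by (simp add: std_atlas_def)

end

theorem local_model:
  assumes "p \<in> topspace X"
  shows "\<exists>N U (F :: complex^'n \<Rightarrow> complex) \<Delta> f.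
             openin X N \<and> p \<in> N \<and>
             open U \<and> holo_fun_on F U \<and> nondegenerate_fun F U \<and> conic_fun F U \<and>
             induced_connection (dF F) U \<Delta> \<and>
             conic_Kaehler_iso_on N X A \<Gamma> \<omega>
               (top_of_set U) (std_atlas U) \<Delta> (induced_form (dF F)) f"
proof -
  have "p \<in> (\<Union>\<kappa>\<in>A. fst \<kappa>)"
    using complex_manifold assms by (simp add: complex_manifold_def)
  then obtain \<kappa>0 where \<kappa>0: "\<kappa>0 \<in> A" "p \<in> fst \<kappa>0"
    by blast
  show ?thesis
  proof (rule conic_chart_exists[OF \<kappa>0(1)])
    fix \<xi> assume cc: "conic_chart (snd \<kappa>0 ` fst \<kappa>0) (G \<kappa>0) (w \<kappa>0) \<xi>"
    show ?thesis
    proof (rule conic_chart.conic_normal_form[OF cc imageI[OF \<kappa>0(2)]])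
      fix N U z g F
      assume N: "N \<subseteq> snd \<kappa>0 ` fst \<kappa>0" "snd \<kappa>0 p \<in> N" and S: "special_coords (G \<kappa>0) (w \<kappa>0) N U z g F"
        and conic: "conic_fun F U"
      interpret special_coords "G \<kappa>0" "w \<kappa>0" N U z g F by (rule S)
      interpret F: nondeg_holo_fun F U
        by unfold_locales (rule open_U, rule F_holo, rule F_nondeg)
      note a = \<kappa>0(1) N(1) S
      have "conic_Kaehler_iso_on (M \<kappa>0 N) X A \<Gamma> \<omega> (top_of_set U) (std_atlas U) (\<lambda>\<kappa>. F.christoffel) (induced_form (dF F)) (f \<kappa>0 z)"
        by (rule f_iso[OF a F.induced_connection_exists])
      moreover have "openin X (M \<kappa>0 N)" by (rule openin_M[OF a])
      moreover have "p \<in> M \<kappa>0 N" using \<kappa>0(2) N(2) by (simp add: M_def[OF a])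
      ultimately show ?thesis
        using open_U F_holo F_nondeg conic F.induced_connection_exists unfolding holo_fun_on_def by blast
    qed
  qed
qed

end

theorem corollary6:
  shows
    "(\<forall>(F :: complex^'n \<Rightarrow> complex) U.
        open U \<longrightarrow> holo_fun_on F U \<longrightarrow> nondegenerate_fun F U \<longrightarrow> conic_fun F U \<longrightarrow>
          holo_immersion_on (dF F) U \<and> totally_complex_on (dF F) U \<and>
          (\<exists>\<Gamma>. induced_connection (dF F) U \<Gamma>) \<and>
          (\<forall>\<Gamma> \<Gamma>'. induced_connection (dF F) U \<Gamma> \<longrightarrow> induced_connection (dF F) U \<Gamma>' \<longrightarrow>
             (\<forall>z\<in>U. \<Gamma> (U, id) z = \<Gamma>' (U, id) z)) \<and>
          (\<forall>\<Gamma>. induced_connection (dF F) U \<Gamma> \<longrightarrow>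
             conic_Kaehler_manifold (top_of_set U) (std_atlas U) \<Gamma> (induced_form (dF F)))) \<and>
     (\<forall>(X :: 'a topology) (A :: ('a, 'n) chart set) \<Gamma> \<omega>.
        conic_Kaehler_manifold X A \<Gamma> \<omega> \<longrightarrow>
          (\<forall>p\<in>topspace X. \<exists>N U (F :: complex^'n \<Rightarrow> complex) \<Delta> f.
             openin X N \<and> p \<in> N \<and>
             open U \<and> holo_fun_on F U \<and> nondegenerate_fun F U \<and> conic_fun F U \<and>
             induced_connection (dF F) U \<Delta> \<and>
             conic_Kaehler_iso_on N X A \<Gamma> \<omega>
               (top_of_set U) (std_atlas U) \<Delta> (induced_form (dF F)) f))"
proof (rule conjI, goal_cases)
  case 1
  show ?case
  proof (intro allI impI, goal_cases)
    case (1 F U)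
    then interpret conic_holo_fun F U
      by unfold_locales (simp_all add: holo_fun_on_def)
    show ?case
      using dF_immersion dF_totally_complex induced_connection_exists induced_connection_unique conic_Kaehler_std by blast
  qed
next
  case 2
  show ?case
    by (intro allI impI ballI) (rule conic_Kaehler.local_model[OF conic_Kaehler.intro])
qed

end
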